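(* Let $c_1>|c_2|$. All four equilibria in $\mathfrak{t}_2\cap\operatorname{Orb}_{c_1;c_2}$ of the $\mathfrak{so}(4)$ rigid body equations are non-degenerate of center-saddle type and therefore unstable on the corresponding adjoint orbit $\operatorname{Orb}_{c_1;c_2}$. Thus these equilibria are also unstable for the Lie-Poisson dynamics on $\mathfrak{so}(4)$.
   Context: Let $\lambda_1>\lambda_2>\lambda_3>\lambda_4$ be real numbers with $\lambda_i+\lambda_j>0$ for $i\ne j$, and $J=\operatorname{diag}(\lambda_1,\lambda_2,\lambda_3,\lambda_4)$. The Lie-Poisson dynamics of the $\mathfrak{so}(4)$ rigid body is $\dot M=[M,\Omega]$ on $\mathfrak{so}(4)$ (real antisymmetric $4\times4$ matrices), where $\Omega\in\mathfrak{so}(4)$ is determined by $M=J\Omega+\Omega J$. Write $$M=\begin{bmatrix}0&-x_3&x_2&y_1\\ x_3&0&-x_1&y_2\\ -x_2&x_1&0&y_3\\ -y_1&-y_2&-y_3&0\end{bmatrix}.$$ The following are constants of motion: $C_1=\frac12(\sum x_i^2+\sum y_i^2)$, $C_2=\sum x_iy_i$ (Casimirs), $$H=\tfrac12\left(\tfrac{x_1^2}{\lambda_2+\lambda_3}+\tfrac{x_2^2}{\lambda_1+\lambda_3}+\tfrac{x_3^2}{\lambda_1+\lambda_2}+\tfrac{y_1^2}{\lambda_1+\lambda_4}+\tfrac{y_2^2}{\lambda_2+\lambda_4}+\tfrac{y_3^2}{\lambda_3+\lambda_4}\right),$$ $$I=(\lambda_2^2+\lambda_3^2)x_1^2+(\lambda_1^2+\lambda_3^2)x_2^2+(\lambda_1^2+\lambda_2^2)x_3^2+(\lambda_1^2+\lambda_4^2)y_1^2+(\lambda_2^2+\lambda_4^2)y_2^2+(\lambda_3^2+\lambda_4^2)y_3^2.$$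 For $c_1>|c_2|$, $\operatorname{Orb}_{c_1;c_2}=\{M\mid C_1(M)=c_1,\,C_2(M)=c_2\}$ is a four-dimensional regular adjoint orbit of $\operatorname{SO}(4)$, invariant under the dynamics, with orbit symplectic form $\omega$, $\omega(M)([M,X],[M,Y])=\frac12\operatorname{Trace}(M[X,Y])$. For a function $F$ on $\mathfrak{so}(4)$, the Hamiltonian vector field of $F|_{\operatorname{Orb}_{c_1;c_2}}$ is $X_{F|_{\operatorname{Orb}_{c_1;c_2}}}(M)=[M,\nabla F(M)]$, with the gradient taken relative to $\langle X,Y\rangle=-\frac12\operatorname{Trace}(XY)$; for $F=H$ this is the restriction of the rigid body equation. $M^2_{p,q}$ is the matrix with $x_2=p$, $y_2=q$, $x_1=x_3=y_1=y_3=0$, and $\mathfrak{t}_2=\{M^2_{p,q}\mid p,q\in\mathbb{R}\}$. The set $\mathfrak{t}_2\cap\operatorname{Orb}_{c_1;c_2}$ consists of the four equilibria $M^2_{a,b},M^2_{-a,-b},M^2_{b,a},M^2_{-b,-a}$ with $a=\frac{1}{\sqrt2}(\sqrt{c_1+c_2}+\sqrt{c_1-c_2})$, $b=\frac{1}{\sqrt2}(\sqrt{c_1+c_2}-\sqrt{c_1-c_2})$. An equilibrium $M\in\operatorname{Orb}_{c_1;c_2}$ at which the differentials of both $H|_{\operatorname{Orb}_{c_1;c_2}}$ and $I|_{\operatorname{Orb}_{c_1;c_2}}$ vanish is called non-degenerate if the (commuting) linearizations $\mathbf{D}X_{H|_{\operatorname{Orb}_{c_1;c_2}}}(M)$ and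 $\mathbf{D}X_{I|_{\operatorname{Orb}_{c_1;c_2}}}(M)$ generate a Cartan subalgebra of the Lie algebra of infinitesimally symplectic linear maps of $(T_M\operatorname{Orb}_{c_1;c_2},\omega(M))$. It is of center-saddle type if this Cartan subalgebra is conjugate to the algebra of matrices $$\begin{bmatrix}-A&0&0&0\\0&0&0&-B\\0&0&A&0\\0&B&0&0\end{bmatrix},\quad A,B\in\mathbb{R}$$ (eigenvalues $\pm A,\pm iB$). Unstable means not Lyapunov stable. *)

theory Defs
  imports "HOL-Analysis.Analysis"
begin

section \<open>The Lie algebra so(4) and the rigid body equations\<close>

type_synonym mat4 = "real^4^4"

definition comm :: "mat4 \<Rightarrow> mat4 \<Rightarrow> mat4" where
  "comm A B = A ** B - B ** A"

definition so4 :: "mat4 set" where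
  "so4 = {M. transpose M = - M}"

definition so4_mat :: "real \<Rightarrow> real \<Rightarrow> real \<Rightarrow> real \<Rightarrow> real \<Rightarrow> real \<Rightarrow> mat4" where
  "so4_mat x1 x2 x3 y1 y2 y3 = vector
    [vector [0, - x3, x2, y1],
     vector [x3, 0, - x1, y2],
     vector [- x2, x1, 0, y3],
     vector [- y1, - y2, - y3, 0]]"

text \<open>The coordinates \<open>x\<^sub>1,x\<^sub>2,x\<^sub>3\<close> and \<open>y\<^sub>1,y\<^sub>2,y\<^sub>3\<close> of a matrix of the form \<open>so4_mat\<close>.\<close>

definition xc :: "mat4 \<Rightarrow> real^3" where
  "xc M = vector [M$3$2, M$1$3, M$2$1]"

definition yc :: "mat4 \<Rightarrow> real^3" where
  "yc M = vector [M$1$4, M$2$4, M$3$4]"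

definition diag_mat :: "real^4 \<Rightarrow> mat4" where
  "diag_mat l = (\<chi> i j. if i = j then l$i else 0)"

text \<open>For \<open>M \<in> so4\<close> and \<open>l$i + l$j \<noteq> 0\<close> (\<open>i \<noteq> j\<close>) the matrix below exists and is unique,
  with entries \<open>M$i$j / (l$i + l$j)\<close> off the diagonal.\<close>

definition ang_vel :: "real^4 \<Rightarrow> mat4 \<Rightarrow> mat4" where
  "ang_vel l M = (THE W. W \<in> so4 \<and> M = diag_mat l ** W + W ** diag_mat l)"

definition rigid_body :: "real^4 \<Rightarrow> mat4 \<Rightarrow> mat4" where
  "rigid_body l M = comm M (ang_vel l M)"

definition C1 :: "mat4 \<Rightarrow> real" where
  "C1 M = 1/2 * ((\<Sum>i\<in>UNIV. (xc M $ i)\<^sup>2) + (\<Sum>i\<in>UNIV. (yc M $ i)\<^sup>2))"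

definition C2 :: "mat4 \<Rightarrow> real" where
  "C2 M = (\<Sum>i\<in>UNIV. xc M $ i * yc M $ i)"

definition H :: "real^4 \<Rightarrow> mat4 \<Rightarrow> real" where
  "H l M = 1/2 *
    ((xc M $ 1)\<^sup>2 / (l$2 + l$3) + (xc M $ 2)\<^sup>2 / (l$1 + l$3) + (xc M $ 3)\<^sup>2 / (l$1 + l$2)
   + (yc M $ 1)\<^sup>2 / (l$1 + l$4) + (yc M $ 2)\<^sup>2 / (l$2 + l$4) + (yc M $ 3)\<^sup>2 / (l$3 + l$4))"

definition I :: "real^4 \<Rightarrow> mat4 \<Rightarrow> real" where
  "I l M =
     ((l$2)\<^sup>2 + (l$3)\<^sup>2) * (xc M $ 1)\<^sup>2 + ((l$1)\<^sup>2 + (l$3)\<^sup>2) * (xc M $ 2)\<^sup>2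
   + ((l$1)\<^sup>2 + (l$2)\<^sup>2) * (xc M $ 3)\<^sup>2 + ((l$1)\<^sup>2 + (l$4)\<^sup>2) * (yc M $ 1)\<^sup>2
   + ((l$2)\<^sup>2 + (l$4)\<^sup>2) * (yc M $ 2)\<^sup>2 + ((l$3)\<^sup>2 + (l$4)\<^sup>2) * (yc M $ 3)\<^sup>2"

section \<open>Adjoint orbits\<close>

definition Orb :: "real \<Rightarrow> real \<Rightarrow> mat4 set" where
  "Orb c1 c2 = {M \<in> so4. C1 M = c1 \<and> C2 M = c2}"

definition M2 :: "real \<Rightarrow> real \<Rightarrow> mat4" where
  "M2 p q = so4_mat 0 p 0 0 q 0"

definition t2 :: "mat4 set" where
  "t2 = {M2 p q | p q. True}"

lemma vector_4_nth: "(vector [a,b,c,d] :: 'a::zero^4)$1 = a" "(vector [a,b,c,d]:: 'a^4)$2 = b"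
 "(vector [a,b,c,d]:: 'a^4)$3 = c" "(vector [a,b,c,d]:: 'a^4)$4 = d"
  unfolding vector_def by simp_all

lemma M2_coords: "xc (M2 p q) $ 1 = 0" "xc (M2 p q) $ 2 = p" "xc (M2 p q) $ 3 = 0"
  "yc (M2 p q) $ 1 = 0" "yc (M2 p q) $ 2 = q" "yc (M2 p q) $ 3 = 0"
  by (simp_all add: M2_def so4_mat_def xc_def yc_def vector_4_nth)
lemma so4_mat_in_so4: "so4_mat x1 x2 x3 y1 y2 y3 \<in> so4"
  by (simp add: so4_def so4_mat_def vec_eq_iff forall_4 transpose_def vector_4_nth)
lemma M2_inj: "M2 p q = M2 r s \<longleftrightarrow> p = r \<and> q = s"
  using M2_coords by metis

lemma t2_Int_Orb:
  fixes c1 c2 :: real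
  assumes "c1 > \<bar>c2\<bar>"
  defines "a \<equiv> (sqrt (c1 + c2) + sqrt (c1 - c2)) / sqrt 2"
    and "b \<equiv> (sqrt (c1 + c2) - sqrt (c1 - c2)) / sqrt 2"
  shows "t2 \<inter> Orb c1 c2 = {M2 a b, M2 (-a) (-b), M2 b a, M2 (-b) (-a)}"
    and "card (t2 \<inter> Orb c1 c2) = 4"
proof -
  have ab: "a\<^sup>2 + b\<^sup>2 = 2*c1" "a*b = c2"
    using assms(1) by (auto simp: a_def b_def power_divide power2_sum power2_diff field_simps)
  have pos: "sqrt (c1+c2) > 0" "sqrt (c1-c2) > 0" using assms(1) by auto
  hence apos: "a > 0" "a - b > 0" "a + b > 0"
    using add_pos_pos[OF pos] by (auto simp: a_def b_def field_simps)
  have mem: "M2 p q \<in> Orb c1 c2 \<longleftrightarrow> p\<^sup>2+q\<^sup>2 = 2*c1 \<and> p*q = c2" for p q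
    using so4_mat_in_so4 by (auto simp: Orb_def C1_def C2_def sum_3 M2_coords) (auto simp: M2_def)
  have sol: "(p\<^sup>2+q\<^sup>2 = 2*c1 \<and> p*q = c2) \<longleftrightarrow> (p,q) \<in> {(a,b),(-a,-b),(b,a),(-b,-a)}" (is "?L \<longleftrightarrow> ?R") for p q
  proof
    assume ?L
    hence "(p+q)^2 = (a+b)^2" "(p-q)^2 = (a-b)^2" using ab by (auto simp: power2_sum power2_diff)
    thus ?R unfolding power2_eq_iff by (auto)
  next
    assume ?R thus ?L using ab by (auto simp: algebra_simps)
  qed
  show eq: "t2 \<inter> Orb c1 c2 = {M2 a b, M2 (-a) (-b), M2 b a, M2 (-b) (-a)}"
    using mem sol by (auto simp: t2_def)
  show "card (t2 \<inter> Orb c1 c2) = 4" unfolding eq using apos by (simp add: M2_inj)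
qed

definition tangent_orb :: "mat4 \<Rightarrow> mat4 set" where
  "tangent_orb M = {comm M X | X. X \<in> so4}"

text \<open>The value does not depend on the choice of \<open>X\<close> and \<open>Y\<close>, since
  \<open>trace (M [X,Y]) = trace ([M,X] Y) = - trace ([M,Y] X)\<close>. Only arguments in
  \<open>tangent_orb M\<close> are meaningful.\<close>

definition orb_form :: "mat4 \<Rightarrow> mat4 \<Rightarrow> mat4 \<Rightarrow> real" where
  "orb_form M u v = (THE r. \<exists>X\<in>so4. \<exists>Y\<in>so4.
     u = comm M X \<and> v = comm M Y \<and> r = 1/2 * trace (M ** comm X Y))"

definition ip :: "mat4 \<Rightarrow> mat4 \<Rightarrow> real" where
  "ip X Y = - (1/2) * trace (X ** Y)"

text \<open>The gradient on \<open>so4\<close> with respect to \<open>ip\<close>, which is an inner product there.\<close>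

definition grad :: "(mat4 \<Rightarrow> real) \<Rightarrow> mat4 \<Rightarrow> mat4" where
  "grad F M = (THE G. G \<in> so4 \<and> (F has_derivative ip G) (at M within so4))"

definition ham_vf :: "(mat4 \<Rightarrow> real) \<Rightarrow> mat4 \<Rightarrow> mat4" where
  "ham_vf F M = comm M (grad F M)"

section \<open>Lie algebras of endomorphisms of a subspace\<close>

text \<open>Linear endomorphisms of a subspace \<open>T\<close> are represented by maps of the ambient space
  that preserve \<open>T\<close> and vanish on its orthogonal complement. Restriction to \<open>T\<close> is an
  isomorphism of Lie algebras from \<open>endo T\<close> onto the endomorphisms of \<open>T\<close>.\<close>

definition endo :: "'a::euclidean_space set \<Rightarrow> ('a \<Rightarrow>\<^sub>L 'a) set" where
  "endo T = {f. (\<forall>v\<in>T. blinfun_apply f v \<in> T) \<and>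
                (\<forall>w. (\<forall>v\<in>T. orthogonal v w) \<longrightarrow> blinfun_apply f w = 0)}"

definition inf_symplectic ::
    "'a::euclidean_space set \<Rightarrow> ('a \<Rightarrow> 'a \<Rightarrow> real) \<Rightarrow> ('a \<Rightarrow>\<^sub>L 'a) set" where
  "inf_symplectic T \<omega> =
     {f \<in> endo T. \<forall>u\<in>T. \<forall>v\<in>T. \<omega> (blinfun_apply f u) v + \<omega> u (blinfun_apply f v) = 0}"

definition endo_comm ::
    "('a::real_normed_vector \<Rightarrow>\<^sub>L 'a) \<Rightarrow> ('a \<Rightarrow>\<^sub>L 'a) \<Rightarrow> ('a \<Rightarrow>\<^sub>L 'a)" where
  "endo_comm f g = (f o\<^sub>L g) - (g o\<^sub>L f)"

definition lie_closed :: "('a::real_normed_vector \<Rightarrow>\<^sub>L 'a) set \<Rightarrow> bool" where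
  "lie_closed h \<longleftrightarrow> subspace h \<and> (\<forall>f\<in>h. \<forall>g\<in>h. endo_comm f g \<in> h)"

primrec lower_central ::
    "('a::real_normed_vector \<Rightarrow>\<^sub>L 'a) set \<Rightarrow> nat \<Rightarrow> ('a \<Rightarrow>\<^sub>L 'a) set" where
  "lower_central h 0 = h"
| "lower_central h (Suc n) = span {endo_comm f g | f g. f \<in> h \<and> g \<in> lower_central h n}"

definition nilpotent_lie :: "('a::real_normed_vector \<Rightarrow>\<^sub>L 'a) set \<Rightarrow> bool" where
  "nilpotent_lie h \<longleftrightarrow> (\<exists>n. lower_central h n = {0})"

text \<open>A Cartan subalgebra is a nilpotent subalgebra that equals its own normalizer.\<close>

definition cartan_subalgebra ::
    "('a::real_normed_vector \<Rightarrow>\<^sub>L 'a) set \<Rightarrow> ('a \<Rightarrow>\<^sub>L 'a) set \<Rightarrow> bool" where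
  "cartan_subalgebra g h \<longleftrightarrow> lie_closed h \<and> h \<subseteq> g \<and> nilpotent_lie h \<and>
     {f \<in> g. \<forall>k\<in>h. endo_comm f k \<in> h} = h"

section \<open>Non-degenerate equilibria and center-saddles\<close>

text \<open>The linearization on \<open>tangent_orb M\<close> of a vector field on \<open>Orb c1 c2\<close>, at an equilibrium
  \<open>M\<close> in the orbit. The derivative is taken within the orbit, so it is determined on the
  tangent space, and \<open>endo\<close> fixes the extension to the ambient space.\<close>

definition linearization :: "real \<Rightarrow> real \<Rightarrow> (mat4 \<Rightarrow> mat4) \<Rightarrow> mat4 \<Rightarrow> (mat4 \<Rightarrow>\<^sub>L mat4)" where
  "linearization c1 c2 X M = (THE L. L \<in> endo (tangent_orb M) \<and>
     (X has_derivative blinfun_apply L) (at M within Orb c1 c2))"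

definition linearized_algebra :: "real^4 \<Rightarrow> real \<Rightarrow> real \<Rightarrow> mat4 \<Rightarrow> (mat4 \<Rightarrow>\<^sub>L mat4) set" where
  "linearized_algebra l c1 c2 M = lie_closed hull
     {linearization c1 c2 (ham_vf (H l)) M, linearization c1 c2 (ham_vf (I l)) M}"

definition nondegenerate :: "real^4 \<Rightarrow> real \<Rightarrow> real \<Rightarrow> mat4 \<Rightarrow> bool" where
  "nondegenerate l c1 c2 M \<longleftrightarrow>
     M \<in> Orb c1 c2 \<and> rigid_body l M = 0 \<and>
     (H l has_derivative (\<lambda>_. 0)) (at M within Orb c1 c2) \<and>
     (I l has_derivative (\<lambda>_. 0)) (at M within Orb c1 c2) \<and>
     cartan_subalgebra (inf_symplectic (tangent_orb M) (orb_form M)) (linearized_algebra l c1 c2 M)"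

definition center_saddle_mat :: "real \<Rightarrow> real \<Rightarrow> mat4" where
  "center_saddle_mat A B = vector
    [vector [- A, 0, 0, 0],
     vector [0, 0, 0, - B],
     vector [0, 0, A, 0],
     vector [0, B, 0, 0]]"

text \<open>The standard symplectic form on \<open>real^4\<close> in coordinates \<open>(q\<^sub>1,q\<^sub>2,p\<^sub>1,p\<^sub>2)\<close>. All the
  matrices \<open>center_saddle_mat A B\<close> are infinitesimally symplectic for it.\<close>

definition std_form :: "real^4 \<Rightarrow> real^4 \<Rightarrow> real" where
  "std_form u v = u$1 * v$3 + u$2 * v$4 - u$3 * v$1 - u$4 * v$2"

text \<open>Conjugacy is by a linear symplectic isomorphism from \<open>(real^4, std_form)\<close> onto the tangent
  space. The sign convention for \<open>std_form\<close> is immaterial: exchanging \<open>q\<^sub>i\<close> and \<open>p\<^sub>i\<close> reverses the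
  sign and preserves the algebra of matrices.\<close>

definition center_saddle :: "real^4 \<Rightarrow> real \<Rightarrow> real \<Rightarrow> mat4 \<Rightarrow> bool" where
  "center_saddle l c1 c2 M \<longleftrightarrow>
     (\<exists>\<phi> :: real^4 \<Rightarrow> mat4. linear \<phi> \<and> bij_betw \<phi> UNIV (tangent_orb M) \<and>
        (\<forall>u v. orb_form M (\<phi> u) (\<phi> v) = std_form u v) \<and>
        linearized_algebra l c1 c2 M =
          {f \<in> endo (tangent_orb M).
             \<exists>A B. \<forall>u. blinfun_apply f (\<phi> u) = \<phi> (center_saddle_mat A B *v u)})"

section \<open>Stability\<close>

definition solution_on :: "(mat4 \<Rightarrow> mat4) \<Rightarrow> mat4 set \<Rightarrow> (real \<Rightarrow> mat4) \<Rightarrow> bool" where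
  "solution_on X S \<gamma> \<longleftrightarrow>
     (\<forall>t\<ge>0. \<gamma> t \<in> S \<and> (\<gamma> has_vector_derivative X (\<gamma> t)) (at t within {0..}))"

definition lyapunov_stable :: "(mat4 \<Rightarrow> mat4) \<Rightarrow> mat4 set \<Rightarrow> mat4 \<Rightarrow> bool" where
  "lyapunov_stable X S p \<longleftrightarrow>
     (\<forall>\<epsilon>>0. \<exists>\<delta>>0. \<forall>\<gamma>. solution_on X S \<gamma> \<and> dist (\<gamma> 0) p < \<delta> \<longrightarrow> (\<forall>t\<ge>0. dist (\<gamma> t) p < \<epsilon>))"

end

theory Submission
  imports Defs
begin

text \<open>Write \<open>a\<^sub>i = (l$i)\<^sup>2\<close>. The whole proof rests on a one-parameter family of three-dimensional linear subspaces
of \<open>so4\<close>, called slices below. For \<open>\<mu>\<close> outside the open interval \<open>(a\<^sub>4, a\<^sub>1)\<close> choose weights \<open>e\<^sub>i\<close> with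
\<open>e\<^sub>i\<^sup>2 = \<bar>a\<^sub>i - \<mu>\<bar>\<close> and consider the matrices with coordinates
\<open>x = (e\<^sub>2e\<^sub>3w\<^sub>1, e\<^sub>1e\<^sub>3w\<^sub>2, e\<^sub>1e\<^sub>2w\<^sub>3)\<close> and \<open>y = (e\<^sub>1e\<^sub>4w\<^sub>1, e\<^sub>2e\<^sub>4w\<^sub>2, e\<^sub>3e\<^sub>4w\<^sub>3)\<close>.
For \<open>\<mu>\<close> in \<open>[a\<^sub>3, a\<^sub>2]\<close> take the same coordinates with the opposite sign of the last one.
Such a slice is invariant under the vector fields of \<open>H\<close> and of \<open>I\<close>, and both restrict to it as the same
three-dimensional Euler top, up to a constant speed factor: \<open>H_factor l \<mu>\<close> for \<open>H\<close> and \<open>- 2\<close> for \<open>I\<close>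
(\<open>quad_vf_slice_point\<close>, \<open>euler_top_factor_H\<close>, \<open>euler_top_factor_I\<close>).

The equilibrium \<open>M2 p q\<close> lies on the \<open>w\<^sub>2\<close>-axis of the slice of \<open>\<mu>\<close> exactly when \<open>\<mu>\<close> solves a quadratic equation.
One root lies in \<open>[a\<^sub>3, a\<^sub>2]\<close>, the other outside the open interval \<open>(a\<^sub>4, a\<^sub>1)\<close> (\<open>interlacing_roots\<close>). For the
outer root the \<open>w\<^sub>2\<close>-axis is the unstable middle axis of the top; for the inner root a sign in the equations of
the top changes and it is a stable axis. The tangent space of the orbit is the \<open>\<omega>\<close>-orthogonal sum of the two planes cut
out by the two slices, the linearizations of \<open>H\<close> and \<open>I\<close> respect this splitting, and a rescaling of
the eigenvectors gives a symplectic frame in which both have center-saddle form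
(\<open>center_saddle_frame\<close>). As \<open>H_factor l\<close> is injective and \<open>I\<close> has the same factor on both
slices, the two linearizations are independent, hence span the center-saddle algebra, which is its own
normalizer (\<open>cartan_center_saddle_algebra\<close>).

Instability does not follow from the linearization of \<open>H\<close> alone: \<open>H_factor l\<close> may vanish at the outer root, and
then the real eigenvalues of the linearization of \<open>H\<close> are zero and the outer slice consists of equilibria.
Explicit solutions give a proof that covers both cases. If the factor is nonzero, the outer
slice contains solutions asymptotic to \<open>M2 p q\<close> in the past, given by hyperbolic functions
(\<open>unstable_of_nonzero_rate\<close>). If it is zero, slices with a slightly smaller \<open>\<mu>\<close> meet the same orbit in curves
that pass close to \<open>M2 p q\<close>; on them the top moves, with a small but nonzero speed, and the solutions, in general
elliptic functions, travel a fixed distance away (\<open>unstable_of_zero_rate\<close>).\<close>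

section \<open>Coordinates on so(4)\<close>

lemma so4_mat_nth [simp]:
  "so4_mat x1 x2 x3 y1 y2 y3 $ 1 $ 1 = 0" "so4_mat x1 x2 x3 y1 y2 y3 $ 1 $ 2 = - x3"
  "so4_mat x1 x2 x3 y1 y2 y3 $ 1 $ 3 = x2" "so4_mat x1 x2 x3 y1 y2 y3 $ 1 $ 4 = y1"
  "so4_mat x1 x2 x3 y1 y2 y3 $ 2 $ 1 = x3" "so4_mat x1 x2 x3 y1 y2 y3 $ 2 $ 2 = 0"
  "so4_mat x1 x2 x3 y1 y2 y3 $ 2 $ 3 = - x1" "so4_mat x1 x2 x3 y1 y2 y3 $ 2 $ 4 = y2"
  "so4_mat x1 x2 x3 y1 y2 y3 $ 3 $ 1 = - x2" "so4_mat x1 x2 x3 y1 y2 y3 $ 3 $ 2 = x1"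
  "so4_mat x1 x2 x3 y1 y2 y3 $ 3 $ 3 = 0" "so4_mat x1 x2 x3 y1 y2 y3 $ 3 $ 4 = y3"
  "so4_mat x1 x2 x3 y1 y2 y3 $ 4 $ 1 = - y1" "so4_mat x1 x2 x3 y1 y2 y3 $ 4 $ 2 = - y2"
  "so4_mat x1 x2 x3 y1 y2 y3 $ 4 $ 3 = - y3" "so4_mat x1 x2 x3 y1 y2 y3 $ 4 $ 4 = 0"
  by (simp_all add: so4_mat_def vector_4_nth)

lemma xc_nth [simp]: "xc M $ 1 = M$3$2" "xc M $ 2 = M$1$3" "xc M $ 3 = M$2$1"
  and yc_nth [simp]: "yc M $ 1 = M$1$4" "yc M $ 2 = M$2$4" "yc M $ 3 = M$3$4"
  by (simp_all add: xc_def yc_def)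

lemma so4_iff: "M \<in> so4 \<longleftrightarrow> (\<forall>i j. M $ j $ i = - M $ i $ j)"
  by (simp add: so4_def vec_eq_iff transpose_def)

lemma so4_mat_cases:
  assumes "M \<in> so4"
  obtains x1 x2 x3 y1 y2 y3 where "M = so4_mat x1 x2 x3 y1 y2 y3"
proof
  have "M $ j $ i = - M $ i $ j" for i j
    using assms unfolding so4_iff by blast
  note anti = this
  have diag: "M $ i $ i = 0" for i using anti[of i i] by simp
  show "M = so4_mat (M$3$2) (M$1$3) (M$2$1) (M$1$4) (M$2$4) (M$3$4)"
    using anti[of 2 1] anti[of 1 3] anti[of 3 2] anti[of 1 4] anti[of 2 4] anti[of 3 4]
    by (simp add: vec_eq_iff forall_4 diag)
qed

lemma so4_mat_eq_iff:
  "so4_mat x1 x2 x3 y1 y2 y3 = so4_mat X1 X2 X3 Y1 Y2 Y3 \<longleftrightarrow>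
    x1 = X1 \<and> x2 = X2 \<and> x3 = X3 \<and> y1 = Y1 \<and> y2 = Y2 \<and> y3 = Y3"
  by (auto simp: vec_eq_iff forall_4)

lemma so4_mat_add:
  "so4_mat x1 x2 x3 y1 y2 y3 + so4_mat X1 X2 X3 Y1 Y2 Y3 =
   so4_mat (x1 + X1) (x2 + X2) (x3 + X3) (y1 + Y1) (y2 + Y2) (y3 + Y3)"
  by (simp add: vec_eq_iff forall_4)

lemma so4_mat_scaleR:
  "r *\<^sub>R so4_mat x1 x2 x3 y1 y2 y3 = so4_mat (r*x1) (r*x2) (r*x3) (r*y1) (r*y2) (r*y3)"
  by (simp add: vec_eq_iff forall_4)

lemma so4_mat_zero: "so4_mat 0 0 0 0 0 0 = 0"
  by (simp add: vec_eq_iff forall_4)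

lemma subspace_so4: "subspace so4"
proof -
  have "transpose (A + B) = transpose A + transpose B" "transpose (r *\<^sub>R A) = r *\<^sub>R transpose A"
    "transpose (0::mat4) = 0" for A B :: mat4 and r
    by (simp_all add: vec_eq_iff transpose_def)
  then show ?thesis by (simp add: subspace_def so4_def)
qed

lemma comm_so4_mat:
  "comm (so4_mat x1 x2 x3 y1 y2 y3) (so4_mat X1 X2 X3 Y1 Y2 Y3) =
   so4_mat (x2*X3 - x3*X2 + y2*Y3 - y3*Y2) (x3*X1 - x1*X3 + y3*Y1 - y1*Y3)
     (x1*X2 - x2*X1 + y1*Y2 - y2*Y1) (x2*Y3 - x3*Y2 + y2*X3 - y3*X2)
     (x3*Y1 - x1*Y3 + y3*X1 - y1*X3) (x1*Y2 - x2*Y1 + y1*X2 - y2*X1)"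
  by (simp add: vec_eq_iff forall_4 comm_def matrix_matrix_mult_def sum_4 algebra_simps)

lemma trace_mult_so4_mat:
  "trace (so4_mat x1 x2 x3 y1 y2 y3 ** so4_mat X1 X2 X3 Y1 Y2 Y3) =
   - 2 * (x1*X1 + x2*X2 + x3*X3 + y1*Y1 + y2*Y2 + y3*Y3)"
  by (simp add: trace_def matrix_matrix_mult_def sum_4 algebra_simps)

lemma ip_so4_mat:
  "ip (so4_mat x1 x2 x3 y1 y2 y3) (so4_mat X1 X2 X3 Y1 Y2 Y3) =
   x1*X1 + x2*X2 + x3*X3 + y1*Y1 + y2*Y2 + y3*Y3"
  by (simp add: ip_def trace_mult_so4_mat field_simps)

lemma C1_so4_mat: "C1 (so4_mat x1 x2 x3 y1 y2 y3) = 1/2 * (x1\<^sup>2 + x2\<^sup>2 + x3\<^sup>2 + y1\<^sup>2 + y2\<^sup>2 + y3\<^sup>2)"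
  and C2_so4_mat: "C2 (so4_mat x1 x2 x3 y1 y2 y3) = x1*y1 + x2*y2 + x3*y3"
  by (simp_all add: C1_def C2_def sum_3)

lemma so4_mat_in_Orb_iff:
  "so4_mat x1 x2 x3 y1 y2 y3 \<in> Orb c1 c2 \<longleftrightarrow>
   x1\<^sup>2 + x2\<^sup>2 + x3\<^sup>2 + y1\<^sup>2 + y2\<^sup>2 + y3\<^sup>2 = 2 * c1 \<and> x1*y1 + x2*y2 + x3*y3 = c2"
  by (auto simp: Orb_def so4_mat_in_so4 C1_so4_mat C2_so4_mat)

lemma M2_in_Orb_iff: "M2 p q \<in> Orb c1 c2 \<longleftrightarrow> p\<^sup>2 + q\<^sup>2 = 2 * c1 \<and> p * q = c2"
  by (simp add: M2_def so4_mat_in_Orb_iff)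

lemma so4_mat_expand:
  "so4_mat x1 x2 x3 y1 y2 y3 =
      x1 *\<^sub>R so4_mat 1 0 0 0 0 0 + x2 *\<^sub>R so4_mat 0 1 0 0 0 0 + x3 *\<^sub>R so4_mat 0 0 1 0 0 0
    + y1 *\<^sub>R so4_mat 0 0 0 1 0 0 + y2 *\<^sub>R so4_mat 0 0 0 0 1 0 + y3 *\<^sub>R so4_mat 0 0 0 0 0 1"
  by (simp add: so4_mat_scaleR so4_mat_add)

lemma has_derivative_so4_mat:
  assumes "(x1 has_derivative x1') F" "(x2 has_derivative x2') F" "(x3 has_derivative x3') F"
    "(y1 has_derivative y1') F" "(y2 has_derivative y2') F" "(y3 has_derivative y3') F"
  shows "((\<lambda>u. so4_mat (x1 u) (x2 u) (x3 u) (y1 u) (y2 u) (y3 u)) has_derivative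
     (\<lambda>u. so4_mat (x1' u) (x2' u) (x3' u) (y1' u) (y2' u) (y3' u))) F"
  unfolding so4_mat_expand[of "x1 _"] so4_mat_expand[of "x1' _"]
  by (intro derivative_intros assms)

lemma bounded_linear_so4_mat:
  assumes "bounded_linear x1" "bounded_linear x2" "bounded_linear x3"
    "bounded_linear y1" "bounded_linear y2" "bounded_linear y3"
  shows "bounded_linear (\<lambda>u. so4_mat (x1 u) (x2 u) (x3 u) (y1 u) (y2 u) (y3 u))"
  unfolding so4_mat_expand[of "x1 _"]
  by (intro bounded_linear_add bounded_linear_compose[OF bounded_linear_scaleR_left] assms)

lemma tendsto_so4_mat:
  assumes "(x1 \<longlongrightarrow> a1) F" "(x2 \<longlongrightarrow> a2) F" "(x3 \<longlongrightarrow> a3) F"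
    "(y1 \<longlongrightarrow> b1) F" "(y2 \<longlongrightarrow> b2) F" "(y3 \<longlongrightarrow> b3) F"
  shows "((\<lambda>u. so4_mat (x1 u) (x2 u) (x3 u) (y1 u) (y2 u) (y3 u)) \<longlongrightarrow> so4_mat a1 a2 a3 b1 b2 b3) F"
  unfolding so4_mat_expand[of "x1 _"] so4_mat_expand[of a1]
  by (intro tendsto_intros assms)

section \<open>Diagonal quadratic Hamiltonians\<close>

text \<open>Both \<open>H\<close> and \<open>I\<close> are quadratic forms without mixed terms. Treating them together, with a coefficient
\<open>c i j\<close> for each entry \<open>M$i$j\<close>, makes every later statement about vector fields and linearizations
available for both at once. Only coefficients with \<open>i < j\<close> enter.\<close>

definition inertia :: "(4 \<Rightarrow> 4 \<Rightarrow> real) \<Rightarrow> mat4 \<Rightarrow> mat4" where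
  "inertia c M = so4_mat (c 2 3 * M$3$2) (c 1 3 * M$1$3) (c 1 2 * M$2$1)
                         (c 1 4 * M$1$4) (c 2 4 * M$2$4) (c 3 4 * M$3$4)"

definition energy :: "(4 \<Rightarrow> 4 \<Rightarrow> real) \<Rightarrow> mat4 \<Rightarrow> real" where
  "energy c M = 1/2 * (c 2 3 * (M$3$2)\<^sup>2 + c 1 3 * (M$1$3)\<^sup>2 + c 1 2 * (M$2$1)\<^sup>2
                     + c 1 4 * (M$1$4)\<^sup>2 + c 2 4 * (M$2$4)\<^sup>2 + c 3 4 * (M$3$4)\<^sup>2)"

abbreviation H_coeff :: "real^4 \<Rightarrow> 4 \<Rightarrow> 4 \<Rightarrow> real" where
  "H_coeff l i j \<equiv> 1 / (l$i + l$j)"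

abbreviation I_coeff :: "real^4 \<Rightarrow> 4 \<Rightarrow> 4 \<Rightarrow> real" where
  "I_coeff l i j \<equiv> 2 * ((l$i)\<^sup>2 + (l$j)\<^sup>2)"

lemma H_eq_energy: "H l = energy (H_coeff l)"
  by (rule ext) (simp add: H_def energy_def)

lemma I_eq_energy: "I l = energy (I_coeff l)"
  by (rule ext) (simp add: I_def energy_def algebra_simps)

lemma ang_vel_eq_inertia:
  assumes "\<And>i j. i \<noteq> j \<Longrightarrow> l$i + l$j > 0" "M \<in> so4"
  shows "ang_vel l M = inertia (H_coeff l) M"
proof -
  have s: "l$1 + l$2 \<noteq> 0" "l$1 + l$3 \<noteq> 0" "l$1 + l$4 \<noteq> 0" "l$2 + l$3 \<noteq> 0" "l$2 + l$4 \<noteq> 0" "l$3 + l$4 \<noteq> 0"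
    using assms(1)[of 1 2] assms(1)[of 1 3] assms(1)[of 1 4] assms(1)[of 2 3] assms(1)[of 2 4]
      assms(1)[of 3 4] by auto
  obtain x1 x2 x3 y1 y2 y3 where M: "M = so4_mat x1 x2 x3 y1 y2 y3"
    using so4_mat_cases[OF assms(2)] .
  have J: "diag_mat l ** so4_mat X1 X2 X3 Y1 Y2 Y3 + so4_mat X1 X2 X3 Y1 Y2 Y3 ** diag_mat l =
     so4_mat ((l$2 + l$3) * X1) ((l$1 + l$3) * X2) ((l$1 + l$2) * X3)
             ((l$1 + l$4) * Y1) ((l$2 + l$4) * Y2) ((l$3 + l$4) * Y3)" for X1 X2 X3 Y1 Y2 Y3
    by (simp add: vec_eq_iff forall_4 diag_mat_def matrix_matrix_mult_def sum_4 algebra_simps)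
  show ?thesis
    unfolding ang_vel_def
  proof (rule the_equality)
    show "inertia (H_coeff l) M \<in> so4 \<and>
        M = diag_mat l ** inertia (H_coeff l) M + inertia (H_coeff l) M ** diag_mat l"
      using s by (simp add: inertia_def M so4_mat_in_so4 J)
    fix W assume W: "W \<in> so4 \<and> M = diag_mat l ** W + W ** diag_mat l"
    then obtain X1 X2 X3 Y1 Y2 Y3 where W': "W = so4_mat X1 X2 X3 Y1 Y2 Y3"
      using so4_mat_cases by blast
    show "W = inertia (H_coeff l) M"
      using W s unfolding W' M J inertia_def by (simp add: so4_mat_eq_iff)
  qed
qed

text \<open>The derivative required of a gradient acts on all matrices through \<open>ip\<close>, which sees only their
skew part. Composing with the projection below therefore turns a function on \<open>so4\<close> into one that has this
derivative on the whole space.\<close>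

definition skew_part :: "mat4 \<Rightarrow> mat4" where
  "skew_part N = so4_mat ((N$3$2 - N$2$3)/2) ((N$1$3 - N$3$1)/2) ((N$2$1 - N$1$2)/2)
     ((N$1$4 - N$4$1)/2) ((N$2$4 - N$4$2)/2) ((N$3$4 - N$4$3)/2)"

lemma skew_part_so4_mat [simp]:
  "skew_part (so4_mat x1 x2 x3 y1 y2 y3) = so4_mat x1 x2 x3 y1 y2 y3"
  by (simp add: skew_part_def)

lemma skew_part_so4: "N \<in> so4 \<Longrightarrow> skew_part N = N"
  by (metis so4_mat_cases skew_part_so4_mat)

lemma bounded_linear_vec_nth_nth: "bounded_linear (\<lambda>N::real^'n^'m. N$i$j)"
  by (intro bounded_linear_compose[OF bounded_linear_vec_nth] bounded_linear_vec_nth)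

lemmas has_derivative_nth_nth = bounded_linear.has_derivative[OF bounded_linear_vec_nth_nth]

lemma bounded_linear_skew_part: "bounded_linear skew_part"
  unfolding skew_part_def
  by (intro bounded_linear_so4_mat bounded_linear_sub bounded_linear_vec_nth_nth
      bounded_linear_compose[OF bounded_linear_divide])

lemma energy_has_derivative:
  assumes "M \<in> so4"
  shows "(energy c has_derivative ip (inertia c M)) (at M within so4)"
proof -
  obtain x1 x2 x3 y1 y2 y3 where M: "M = so4_mat x1 x2 x3 y1 y2 y3"
    using so4_mat_cases[OF assms] .
  have ip: "ip (inertia c M) = (\<lambda>d. c 2 3 * x1 * (skew_part d$3$2) + c 1 3 * x2 * (skew_part d$1$3)
      + c 1 2 * x3 * (skew_part d$2$1) + c 1 4 * y1 * (skew_part d$1$4) 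
      + c 2 4 * y2 * (skew_part d$2$4) + c 3 4 * y3 * (skew_part d$3$4))"
    by (rule ext) (simp add: ip_def inertia_def trace_def matrix_matrix_mult_def sum_4 M
        skew_part_def field_simps)
  have sk: "(skew_part has_derivative skew_part) (at M within so4)"
    by (rule bounded_linear.has_derivative[OF bounded_linear_skew_part]) (rule has_derivative_ident)
  have sq: "((\<lambda>N. (skew_part N$i$j)\<^sup>2) has_derivative (\<lambda>d. 2 * M$i$j * skew_part d$i$j))
      (at M within so4)" for i j
    by (rule has_derivative_eq_rhs, rule has_derivative_power, rule has_derivative_nth_nth[OF sk])
       (simp add: M fun_eq_iff)
  have "((\<lambda>N. energy c (skew_part N)) has_derivative ip (inertia c M)) (at M within so4)"
  proof -
    have "((\<lambda>N. energy c (skew_part N)) has_derivative (\<lambda>d. 1/2 *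
        (c 2 3 * (2 * M$3$2 * skew_part d$3$2) + c 1 3 * (2 * M$1$3 * skew_part d$1$3)
       + c 1 2 * (2 * M$2$1 * skew_part d$2$1) + c 1 4 * (2 * M$1$4 * skew_part d$1$4)
       + c 2 4 * (2 * M$2$4 * skew_part d$2$4) + c 3 4 * (2 * M$3$4 * skew_part d$3$4)))) (at M within so4)"
      unfolding energy_def by (intro has_derivative_add has_derivative_mult_right sq)
    then show ?thesis
      by (rule has_derivative_eq_rhs) (simp add: ip fun_eq_iff, simp add: M algebra_simps)
  qed
  then show ?thesis
    by (rule has_derivative_transform[rotated 2]) (use assms in \<open>auto simp: skew_part_so4\<close>)
qed

lemma grad_energy:
  assumes "M \<in> so4"
  shows "grad (energy c) M = inertia c M"
  unfolding grad_def
proof (rule the_equality)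
  show "inertia c M \<in> so4 \<and> (energy c has_derivative ip (inertia c M)) (at M within so4)"
    using energy_has_derivative[OF assms] by (simp add: inertia_def so4_mat_in_so4)
next
  fix G assume G: "G \<in> so4 \<and> (energy c has_derivative ip G) (at M within so4)"
  have line: "ip G d = ip (inertia c M) d" if d: "d \<in> so4" for d
  proof -
    let ?c = "\<lambda>t::real. M + t *\<^sub>R d"
    have rng: "range ?c \<subseteq> so4"
      using assms d subspace_so4 by (auto intro: subspace_add subspace_scale)
    have c: "(?c has_derivative (\<lambda>t. t *\<^sub>R d)) (at 0)"
      by (auto intro!: derivative_eq_intros)
    have comp: "((\<lambda>t. energy c (?c t)) has_derivative (\<lambda>t. D (t *\<^sub>R d))) (at 0)"
      if "(energy c has_derivative D) (at M within so4)" for D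
    proof (rule has_derivative_in_compose[OF c])
      show "(energy c has_derivative D) (at (?c 0) within range ?c)"
        using has_derivative_subset[OF that rng] by simp
    qed
    have "(\<lambda>t. ip G (t *\<^sub>R d)) = (\<lambda>t. ip (inertia c M) (t *\<^sub>R d))"
      using has_derivative_unique[OF comp comp] G energy_has_derivative[OF assms] by blast
    then have "ip G (1 *\<^sub>R d) = ip (inertia c M) (1 *\<^sub>R d)" by meson
    then show ?thesis by simp
  qed
  obtain X1 X2 X3 Y1 Y2 Y3 where G': "G = so4_mat X1 X2 X3 Y1 Y2 Y3"
    using G so4_mat_cases by blast
  have e: "X1*a1 + X2*a2 + X3*a3 + Y1*b1 + Y2*b2 + Y3*b3 =
      (c 2 3 * M$3$2) * a1 + (c 1 3 * M$1$3) * a2 + (c 1 2 * M$2$1) * a3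
      + (c 1 4 * M$1$4) * b1 + (c 2 4 * M$2$4) * b2 + (c 3 4 * M$3$4) * b3" for a1 a2 a3 b1 b2 b3
    using line[OF so4_mat_in_so4, of a1 a2 a3 b1 b2 b3] unfolding G' inertia_def ip_so4_mat .
  show "G = inertia c M"
    unfolding G' inertia_def so4_mat_eq_iff
    using e[of 1 0 0 0 0 0] e[of 0 1 0 0 0 0] e[of 0 0 1 0 0 0]
      e[of 0 0 0 1 0 0] e[of 0 0 0 0 1 0] e[of 0 0 0 0 0 1]
    unfolding mult_zero_right mult_1_right add_0 add_0_right by blast
qed

text \<open>The Hamiltonian vector field of \<open>energy c\<close>, written without the gradient so that it is
a quadratic map on all matrices.\<close>

definition quad_vf :: "(4 \<Rightarrow> 4 \<Rightarrow> real) \<Rightarrow> mat4 \<Rightarrow> mat4" where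
  "quad_vf c M = comm M (inertia c M)"

lemma ham_vf_energy: "M \<in> so4 \<Longrightarrow> ham_vf (energy c) M = quad_vf c M"
  by (simp add: ham_vf_def quad_vf_def grad_energy)

lemma rigid_body_eq_quad_vf:
  assumes "\<And>i j. i \<noteq> j \<Longrightarrow> l$i + l$j > 0" "M \<in> so4"
  shows "rigid_body l M = quad_vf (H_coeff l) M"
  by (simp add: rigid_body_def quad_vf_def ang_vel_eq_inertia[OF assms])

lemma quad_vf_so4_mat:
  "quad_vf c (so4_mat x1 x2 x3 y1 y2 y3) = so4_mat
     ((c 1 2 - c 1 3) * x2 * x3 + (c 3 4 - c 2 4) * y2 * y3)
     ((c 2 3 - c 1 2) * x1 * x3 + (c 1 4 - c 3 4) * y1 * y3)
     ((c 1 3 - c 2 3) * x1 * x2 + (c 2 4 - c 1 4) * y1 * y2)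
     ((c 3 4 - c 1 3) * x2 * y3 + (c 1 2 - c 2 4) * x3 * y2)
     ((c 1 4 - c 1 2) * x3 * y1 + (c 2 3 - c 3 4) * x1 * y3)
     ((c 2 4 - c 2 3) * x1 * y2 + (c 1 3 - c 1 4) * x2 * y1)"
  unfolding quad_vf_def inertia_def comm_so4_mat so4_mat_eq_iff so4_mat_nth
  by (intro conjI; algebra)

section \<open>The center-saddle algebra is a Cartan subalgebra\<close>

lemma center_saddle_mat_nth [simp]:
  "center_saddle_mat A B $ 1 = vector [- A, 0, 0, 0]"
  "center_saddle_mat A B $ 2 = vector [0, 0, 0, - B]"
  "center_saddle_mat A B $ 3 = vector [0, 0, A, 0]"
  "center_saddle_mat A B $ 4 = vector [0, B, 0, 0]"
  by (simp_all add: center_saddle_mat_def vector_4_nth)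

lemma center_saddle_mat_mult:
  "center_saddle_mat A B *v u = vector [- A * u$1, - B * u$4, A * u$3, B * u$2]"
  by (simp add: vec_eq_iff forall_4 matrix_vector_mult_def sum_4 vector_4_nth)

text \<open>Elements of \<open>endo T\<close> vanish on the orthogonal complement of \<open>T\<close>, so their values on \<open>T\<close> determine them.\<close>

lemma endo_eqI:
  fixes f g :: "'a::euclidean_space \<Rightarrow>\<^sub>L 'a"
  assumes "f \<in> endo T" "g \<in> endo T" "\<And>v. v \<in> T \<Longrightarrow> blinfun_apply f v = blinfun_apply g v"
    and "subspace T"
  shows "f = g"
proof (rule blinfun_eqI)
  fix w
  obtain y z where yz: "y \<in> span T" "\<And>v. v \<in> span T \<Longrightarrow> orthogonal z v" "w = y + z"
    using orthogonal_subspace_decomp_exists[of T w] by metis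
  have "y \<in> T" using yz(1) assms(4) by (simp add: span_eq_iff[THEN iffD2])
  moreover have "\<forall>v\<in>T. orthogonal v z" using yz(2) by (metis orthogonal_commute span_base)
  ultimately show "blinfun_apply f w = blinfun_apply g w"
    using assms by (auto simp: yz(3) blinfun.add_right endo_def)
qed

lemma subspace_endo:
  assumes "subspace T"
  shows "subspace (endo T)"
  using assms unfolding subspace_def endo_def
  by (auto simp: blinfun.add_left blinfun.scaleR_left)

lemma endo_comm_apply:
  "blinfun_apply (endo_comm f g) v = blinfun_apply f (blinfun_apply g v) - blinfun_apply g (blinfun_apply f v)"
  by (simp add: endo_comm_def blinfun.diff_left)

lemma endo_comm_endo:
  assumes "f \<in> endo T" "g \<in> endo T" "subspace T"
  shows "endo_comm f g \<in> endo T"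
  using assms unfolding endo_def by (auto simp: endo_comm_apply subspace_diff)

text \<open>A frame identifies \<open>T\<close> with the standard symplectic space; all computations with endomorphisms of
\<open>T\<close> then become computations with \<open>4\<times>4\<close> matrices.\<close>

locale symplectic_frame =
  fixes T :: "'a::euclidean_space set" and \<omega> :: "'a \<Rightarrow> 'a \<Rightarrow> real" and \<phi> :: "real^4 \<Rightarrow> 'a"
  assumes subT: "subspace T" and lin: "linear \<phi>" and bij: "bij_betw \<phi> UNIV T"
    and symp: "\<And>u v. \<omega> (\<phi> u) (\<phi> v) = std_form u v"
begin

definition center_saddle_algebra :: "('a \<Rightarrow>\<^sub>L 'a) set" where
  "center_saddle_algebra = {f \<in> endo T. \<exists>A B. \<forall>u. blinfun_apply f (\<phi> u) = \<phi> (center_saddle_mat A B *v u)}"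

lemma frame_cases: assumes "v \<in> T" obtains u where "v = \<phi> u"
  using bij assms by (auto simp: bij_betw_def)

lemma frame_in: "\<phi> u \<in> T"
  using bij by (auto simp: bij_betw_def)

lemma frame_inj: "\<phi> u = \<phi> v \<longleftrightarrow> u = v"
  using bij by (auto simp: bij_betw_def inj_def)

lemma center_saddle_algebra_commute:
  assumes "f \<in> center_saddle_algebra" "g \<in> center_saddle_algebra"
  shows "endo_comm f g = 0"
proof (rule endo_eqI[of _ T])
  obtain A B A' B' where f: "\<And>u. blinfun_apply f (\<phi> u) = \<phi> (center_saddle_mat A B *v u)"
    and g: "\<And>u. blinfun_apply g (\<phi> u) = \<phi> (center_saddle_mat A' B' *v u)"
    using assms unfolding center_saddle_algebra_def by blast
  fix v assume "v \<in> T"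
  then obtain u where "v = \<phi> u" by (rule frame_cases)
  then show "blinfun_apply (endo_comm f g) v = blinfun_apply 0 v"
    by (simp add: endo_comm_apply f g frame_inj center_saddle_mat_mult vector_4_nth mult.left_commute)
qed (use assms subT in \<open>auto simp: center_saddle_algebra_def endo_comm_endo subspace_0 subspace_endo\<close>)

lemma subspace_center_saddle_algebra: "subspace center_saddle_algebra"
proof (rule subspaceI)
  have z: "center_saddle_mat 0 0 *v u = 0" for u
    by (simp add: center_saddle_mat_mult vec_eq_iff forall_4 vector_4_nth)
  show "0 \<in> center_saddle_algebra"
    using subspace_0[OF subspace_endo[OF subT]]
    by (auto simp: center_saddle_algebra_def linear_0[OF lin] z intro!: exI[of _ 0])
  fix f g assume fg: "f \<in> center_saddle_algebra" "g \<in> center_saddle_algebra"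
  obtain A B A' B' where f: "\<And>u. blinfun_apply f (\<phi> u) = \<phi> (center_saddle_mat A B *v u)"
    and g: "\<And>u. blinfun_apply g (\<phi> u) = \<phi> (center_saddle_mat A' B' *v u)"
    using fg unfolding center_saddle_algebra_def by blast
  have "blinfun_apply (f + g) (\<phi> u) = \<phi> (center_saddle_mat (A + A') (B + B') *v u)" for u
    unfolding blinfun.add_left f g linear_add[OF lin, symmetric] frame_inj
    by (simp add: center_saddle_mat_mult vec_eq_iff forall_4 vector_4_nth algebra_simps)
  then show "f + g \<in> center_saddle_algebra"
    using fg subspace_add[OF subspace_endo[OF subT]] unfolding center_saddle_algebra_def by blast
  fix r :: real
  have "blinfun_apply (r *\<^sub>R f) (\<phi> u) = \<phi> (center_saddle_mat (r * A) (r * B) *v u)" for u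
    unfolding blinfun.scaleR_left f linear_cmul[OF lin, symmetric] frame_inj
    by (simp add: center_saddle_mat_mult vec_eq_iff forall_4 vector_4_nth algebra_simps)
  then show "r *\<^sub>R f \<in> center_saddle_algebra"
    using fg subspace_scale[OF subspace_endo[OF subT]] unfolding center_saddle_algebra_def by blast
qed

lemma lie_closed_center_saddle_algebra: "lie_closed center_saddle_algebra"
  unfolding lie_closed_def
  using subspace_center_saddle_algebra by (auto simp: center_saddle_algebra_commute subspace_0)

lemma center_saddle_algebra_inf_symplectic: "center_saddle_algebra \<subseteq> inf_symplectic T \<omega>"
proof
  fix f assume "f \<in> center_saddle_algebra"
  then obtain A B where f: "f \<in> endo T" "\<And>u. blinfun_apply f (\<phi> u) = \<phi> (center_saddle_mat A B *v u)"
    unfolding center_saddle_algebra_def by blast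
  have "\<omega> (blinfun_apply f (\<phi> u)) (\<phi> v) + \<omega> (\<phi> u) (blinfun_apply f (\<phi> v)) = 0" for u v
    by (simp add: f symp std_form_def center_saddle_mat_mult vector_4_nth algebra_simps)
  then show "f \<in> inf_symplectic T \<omega>"
    using f(1) unfolding inf_symplectic_def by (auto elim!: frame_cases)
qed

lemma frame_matrix:
  assumes "f \<in> endo T"
  obtains F :: "real^4^4" where "\<And>u. blinfun_apply f (\<phi> u) = \<phi> (F *v u)"
proof -
  let ?g = "inv_into UNIV \<phi>"
  have inv: "\<phi> (?g v) = v" if "v \<in> T" for v
    using bij_betw_inv_into_right[OF bij that] .
  have fT: "blinfun_apply f (\<phi> u) \<in> T" for u
    using assms frame_in by (auto simp: endo_def)
  have "linear (\<lambda>u. ?g (blinfun_apply f (\<phi> u)))"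
    by (rule linearI; subst frame_inj[symmetric])
      (simp_all add: linear_add[OF lin] linear_cmul[OF lin] inv fT blinfun.add_right blinfun.scaleR_right
        subspace_add[OF subT] subspace_scale[OF subT])
  then have "\<phi> (matrix (\<lambda>u. ?g (blinfun_apply f (\<phi> u))) *v u) = blinfun_apply f (\<phi> u)" for u
    by (simp add: matrix_works inv fT)
  then show ?thesis using that by metis
qed

text \<open>It suffices to test against the single element \<open>K\<close> with \<open>A = B = 1\<close>. Its eigenvalues \<open>\<plusminus> 1, \<plusminus> \<i>\<close> are
distinct, so if the matrix of \<open>f\<close> has a commutator with \<open>K\<close> in the algebra, the commutator vanishes and
the matrix is a polynomial in \<open>K\<close>; being infinitesimally symplectic removes the two trace parts.\<close>

lemma normalizer_center_saddle_algebra: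
  assumes f: "f \<in> inf_symplectic T \<omega>" and K: "K \<in> endo T"
    "\<And>u. blinfun_apply K (\<phi> u) = \<phi> (center_saddle_mat 1 1 *v u)"
    and n: "endo_comm f K \<in> center_saddle_algebra"
  shows "f \<in> center_saddle_algebra"
proof -
  have fE: "f \<in> endo T" using f by (simp add: inf_symplectic_def)
  obtain F where F: "\<And>u. blinfun_apply f (\<phi> u) = \<phi> (F *v u)"
    using frame_matrix[OF fE] by blast
  have sF: "std_form (F *v u) v + std_form u (F *v v) = 0" for u v
    using f frame_in by (auto simp: inf_symplectic_def F[symmetric] symp[symmetric])
  let ?C = "center_saddle_mat 1 1"
  obtain A B where AB: "\<And>u. blinfun_apply (endo_comm f K) (\<phi> u) = \<phi> (center_saddle_mat A B *v u)"
    using n unfolding center_saddle_algebra_def by blast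
  have C: "F *v (?C *v u) - ?C *v (F *v u) = center_saddle_mat A B *v u" for u
    using AB[of u] unfolding endo_comm_apply F K(2) linear_diff[OF lin, symmetric] frame_inj .
  then have "F ** ?C - ?C ** F = center_saddle_mat A B"
    by (simp add: matrix_eq matrix_vector_mult_diff_rdistrib matrix_vector_mul_assoc)
  then have "(F ** ?C - ?C ** F) $ i $ j = center_saddle_mat A B $ i $ j" for i j by simp
  note e = this[of 1 1] this[of 1 2] this[of 1 3] this[of 1 4] this[of 2 1] this[of 2 2] this[of 2 3]
    this[of 2 4] this[of 3 1] this[of 3 2] this[of 3 3] this[of 3 4] this[of 4 1] this[of 4 2]
    this[of 4 3] this[of 4 4]
  note e' = e[unfolded matrix_matrix_mult_def, simplified sum_4 vector_minus_component vec_lambda_beta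
      center_saddle_mat_nth vector_4_nth, simplified]
  have s: "F$1$1 + F$3$3 = 0" "F$2$2 + F$4$4 = 0"
    using sF[of "axis 1 1" "axis 3 1"] sF[of "axis 2 1" "axis 4 1"]
    by (simp_all add: std_form_def matrix_vector_mult_def sum_4 axis_def)
  have "F = center_saddle_mat (F$3$3) (F$4$2)"
    unfolding vec_eq_iff forall_4 center_saddle_mat_nth vector_4_nth
    using e' s by (intro conjI; linarith)
  then obtain A' B' where "F = center_saddle_mat A' B'" by blast
  then show ?thesis
    using F fE unfolding center_saddle_algebra_def by blast
qed

text \<open>Two elements of the algebra with independent parameters span it, and it is commutative, so it is
the smallest Lie subalgebra containing them.\<close>

theorem cartan_center_saddle_algebra:
  assumes L1: "L1 \<in> endo T" "\<And>u. blinfun_apply L1 (\<phi> u) = \<phi> (center_saddle_mat A1 B1 *v u)"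
    and L2: "L2 \<in> endo T" "\<And>u. blinfun_apply L2 (\<phi> u) = \<phi> (center_saddle_mat A2 B2 *v u)"
    and indep: "A1 * B2 - A2 * B1 \<noteq> 0"
  shows "lie_closed hull {L1, L2} = center_saddle_algebra"
    and "cartan_subalgebra (inf_symplectic T \<omega>) center_saddle_algebra"
proof -
  have combE: "r *\<^sub>R L1 + s *\<^sub>R L2 \<in> endo T" for r s
    using L1(1) L2(1) subspace_endo[OF subT] by (simp add: subspace_add subspace_scale)
  have span: "\<exists>r s. \<forall>u. blinfun_apply (r *\<^sub>R L1 + s *\<^sub>R L2) (\<phi> u) = \<phi> (center_saddle_mat A B *v u)"
    for A B
  proof -
    define D where "D = A1 * B2 - A2 * B1"
    define r s where "r = (A * B2 - A2 * B) / D" and "s = (A1 * B - A * B1) / D"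
    have "D \<noteq> 0" using indep by (simp add: D_def)
    then have rs: "A = r * A1 + s * A2" "B = r * B1 + s * B2"
      unfolding r_def s_def by (simp_all add: field_simps) (simp_all add: D_def algebra_simps)
    have "blinfun_apply (r *\<^sub>R L1 + s *\<^sub>R L2) (\<phi> u) = \<phi> (center_saddle_mat A B *v u)" for u
      unfolding blinfun.add_left blinfun.scaleR_left L1 L2 linear_cmul[OF lin, symmetric]
        linear_add[OF lin, symmetric] frame_inj
      by (simp add: center_saddle_mat_mult vec_eq_iff forall_4 vector_4_nth rs algebra_simps)
    then show ?thesis by blast
  qed
  have comb: "\<exists>r s. f = r *\<^sub>R L1 + s *\<^sub>R L2" if f: "f \<in> center_saddle_algebra" for f
  proof -
    obtain A B where fAB: "f \<in> endo T" "\<And>u. blinfun_apply f (\<phi> u) = \<phi> (center_saddle_mat A B *v u)"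
      using f unfolding center_saddle_algebra_def by blast
    obtain r s where rs: "\<And>u. blinfun_apply (r *\<^sub>R L1 + s *\<^sub>R L2) (\<phi> u) = \<phi> (center_saddle_mat A B *v u)"
      using span by blast
    have "f = r *\<^sub>R L1 + s *\<^sub>R L2"
    proof (rule endo_eqI[OF fAB(1) combE _ subT])
      fix v assume "v \<in> T"
      then obtain u where "v = \<phi> u" by (rule frame_cases)
      then show "blinfun_apply f v = blinfun_apply (r *\<^sub>R L1 + s *\<^sub>R L2) v"
        by (simp only: fAB rs)
    qed
    then show ?thesis by blast
  qed
  have "L1 \<in> center_saddle_algebra" "L2 \<in> center_saddle_algebra"
    using L1 L2 unfolding center_saddle_algebra_def by blast+
  then have "lie_closed hull {L1, L2} \<subseteq> center_saddle_algebra"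
    by (intro hull_minimal) (auto simp: lie_closed_center_saddle_algebra)
  moreover have "center_saddle_algebra \<subseteq> lie_closed hull {L1, L2}"
  proof
    fix f assume "f \<in> center_saddle_algebra"
    then obtain r s where "f = r *\<^sub>R L1 + s *\<^sub>R L2"
      using comb by blast
    then show "f \<in> lie_closed hull {L1, L2}"
      by (auto simp: hull_def lie_closed_def intro!: subspace_add subspace_scale)
  qed
  ultimately show "lie_closed hull {L1, L2} = center_saddle_algebra" by blast
  obtain r s where rs: "\<And>u. blinfun_apply (r *\<^sub>R L1 + s *\<^sub>R L2) (\<phi> u) = \<phi> (center_saddle_mat 1 1 *v u)"
    using span by blast
  define K where "K = r *\<^sub>R L1 + s *\<^sub>R L2"
  have KE: "K \<in> endo T" and K: "\<And>u. blinfun_apply K (\<phi> u) = \<phi> (center_saddle_mat 1 1 *v u)"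
    using combE rs by (simp_all add: K_def)
  have "K \<in> center_saddle_algebra" using K KE unfolding center_saddle_algebra_def by blast
  have "{f \<in> inf_symplectic T \<omega>. \<forall>k\<in>center_saddle_algebra. endo_comm f k \<in> center_saddle_algebra} = center_saddle_algebra"
    using normalizer_center_saddle_algebra[OF _ KE K] \<open>K \<in> center_saddle_algebra\<close> center_saddle_algebra_inf_symplectic
      lie_closed_center_saddle_algebra by (auto simp: lie_closed_def)
  moreover have "nilpotent_lie center_saddle_algebra"
    unfolding nilpotent_lie_def
  proof
    have "{endo_comm f g |f g. f \<in> center_saddle_algebra \<and> g \<in> center_saddle_algebra} = {0}"
      using center_saddle_algebra_commute subspace_0[OF subspace_center_saddle_algebra] by (auto intro!: exI[of _ 0])
    then show "lower_central center_saddle_algebra 1 = {0}"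
      by simp
  qed
  ultimately show "cartan_subalgebra (inf_symplectic T \<omega>) center_saddle_algebra"
    unfolding cartan_subalgebra_def using lie_closed_center_saddle_algebra center_saddle_algebra_inf_symplectic by blast
qed

end

section \<open>Tangent space, symplectic form and linearization at the equilibria\<close>

lemma bounded_bilinear_comm: "bounded_bilinear comm"
proof -
  have "bilinear comm"
    unfolding bilinear_def comm_def
    by (auto intro!: linearI simp: vec_eq_iff matrix_matrix_mult_def sum.distrib sum_distrib_left
        algebra_simps)
  then show ?thesis by (simp add: bilinear_conv_bounded_bilinear)
qed

lemma bounded_linear_inertia: "bounded_linear (inertia c)"
  unfolding inertia_def
  by (intro bounded_linear_so4_mat bounded_linear_const_mult bounded_linear_vec_nth_nth)

text \<open>The derivative of \<open>quad_vf c\<close> at \<open>M2 p q\<close>. It kills the directions inside \<open>t2\<close>, along which the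
vector field vanishes, and the symmetric matrices are removed by \<open>skew_part\<close>; hence it already
belongs to \<open>endo\<close> of the tangent space.\<close>

definition linearized_vf :: "(4 \<Rightarrow> 4 \<Rightarrow> real) \<Rightarrow> real \<Rightarrow> real \<Rightarrow> mat4 \<Rightarrow> mat4" where
  "linearized_vf c p q w = comm (skew_part w) (inertia c (M2 p q)) + comm (M2 p q) (inertia c (skew_part w))"

lemma linearized_vf_so4_mat:
  "linearized_vf c p q (so4_mat x1 x2 x3 y1 y2 y3) = so4_mat
     ((c 1 2 - c 1 3) * p * x3 + (c 3 4 - c 2 4) * q * y3) 0
     ((c 1 3 - c 2 3) * p * x1 + (c 2 4 - c 1 4) * q * y1)
     ((c 3 4 - c 1 3) * p * y3 + (c 1 2 - c 2 4) * q * x3) 0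
     ((c 2 4 - c 2 3) * q * x1 + (c 1 3 - c 1 4) * p * y1)"
  unfolding linearized_vf_def M2_def inertia_def skew_part_so4_mat so4_mat_nth comm_so4_mat so4_mat_add
    so4_mat_eq_iff
  by (intro conjI; algebra)

lemma bounded_linear_linearized_vf: "bounded_linear (linearized_vf c p q)"
proof -
  interpret bounded_bilinear comm by (rule bounded_bilinear_comm)
  show ?thesis
    unfolding linearized_vf_def
    by (intro bounded_linear_add bounded_linear_compose[OF bounded_linear_left bounded_linear_skew_part]
       bounded_linear_compose[OF bounded_linear_right
         bounded_linear_compose[OF bounded_linear_inertia bounded_linear_skew_part]])
qed

lemma quad_vf_has_derivative:
  "(quad_vf c has_derivative linearized_vf c p q) (at (M2 p q) within so4)"
proof -
  let ?M = "M2 p q"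
  have Mso: "?M \<in> so4" by (simp add: M2_def so4_mat_in_so4)
  have sk: "(skew_part has_derivative skew_part) (at ?M within so4)"
    by (rule bounded_linear.has_derivative[OF bounded_linear_skew_part]) (rule has_derivative_ident)
  have "((\<lambda>N. comm (skew_part N) (inertia c (skew_part N))) has_derivative linearized_vf c p q) (at ?M within so4)"
    by (rule has_derivative_eq_rhs, rule bounded_bilinear.FDERIV[OF bounded_bilinear_comm sk
          bounded_linear.has_derivative[OF bounded_linear_inertia sk]])
       (simp add: fun_eq_iff linearized_vf_def skew_part_so4[OF Mso] add.commute)
  then show ?thesis
    by (rule has_derivative_transform[rotated 2]) (use Mso in \<open>auto simp: skew_part_so4 quad_vf_def\<close>)
qed

lemma tangent_orb_M2:
  assumes "p\<^sup>2 \<noteq> q\<^sup>2"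
  shows "tangent_orb (M2 p q) = {so4_mat x1 0 x3 y1 0 y3 |x1 x3 y1 y3. True}"
proof (intro set_eqI iffI)
  fix u assume "u \<in> tangent_orb (M2 p q)"
  then obtain X where X: "u = comm (M2 p q) X" "X \<in> so4" by (auto simp: tangent_orb_def)
  from X(2) obtain X1 X2 X3 Y1 Y2 Y3 where "X = so4_mat X1 X2 X3 Y1 Y2 Y3" by (rule so4_mat_cases)
  then show "u \<in> {so4_mat x1 0 x3 y1 0 y3 |x1 x3 y1 y3. True}"
    by (auto simp: X M2_def comm_so4_mat so4_mat_eq_iff)
next
  fix u assume "u \<in> {so4_mat x1 0 x3 y1 0 y3 |x1 x3 y1 y3. True}"
  then obtain x1 x3 y1 y3 where u: "u = so4_mat x1 0 x3 y1 0 y3" by blast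
  define D where "D = p\<^sup>2 - q\<^sup>2"
  have D: "D \<noteq> 0" using assms by (simp add: D_def)
  have "u = comm (M2 p q) (so4_mat (- (p*x3 - q*y3)/D) 0 ((p*x1 - q*y1)/D) (- (p*y3 - q*x3)/D) 0 ((p*y1 - q*x1)/D))"
    unfolding u M2_def comm_so4_mat so4_mat_eq_iff using D
    by (simp add: field_simps) (simp add: D_def power2_eq_square algebra_simps)
  then show "u \<in> tangent_orb (M2 p q)"
    unfolding tangent_orb_def using so4_mat_in_so4 by blast
qed

lemma subspace_tangent_orb: "subspace (tangent_orb M)"
proof -
  interpret bounded_bilinear comm by (rule bounded_bilinear_comm)
  have "tangent_orb M = comm M ` so4" by (auto simp: tangent_orb_def)
  then show ?thesis
    using linear_subspace_image[OF bounded_linear.linear[OF bounded_linear_right] subspace_so4] by simp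
qed

text \<open>The orbit symplectic form at \<open>M2 p q\<close> in coordinates: the equations \<open>u = [M, X]\<close> determine the
coordinates of \<open>X\<close> that matter after division by \<open>p\<^sup>2 - q\<^sup>2\<close>.\<close>

definition omega :: "real \<Rightarrow> real \<Rightarrow> mat4 \<Rightarrow> mat4 \<Rightarrow> real" where
  "omega p q u v = (p * (u$3$2 * v$2$1 - u$2$1 * v$3$2 + u$1$4 * v$3$4 - u$3$4 * v$1$4)
     - q * (u$3$2 * v$3$4 - u$3$4 * v$3$2 + u$1$4 * v$2$1 - u$2$1 * v$1$4)) / (p\<^sup>2 - q\<^sup>2)"

lemma orb_form_M2:
  assumes "p\<^sup>2 \<noteq> q\<^sup>2" "u \<in> tangent_orb (M2 p q)" "v \<in> tangent_orb (M2 p q)"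
  shows "orb_form (M2 p q) u v = omega p q u v"
proof -
  have val: "1/2 * trace (M2 p q ** comm X Y) = omega p q (comm (M2 p q) X) (comm (M2 p q) Y)"
    if XY: "X \<in> so4" "Y \<in> so4" for X Y
  proof -
    obtain X1 X2 X3 X4 X5 X6 where X: "X = so4_mat X1 X2 X3 X4 X5 X6"
      using so4_mat_cases[OF XY(1)] .
    obtain Y1 Y2 Y3 Y4 Y5 Y6 where Y: "Y = so4_mat Y1 Y2 Y3 Y4 Y5 Y6"
      using so4_mat_cases[OF XY(2)] .
    have D: "p\<^sup>2 - q\<^sup>2 \<noteq> 0" using assms(1) by simp
    show ?thesis
      unfolding X Y M2_def omega_def comm_so4_mat trace_mult_so4_mat so4_mat_nth eq_divide_eq
      using D by simp algebra
  qed
  obtain X Y where XY: "X \<in> so4" "u = comm (M2 p q) X" "Y \<in> so4" "v = comm (M2 p q) Y"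
    using assms(2,3) unfolding tangent_orb_def by blast
  show ?thesis
    unfolding orb_form_def
    by (rule the_equality) (use XY val in auto)
qed

lemma omega_linear:
  "omega p q (u + u') v = omega p q u v + omega p q u' v"
  "omega p q u (v + v') = omega p q u v + omega p q u v'"
  "omega p q (r *\<^sub>R u) v = r * omega p q u v"
  "omega p q u (r *\<^sub>R v) = r * omega p q u v"
  by (simp_all add: omega_def add_divide_distrib[symmetric] algebra_simps)

lemma omega_skew: "omega p q v u = - omega p q u v"
  by (simp add: omega_def minus_divide_left algebra_simps)

lemma omega_linearized_vf:
  assumes "u \<in> tangent_orb (M2 p q)" "v \<in> tangent_orb (M2 p q)" "p\<^sup>2 \<noteq> q\<^sup>2"
  shows "omega p q (linearized_vf c p q u) v = - omega p q u (linearized_vf c p q v)"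
proof -
  obtain x1 x3 y1 y3 where u: "u = so4_mat x1 0 x3 y1 0 y3"
    using assms tangent_orb_M2 by blast
  obtain X1 X3 Y1 Y3 where v: "v = so4_mat X1 0 X3 Y1 0 Y3"
    using assms tangent_orb_M2 by blast
  show ?thesis
    unfolding u v linearized_vf_so4_mat omega_def so4_mat_nth minus_divide_left
    by (rule arg_cong[where f="\<lambda>x. x / _"]) algebra
qed


lemma linearized_vf_endo:
  assumes "p\<^sup>2 \<noteq> q\<^sup>2"
  shows "Blinfun (linearized_vf c p q) \<in> endo (tangent_orb (M2 p q))"
proof -
  have "skew_part w = so4_mat 0 (skew_part w $ 1 $ 3) 0 0 (skew_part w $ 2 $ 4) 0"
    if "\<forall>v\<in>tangent_orb (M2 p q). orthogonal v w" for w
  proof -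
    have "so4_mat x1 0 x3 y1 0 y3 \<bullet> w = 0" for x1 x3 y1 y3
      using that unfolding tangent_orb_M2[OF assms] orthogonal_def by blast
    from this[of 1 0 0 0] this[of 0 1 0 0] this[of 0 0 1 0] this[of 0 0 0 1] show ?thesis
      by (simp add: inner_vec_def sum_4 skew_part_def so4_mat_eq_iff)
  qed
  then have "linearized_vf c p q w = 0" if "\<forall>v\<in>tangent_orb (M2 p q). orthogonal v w" for w
    using linearized_vf_so4_mat[of c p q 0 "skew_part w $ 1 $ 3" 0 0 "skew_part w $ 2 $ 4" 0] that
    by (metis (no_types, lifting) linearized_vf_def skew_part_so4_mat so4_mat_zero mult_zero_right add_0)
  moreover have "linearized_vf c p q v \<in> tangent_orb (M2 p q)" if "v \<in> tangent_orb (M2 p q)" for v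
    using that linearized_vf_so4_mat unfolding tangent_orb_M2[OF assms] by blast
  ultimately show ?thesis
    unfolding endo_def by (simp add: bounded_linear_Blinfun_apply bounded_linear_linearized_vf)
qed

text \<open>Every tangent vector is the velocity of a curve in the orbit. In terms of \<open>x + y\<close> and \<open>x - y\<close> the two
Casimir equations say that both vectors have constant length, so a displacement by \<open>t v\<close> in the
tangential coordinates is compensated by shrinking \<open>p + q\<close> and \<open>p - q\<close> to second order in \<open>t\<close>.\<close>

lemma orbit_curve:
  assumes M: "M2 p q \<in> Orb c1 c2" and pq: "p\<^sup>2 \<noteq> q\<^sup>2" and v: "v \<in> tangent_orb (M2 p q)"
  obtains r and c :: "real \<Rightarrow> mat4" where "r > 0" "c 0 = M2 p q" "c ` ball 0 r \<subseteq> Orb c1 c2"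
    "(c has_derivative (\<lambda>t. t *\<^sub>R v)) (at 0)"
proof -
  obtain x1 x3 y1 y3 where v': "v = so4_mat x1 0 x3 y1 0 y3"
    using v pq tangent_orb_M2 by blast
  define k where "k = ((x1 + y1)\<^sup>2 + (x3 + y3)\<^sup>2) / (p + q)\<^sup>2"
  define m where "m = ((x1 - y1)\<^sup>2 + (x3 - y3)\<^sup>2) / (p - q)\<^sup>2"
  have nz: "p + q \<noteq> 0" "p - q \<noteq> 0"
    using pq by (auto simp: power2_eq_iff add_eq_0_iff)
  have km: "k \<ge> 0" "m \<ge> 0" by (simp_all add: k_def m_def)
  define P where "P t = (p + q) * sqrt (1 - k * t\<^sup>2)" for t
  define Q where "Q t = (p - q) * sqrt (1 - m * t\<^sup>2)" for t
  define c where "c t = so4_mat (t * x1) ((P t + Q t) / 2) (t * x3) (t * y1) ((P t - Q t) / 2) (t * y3)" for t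
  \<comment> \<open>small enough that \<open>k * t\<^sup>2\<close> and \<open>m * t\<^sup>2\<close> stay below \<open>1\<close>\<close>
  define r where "r = 1 / (1 + k + m)"
  have rpos: "r > 0" using km by (simp add: r_def)
  have c0: "c 0 = M2 p q" by (simp add: c_def P_def Q_def M2_def so4_mat_eq_iff)
  have small: "k * t\<^sup>2 \<le> 1" "m * t\<^sup>2 \<le> 1" if "t \<in> ball 0 r" for t
  proof -
    have t: "\<bar>t\<bar> * (1 + k + m) \<le> 1" using that km by (simp add: r_def field_simps)
    have "1 * \<bar>t\<bar> \<le> (1 + k + m) * \<bar>t\<bar>" by (rule mult_right_mono) (use km in auto)
    then have t1: "\<bar>t\<bar> \<le> 1" using t by (simp add: mult.commute)
    have t2: "t\<^sup>2 \<le> \<bar>t\<bar>"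
      using mult_left_mono[OF t1, of "\<bar>t\<bar>"] by (simp add: power2_eq_square)
    have "k * t\<^sup>2 \<le> k * \<bar>t\<bar>" "m * t\<^sup>2 \<le> m * \<bar>t\<bar>" using t2 km by (auto intro: mult_left_mono)
    moreover have "k * \<bar>t\<bar> \<ge> 0" "m * \<bar>t\<bar> \<ge> 0" using km by auto
    ultimately show "k * t\<^sup>2 \<le> 1" "m * t\<^sup>2 \<le> 1" using t by (auto simp: algebra_simps)
  qed
  have orb: "c t \<in> Orb c1 c2" if "t \<in> ball 0 r" for t
  proof -
    have "(P t)\<^sup>2 = (p + q)\<^sup>2 * (1 - k * t\<^sup>2)" "(Q t)\<^sup>2 = (p - q)\<^sup>2 * (1 - m * t\<^sup>2)"
      using small[OF that] by (simp_all add: P_def Q_def power_mult_distrib)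
    then have PQ: "(P t)\<^sup>2 = (p + q)\<^sup>2 - t\<^sup>2 * ((x1 + y1)\<^sup>2 + (x3 + y3)\<^sup>2)"
      "(Q t)\<^sup>2 = (p - q)\<^sup>2 - t\<^sup>2 * ((x1 - y1)\<^sup>2 + (x3 - y3)\<^sup>2)"
      using nz by (simp_all add: k_def m_def right_diff_distrib)
    have M': "p\<^sup>2 + q\<^sup>2 = 2 * c1" "p * q = c2" using M by (auto simp: M2_in_Orb_iff)
    show ?thesis
      unfolding c_def so4_mat_in_Orb_iff M'[symmetric] using PQ
      by (auto simp: power2_eq_square field_simps)
  qed
  have sq: "((\<lambda>t. sqrt (1 - k * t\<^sup>2)) has_derivative (\<lambda>t. 0)) (at 0)" for k
    by (auto intro!: derivative_eq_intros)
  have dP: "((\<lambda>t. (P t + Q t) / 2) has_derivative (\<lambda>t. 0)) (at 0)"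
    "((\<lambda>t. (P t - Q t) / 2) has_derivative (\<lambda>t. 0)) (at 0)"
    unfolding P_def Q_def by (rule derivative_eq_intros sq refl | simp)+
  have lin: "((\<lambda>t. t * x) has_derivative (\<lambda>t. t * x)) (at 0)" for x :: real
    by (auto intro!: derivative_eq_intros)
  have "(c has_derivative (\<lambda>t. so4_mat (t * x1) 0 (t * x3) (t * y1) 0 (t * y3))) (at 0)"
    unfolding c_def by (intro has_derivative_so4_mat lin dP)
  then have "(c has_derivative (\<lambda>t. t *\<^sub>R v)) (at 0)"
    by (simp add: v' so4_mat_scaleR)
  then show ?thesis using that rpos c0 orb by blast
qed

text \<open>This makes the linearization well defined: a derivative within the orbit is determined along the
velocities of curves in the orbit.\<close>

lemma orbit_derivative_unique:
  assumes M: "M2 p q \<in> Orb c1 c2" and pq: "p\<^sup>2 \<noteq> q\<^sup>2" and v: "v \<in> tangent_orb (M2 p q)"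
    and D: "(X has_derivative D) (at (M2 p q) within Orb c1 c2)"
      "(X has_derivative D') (at (M2 p q) within Orb c1 c2)"
  shows "D v = D' v"
proof -
  obtain r and c :: "real \<Rightarrow> mat4" where c: "r > 0" "c 0 = M2 p q" "c ` ball 0 r \<subseteq> Orb c1 c2"
    "(c has_derivative (\<lambda>t. t *\<^sub>R v)) (at 0)"
    using orbit_curve[OF M pq v] .
  have comp: "((\<lambda>t. X (c t)) has_derivative (\<lambda>t. E (t *\<^sub>R v))) (at 0)"
    if "(X has_derivative E) (at (M2 p q) within Orb c1 c2)" for E
  proof -
    have X: "(X has_derivative E) (at (c 0) within c ` ball 0 r)"
      unfolding c(2) by (rule has_derivative_subset[OF that c(3)])
    have "((\<lambda>t. X (c t)) has_derivative (\<lambda>t. E (t *\<^sub>R v))) (at 0 within ball 0 r)"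
      by (rule has_derivative_in_compose[OF has_derivative_at_withinI[OF c(4)] X])
    moreover have "at 0 within ball 0 r = at (0::real)"
      by (rule at_within_open) (use c(1) in auto)
    ultimately show ?thesis by metis
  qed
  have "(\<lambda>t. D (t *\<^sub>R v)) = (\<lambda>t. D' (t *\<^sub>R v))"
    using has_derivative_unique[OF comp comp] D by blast
  then have "D (1 *\<^sub>R v) = D' (1 *\<^sub>R v)" by meson
  then show ?thesis by simp
qed

lemma linearization_eq:
  assumes M: "M2 p q \<in> Orb c1 c2" and pq: "p\<^sup>2 \<noteq> q\<^sup>2"
    and X: "\<And>N. N \<in> Orb c1 c2 \<Longrightarrow> X N = quad_vf c N"
  shows "linearization c1 c2 X (M2 p q) = Blinfun (linearized_vf c p q)"
  unfolding linearization_def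
proof (rule the_equality)
  have "Orb c1 c2 \<subseteq> so4" by (auto simp: Orb_def)
  then have "(quad_vf c has_derivative linearized_vf c p q) (at (M2 p q) within Orb c1 c2)"
    using quad_vf_has_derivative has_derivative_subset by blast
  then have der: "(X has_derivative linearized_vf c p q) (at (M2 p q) within Orb c1 c2)"
    by (rule has_derivative_transform[rotated 2]) (use X M in auto)
  then show L: "Blinfun (linearized_vf c p q) \<in> endo (tangent_orb (M2 p q)) \<and>
      (X has_derivative blinfun_apply (Blinfun (linearized_vf c p q))) (at (M2 p q) within Orb c1 c2)"
    using linearized_vf_endo[OF pq] by (simp add: bounded_linear_Blinfun_apply bounded_linear_linearized_vf)
  fix L assume "L \<in> endo (tangent_orb (M2 p q)) \<and>
      (X has_derivative blinfun_apply L) (at (M2 p q) within Orb c1 c2)"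
  then show "L = Blinfun (linearized_vf c p q)"
    using endo_eqI[OF _ _ _ subspace_tangent_orb] orbit_derivative_unique[OF M pq] L by blast
qed

text \<open>Lagrange multipliers: subtracting suitable multiples of the two Casimirs removes the linear terms of
the energy at \<open>M2 p q\<close> and leaves a form that is quadratic in the displacement.\<close>

lemma energy_expansion:
  fixes x1 x2 x3 y1 y2 y3 :: real
  assumes "x1\<^sup>2 + x2\<^sup>2 + x3\<^sup>2 + y1\<^sup>2 + y2\<^sup>2 + y3\<^sup>2 = p\<^sup>2 + q\<^sup>2" "x1*y1 + x2*y2 + x3*y3 = p * q"
    and "k2 * p = r * p + s * q" "m2 * q = r * q + s * p"
  shows "k1 * x1\<^sup>2 + k2 * x2\<^sup>2 + k3 * x3\<^sup>2 + m1 * y1\<^sup>2 + m2 * y2\<^sup>2 + m3 * y3\<^sup>2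
    = k2 * p\<^sup>2 + m2 * q\<^sup>2 + ((k1 - r) * x1\<^sup>2 + (k2 - r) * (x2 - p)\<^sup>2 + (k3 - r) * x3\<^sup>2
    + (m1 - r) * y1\<^sup>2 + (m2 - r) * (y2 - q)\<^sup>2 + (m3 - r) * y3\<^sup>2)
    - 2 * s * (x1 * y1 + (x2 - p) * (y2 - q) + x3 * y3)"
  using assms by algebra

lemma energy_critical:
  assumes M: "M2 p q \<in> Orb c1 c2" and pq: "p\<^sup>2 \<noteq> q\<^sup>2"
  shows "(energy c has_derivative (\<lambda>_. 0)) (at (M2 p q) within Orb c1 c2)"
proof -
  define D where "D = p\<^sup>2 - q\<^sup>2"
  have D: "D \<noteq> 0" using pq by (simp add: D_def)
  \<comment> \<open>the Lagrange multipliers of \<open>C1\<close> and \<open>C2\<close>\<close>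
  define r s where "r = (c 1 3 * p\<^sup>2 - c 2 4 * q\<^sup>2) / D" and "s = (c 2 4 - c 1 3) * p * q / D"
  have rs: "c 1 3 * p = r * p + s * q" "c 2 4 * q = r * q + s * p"
    unfolding r_def s_def using D
    by (simp_all add: field_simps) (simp_all add: D_def power2_eq_square algebra_simps)
  let ?d = "\<lambda>N i j. N$i$j - M2 p q $i$j"
  define G where "G N = energy c (M2 p q)
    + 1/2 * ((c 2 3 - r) * (?d N 3 2 * ?d N 3 2) + (c 1 3 - r) * (?d N 1 3 * ?d N 1 3)
           + (c 1 2 - r) * (?d N 2 1 * ?d N 2 1) + (c 1 4 - r) * (?d N 1 4 * ?d N 1 4)
           + (c 2 4 - r) * (?d N 2 4 * ?d N 2 4) + (c 3 4 - r) * (?d N 3 4 * ?d N 3 4))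
    + (- s) * (?d N 3 2 * ?d N 1 4 + ?d N 1 3 * ?d N 2 4 + ?d N 2 1 * ?d N 3 4)" for N
  have prod0: "((\<lambda>N. ?d N i j * ?d N k m) has_derivative (\<lambda>_. 0)) (at (M2 p q) within Orb c1 c2)" for i j k m
    by (rule has_derivative_eq_rhs, rule has_derivative_mult)
       (rule has_derivative_diff has_derivative_nth_nth has_derivative_ident has_derivative_const | simp)+
  have add0: "((\<lambda>N. f N + g N) has_derivative (\<lambda>_. 0)) (at (M2 p q) within Orb c1 c2)"
    if "(f has_derivative (\<lambda>_. 0)) (at (M2 p q) within Orb c1 c2)"
      "(g has_derivative (\<lambda>_. 0)) (at (M2 p q) within Orb c1 c2)" for f g :: "mat4 \<Rightarrow> real"
    using has_derivative_add[OF that] by simp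
  have mult0: "((\<lambda>N. k * f N) has_derivative (\<lambda>_. 0)) (at (M2 p q) within Orb c1 c2)"
    if "(f has_derivative (\<lambda>_. 0)) (at (M2 p q) within Orb c1 c2)" for k and f :: "mat4 \<Rightarrow> real"
    using has_derivative_mult_right[OF that] by simp
  have "(G has_derivative (\<lambda>_. 0)) (at (M2 p q) within Orb c1 c2)"
    unfolding G_def by (intro add0 mult0 prod0 has_derivative_const)
  moreover have "energy c N = G N" if N: "N \<in> Orb c1 c2" for N
  proof -
    obtain x1 x2 x3 y1 y2 y3 where N': "N = so4_mat x1 x2 x3 y1 y2 y3"
      using N so4_mat_cases unfolding Orb_def by blast
    have "x1\<^sup>2 + x2\<^sup>2 + x3\<^sup>2 + y1\<^sup>2 + y2\<^sup>2 + y3\<^sup>2 = p\<^sup>2 + q\<^sup>2" "x1*y1 + x2*y2 + x3*y3 = p * q"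
      using N M by (auto simp: N' so4_mat_in_Orb_iff M2_in_Orb_iff)
    then show ?thesis
      using rs energy_expansion[of x1 x2 x3 y1 y2 y3 p q "c 1 3" r s "c 2 4" "c 2 3" "c 1 2" "c 1 4" "c 3 4"]
      unfolding G_def energy_def N' M2_def so4_mat_nth by (simp add: power2_eq_square field_simps)
  qed
  ultimately show ?thesis
    using has_derivative_transform[OF M] by blast
qed

lemma quad_vf_M2: "quad_vf c (M2 p q) = 0"
  by (simp add: M2_def quad_vf_so4_mat so4_mat_zero)

section \<open>Invariant slices carrying Euler tops\<close>

text \<open>The condition under which \<open>quad_vf c\<close> restricts to the slice of \<open>\<mu>\<close> as the Euler top with speed factor \<open>g\<close>.
Each splitting of the four indices into two pairs gives two equations, one for the \<open>x\<close>-coordinate and one for the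
\<open>y\<close>-coordinate that belong to it; the slice is invariant because both have the same factor \<open>g\<close>.\<close>

definition euler_top_factor :: "(4 \<Rightarrow> 4 \<Rightarrow> real) \<Rightarrow> real^4 \<Rightarrow> real \<Rightarrow> real \<Rightarrow> bool" where
  "euler_top_factor c l \<mu> g \<longleftrightarrow> (\<forall>i j. c i j = c j i) \<and>
     (\<forall>(i, j, k, m) \<in> {(1,4,2,3), (2,3,1,4), (1,3,2,4), (2,4,1,3), (1,2,3,4), (3,4,1,2)}.
        (c j k - c i k) * ((l$k)\<^sup>2 - \<mu>) - (c j m - c i m) * ((l$m)\<^sup>2 - \<mu>)
        = g * ((l$i)\<^sup>2 - (l$j)\<^sup>2) * ((l$k)\<^sup>2 - (l$m)\<^sup>2))"

text \<open>The sign \<open>s\<close> distinguishes the slices outside and inside the interval between \<open>a\<^sub>3\<close> and \<open>a\<^sub>2\<close>: inside,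
\<open>a\<^sub>1 - \<mu>, a\<^sub>2 - \<mu>\<close> and \<open>a\<^sub>3 - \<mu>, a\<^sub>4 - \<mu>\<close> have opposite signs, and keeping the
weights real costs the sign \<open>s = -1\<close> in front of the last coordinate.\<close>

definition slice_point :: "real \<Rightarrow> real \<Rightarrow> real \<Rightarrow> real \<Rightarrow> real \<Rightarrow> real \<Rightarrow> real \<Rightarrow> real \<Rightarrow> mat4" where
  "slice_point s e1 e2 e3 e4 w1 w2 w3 = so4_mat (e2 * e3 * w1) (e1 * e3 * w2) (e1 * e2 * w3)
     (e1 * e4 * w1) (e2 * e4 * w2) (s * e3 * e4 * w3)"

text \<open>The weights are fixed only up to sign. Their signs are left free so that every sign pattern of
\<open>(p, q)\<close> is reached.\<close>

definition slice_weights :: "real^4 \<Rightarrow> real \<Rightarrow> real \<Rightarrow> real \<Rightarrow> real \<Rightarrow> real \<Rightarrow> real \<Rightarrow> real \<Rightarrow> bool" where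
  "slice_weights l \<mu> \<epsilon> s e1 e2 e3 e4 \<longleftrightarrow> \<epsilon>\<^sup>2 = 1 \<and> s\<^sup>2 = 1 \<and>
     e1\<^sup>2 = \<epsilon> * ((l$1)\<^sup>2 - \<mu>) \<and> e2\<^sup>2 = \<epsilon> * ((l$2)\<^sup>2 - \<mu>) \<and>
     e3\<^sup>2 = s * \<epsilon> * ((l$3)\<^sup>2 - \<mu>) \<and> e4\<^sup>2 = s * \<epsilon> * ((l$4)\<^sup>2 - \<mu>)"

definition gap_coeff :: "real^4 \<Rightarrow> 4 \<Rightarrow> real" where
  "gap_coeff l n = (if n = 1 then ((l$1)\<^sup>2 - (l$4)\<^sup>2) * ((l$2)\<^sup>2 - (l$3)\<^sup>2)
     else if n = 2 then ((l$1)\<^sup>2 - (l$3)\<^sup>2) * ((l$2)\<^sup>2 - (l$4)\<^sup>2)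
     else ((l$1)\<^sup>2 - (l$2)\<^sup>2) * ((l$3)\<^sup>2 - (l$4)\<^sup>2))"

text \<open>A Pluecker relation. For \<open>s = 1\<close> it makes \<open>w\<^sub>1\<^sup>2 + w\<^sub>2\<^sup>2 + w\<^sub>3\<^sup>2\<close> a constant of motion of the top, as \<open>C2\<close> requires.\<close>

lemma gap_coeff_sum: "gap_coeff l 2 = gap_coeff l 1 + gap_coeff l 3"
  by (simp add: gap_coeff_def algebra_simps)

lemma slice_equations:
  assumes "slice_weights l \<mu> \<epsilon> s e1 e2 e3 e4" "euler_top_factor c l \<mu> g"
  shows "(c 1 2 - c 1 3) * e1\<^sup>2 + s * (c 3 4 - c 2 4) * e4\<^sup>2 = - \<epsilon> * g * gap_coeff l 1"
    "s * (c 3 4 - c 1 3) * e3\<^sup>2 + (c 1 2 - c 2 4) * e2\<^sup>2 = - \<epsilon> * g * gap_coeff l 1"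
    "(c 2 3 - c 1 2) * e2\<^sup>2 + s * (c 1 4 - c 3 4) * e4\<^sup>2 = \<epsilon> * g * gap_coeff l 2"
    "(c 1 4 - c 1 2) * e1\<^sup>2 + s * (c 2 3 - c 3 4) * e3\<^sup>2 = \<epsilon> * g * gap_coeff l 2"
    "(c 1 3 - c 2 3) * e3\<^sup>2 + (c 2 4 - c 1 4) * e4\<^sup>2 = - s * \<epsilon> * g * gap_coeff l 3"
    "(c 2 4 - c 2 3) * e2\<^sup>2 + (c 1 3 - c 1 4) * e1\<^sup>2 = - \<epsilon> * g * gap_coeff l 3"
proof -
  have sy: "c 2 1 = c 1 2" "c 3 1 = c 1 3" "c 4 1 = c 1 4" "c 3 2 = c 2 3" "c 4 2 = c 2 4" "c 4 3 = c 3 4"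
    using assms(2) by (auto simp: euler_top_factor_def)
  have e: "e1\<^sup>2 = \<epsilon> * ((l$1)\<^sup>2 - \<mu>)" "e2\<^sup>2 = \<epsilon> * ((l$2)\<^sup>2 - \<mu>)"
     "e3\<^sup>2 = s * \<epsilon> * ((l$3)\<^sup>2 - \<mu>)" "e4\<^sup>2 = s * \<epsilon> * ((l$4)\<^sup>2 - \<mu>)"
    and s: "s\<^sup>2 = 1" using assms(1) by (auto simp: slice_weights_def)
  have ss: "s * x * (s * \<epsilon> * y) = \<epsilon> * (x * y)" for x y
    using s by (simp add: power2_eq_square algebra_simps)
  have E: "\<forall>(i, j, k, m) \<in> {(1,4,2,3), (2,3,1,4), (1,3,2,4), (2,4,1,3), (1,2,3,4), (3,4,1,2)}.
        (c j k - c i k) * ((l$k)\<^sup>2 - \<mu>) - (c j m - c i m) * ((l$m)\<^sup>2 - \<mu>)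
        = g * ((l$i)\<^sup>2 - (l$j)\<^sup>2) * ((l$k)\<^sup>2 - (l$m)\<^sup>2)"
    using assms(2) unfolding euler_top_factor_def by blast
  note E1 = bspec[OF E, of "(1,4,2,3)", simplified, unfolded sy]
   and E2 = bspec[OF E, of "(2,3,1,4)", simplified, unfolded sy]
   and E3 = bspec[OF E, of "(1,3,2,4)", simplified, unfolded sy]
   and E4 = bspec[OF E, of "(2,4,1,3)", simplified, unfolded sy]
   and E5 = bspec[OF E, of "(1,2,3,4)", simplified, unfolded sy]
   and E6 = bspec[OF E, of "(3,4,1,2)", simplified, unfolded sy]
  have m: "X = Y \<Longrightarrow> \<epsilon> * X = \<epsilon> * Y" for X Y by simp
  show "(c 1 2 - c 1 3) * e1\<^sup>2 + s * (c 3 4 - c 2 4) * e4\<^sup>2 = - \<epsilon> * g * gap_coeff l 1"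
    unfolding e ss gap_coeff_def using m[OF E2] by (simp add: algebra_simps)
  show "s * (c 3 4 - c 1 3) * e3\<^sup>2 + (c 1 2 - c 2 4) * e2\<^sup>2 = - \<epsilon> * g * gap_coeff l 1"
    unfolding e ss gap_coeff_def using m[OF E1] by (simp add: algebra_simps)
  show "(c 2 3 - c 1 2) * e2\<^sup>2 + s * (c 1 4 - c 3 4) * e4\<^sup>2 = \<epsilon> * g * gap_coeff l 2"
    unfolding e ss gap_coeff_def using m[OF E3] by (simp add: algebra_simps)
  show "(c 1 4 - c 1 2) * e1\<^sup>2 + s * (c 2 3 - c 3 4) * e3\<^sup>2 = \<epsilon> * g * gap_coeff l 2"
    unfolding e ss gap_coeff_def using m[OF E4] by (simp add: algebra_simps)
  show "(c 1 3 - c 2 3) * e3\<^sup>2 + (c 2 4 - c 1 4) * e4\<^sup>2 = - s * \<epsilon> * g * gap_coeff l 3"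
    unfolding e ss gap_coeff_def using arg_cong[OF m[OF E5], of "\<lambda>x. s * x"] by (simp add: algebra_simps)
  show "(c 2 4 - c 2 3) * e2\<^sup>2 + (c 1 3 - c 1 4) * e1\<^sup>2 = - \<epsilon> * g * gap_coeff l 3"
    unfolding e ss gap_coeff_def using m[OF E6] by (simp add: algebra_simps)
qed

lemma quad_vf_slice_point:
  assumes "slice_weights l \<mu> \<epsilon> s e1 e2 e3 e4" "euler_top_factor c l \<mu> g"
  shows "quad_vf c (slice_point s e1 e2 e3 e4 w1 w2 w3) = slice_point s e1 e2 e3 e4
     (- \<epsilon> * g * gap_coeff l 1 * (w2 * w3)) (\<epsilon> * g * gap_coeff l 2 * (w1 * w3))
     (- s * \<epsilon> * g * gap_coeff l 3 * (w1 * w2))"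
proof -
  have s: "s * s = 1" using assms(1) by (simp add: slice_weights_def power2_eq_square)
  have y3: "s * e3 * e4 * (- s * \<epsilon> * g * gap_coeff l 3 * (w1 * w2)) = 
     e3 * e4 * (- \<epsilon> * g * gap_coeff l 3 * (w1 * w2))"
    using s by (simp add: algebra_simps)
  note t = slice_equations[OF assms, symmetric]
  show ?thesis
    unfolding slice_point_def quad_vf_so4_mat so4_mat_eq_iff y3
    unfolding t(5)
    apply (intro conjI)
    subgoal unfolding t(1) by (simp add: power2_eq_square algebra_simps)
    subgoal unfolding t(3) by (simp add: power2_eq_square algebra_simps)
    subgoal by (simp add: power2_eq_square algebra_simps)
    subgoal unfolding t(2) by (simp add: power2_eq_square algebra_simps)
    subgoal unfolding t(4) by (simp add: power2_eq_square algebra_simps)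
    subgoal unfolding t(6) by (simp add: power2_eq_square algebra_simps)
    done
qed

lemma linearized_vf_slice_point:
  assumes "slice_weights l \<mu> \<epsilon> s e1 e2 e3 e4" "euler_top_factor c l \<mu> g"
    and pq: "p = w * (e1 * e3)" "q = w * (e2 * e4)"
  shows "linearized_vf c p q (slice_point s e1 e2 e3 e4 w1 0 w3) = slice_point s e1 e2 e3 e4
     (- \<epsilon> * g * gap_coeff l 1 * (w * w3)) 0 (- s * \<epsilon> * g * gap_coeff l 3 * (w1 * w))"
proof -
  have s: "s * s = 1" using assms(1) by (simp add: slice_weights_def power2_eq_square)
  have y3: "s * e3 * e4 * (- s * \<epsilon> * g * gap_coeff l 3 * (w1 * w)) = 
     e3 * e4 * (- \<epsilon> * g * gap_coeff l 3 * (w1 * w))"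
    using s by (simp add: algebra_simps)
  note t = slice_equations[OF assms(1,2), symmetric]
  show ?thesis
    unfolding slice_point_def mult_zero_right linearized_vf_so4_mat so4_mat_eq_iff y3 pq
    unfolding t(5)
    apply (intro conjI)
    subgoal unfolding t(1) by (simp add: power2_eq_square algebra_simps)
    subgoal by simp
    subgoal by (simp add: power2_eq_square algebra_simps)
    subgoal unfolding t(2) by (simp add: power2_eq_square algebra_simps)
    subgoal by simp
    subgoal unfolding t(6) by (simp add: power2_eq_square algebra_simps)
    done
qed

lemma euler_top_factor_I: "euler_top_factor (I_coeff l) l \<mu> (- 2)"
  by (simp add: euler_top_factor_def algebra_simps)

text \<open>The rational identity behind the factor of \<open>H\<close>. The quotient that appears is symmetric in all four
variables, which is why the same factor serves all six equations.\<close>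

lemma inertia_difference_identity:
  fixes x y z t :: real
  assumes "x + y \<noteq> 0" "x + z \<noteq> 0" "x + t \<noteq> 0" "y + z \<noteq> 0" "y + t \<noteq> 0" "z + t \<noteq> 0"
  shows "(1 / (y + z) - 1 / (x + z)) * (z\<^sup>2 - \<mu>) - (1 / (y + t) - 1 / (x + t)) * (t\<^sup>2 - \<mu>)
    = (x*y*z + x*y*t + x*z*t + y*z*t + \<mu> * (x + y + z + t))
      / ((x + y) * (x + z) * (x + t) * (y + z) * (y + t) * (z + t)) * (x\<^sup>2 - y\<^sup>2) * (z\<^sup>2 - t\<^sup>2)"
proof -
  have "(1 / (y + z) - 1 / (x + z)) * (z\<^sup>2 - \<mu>) - (1 / (y + t) - 1 / (x + t)) * (t\<^sup>2 - \<mu>)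
    = (x - y) * ((z\<^sup>2 - \<mu>) / ((y + z) * (x + z)) - (t\<^sup>2 - \<mu>) / ((y + t) * (x + t)))"
    using assms by (simp add: divide_simps) algebra
  also have "(z\<^sup>2 - \<mu>) / ((y + z) * (x + z)) - (t\<^sup>2 - \<mu>) / ((y + t) * (x + t))
    = (z - t) * (x*y*z + x*y*t + x*z*t + y*z*t + \<mu> * (x + y + z + t))
      / ((x + z) * (x + t) * (y + z) * (y + t))"
    using assms by (simp add: divide_simps) algebra
  also have "(x - y) * \<dots> = (x*y*z + x*y*t + x*z*t + y*z*t + \<mu> * (x + y + z + t))
      / ((x + y) * (x + z) * (x + t) * (y + z) * (y + t) * (z + t)) * ((x - y) * (x + y)) * ((z - t) * (z + t))"
    using assms by (simp add: divide_simps)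
  finally show ?thesis
    by (simp add: power2_eq_square algebra_simps)
qed

definition H_factor :: "real^4 \<Rightarrow> real \<Rightarrow> real" where
  "H_factor l \<mu> = (l$1*l$2*l$3 + l$1*l$2*l$4 + l$1*l$3*l$4 + l$2*l$3*l$4 + \<mu> * (l$1 + l$2 + l$3 + l$4))
     / ((l$1 + l$2) * (l$1 + l$3) * (l$1 + l$4) * (l$2 + l$3) * (l$2 + l$4) * (l$3 + l$4))"

lemma euler_top_factor_H:
  assumes "\<And>i j. i \<noteq> j \<Longrightarrow> l$i + l$j > 0"
  shows "euler_top_factor (H_coeff l) l \<mu> (H_factor l \<mu>)"
proof -
  have s: "l$1 + l$2 \<noteq> 0" "l$1 + l$3 \<noteq> 0" "l$1 + l$4 \<noteq> 0" "l$2 + l$3 \<noteq> 0" "l$2 + l$4 \<noteq> 0" "l$3 + l$4 \<noteq> 0"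
    using assms(1)[of 1 2] assms(1)[of 1 3] assms(1)[of 1 4] assms(1)[of 2 3] assms(1)[of 2 4]
      assms(1)[of 3 4] by auto
  then have s': "l$2 + l$1 \<noteq> 0" "l$3 + l$1 \<noteq> 0" "l$4 + l$1 \<noteq> 0" "l$3 + l$2 \<noteq> 0" "l$4 + l$2 \<noteq> 0" "l$4 + l$3 \<noteq> 0"
    by (simp_all add: add.commute)
  have "(H_coeff l j k - H_coeff l i k) * ((l$k)\<^sup>2 - \<mu>) - (H_coeff l j m - H_coeff l i m) * ((l$m)\<^sup>2 - \<mu>)
        = H_factor l \<mu> * ((l$i)\<^sup>2 - (l$j)\<^sup>2) * ((l$k)\<^sup>2 - (l$m)\<^sup>2)"
    if "(i, j, k, m) \<in> {(1,4,2,3), (2,3,1,4), (1,3,2,4), (2,4,1,3), (1,2,3,4), (3,4,1,2)}" for i j k m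
  proof -
    have "l$i + l$j \<noteq> 0" "l$i + l$k \<noteq> 0" "l$i + l$m \<noteq> 0" "l$j + l$k \<noteq> 0" "l$j + l$m \<noteq> 0" "l$k + l$m \<noteq> 0"
      using that s s' by auto
    note inertia_difference_identity[OF this]
    moreover have "(l$i*l$j*l$k + l$i*l$j*l$m + l$i*l$k*l$m + l$j*l$k*l$m + \<mu> * (l$i + l$j + l$k + l$m))
      / ((l$i + l$j) * (l$i + l$k) * (l$i + l$m) * (l$j + l$k) * (l$j + l$m) * (l$k + l$m)) = H_factor l \<mu>"
      unfolding H_factor_def using that
      by (intro arg_cong2[of _ _ _ _ "(/)"]) (auto simp: ac_simps)
    ultimately show ?thesis by metis
  qed
  then show ?thesis
    unfolding euler_top_factor_def by (intro conjI allI) (simp_all only: add.commute, blast)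
qed


lemma slice_point_linear:
  "slice_point s e1 e2 e3 e4 w1 w2 w3 + slice_point s e1 e2 e3 e4 v1 v2 v3
     = slice_point s e1 e2 e3 e4 (w1 + v1) (w2 + v2) (w3 + v3)"
  "r *\<^sub>R slice_point s e1 e2 e3 e4 w1 w2 w3 = slice_point s e1 e2 e3 e4 (r * w1) (r * w2) (r * w3)"
  by (simp_all add: slice_point_def so4_mat_add so4_mat_scaleR so4_mat_eq_iff algebra_simps)

lemma slice_point_tangent:
  assumes "p\<^sup>2 \<noteq> q\<^sup>2"
  shows "slice_point s e1 e2 e3 e4 w1 0 w3 \<in> tangent_orb (M2 p q)"
  unfolding tangent_orb_M2[OF assms] slice_point_def by auto

text \<open>Up to sign and scale the value is \<open>A\<^sub>1A\<^sub>2(a\<^sub>3 - a\<^sub>4) + A\<^sub>3A\<^sub>4(a\<^sub>1 - a\<^sub>2)\<close> with \<open>A\<^sub>i = a\<^sub>i - \<mu>\<close>. The existence of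
real weights forces both products to be nonnegative, and they cannot vanish together.\<close>

lemma omega_slice_pair_nonzero:
  assumes top: "slice_weights l \<mu> \<epsilon> s e1 e2 e3 e4" and pq: "p = w * (e1 * e3)" "q = w * (e2 * e4)" "p\<^sup>2 \<noteq> q\<^sup>2"
    and ord: "(l$1)\<^sup>2 > (l$2)\<^sup>2" "(l$2)\<^sup>2 > (l$3)\<^sup>2" "(l$3)\<^sup>2 > (l$4)\<^sup>2"
  shows "omega p q (slice_point s e1 e2 e3 e4 1 0 0) (slice_point s e1 e2 e3 e4 0 0 1) \<noteq> 0"
proof -
  define A1 A2 A3 A4 where A: "A1 = (l$1)\<^sup>2 - \<mu>" "A2 = (l$2)\<^sup>2 - \<mu>" "A3 = (l$3)\<^sup>2 - \<mu>" "A4 = (l$4)\<^sup>2 - \<mu>"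
  have e: "e1\<^sup>2 = \<epsilon> * A1" "e2\<^sup>2 = \<epsilon> * A2" "e3\<^sup>2 = s * \<epsilon> * A3" "e4\<^sup>2 = s * \<epsilon> * A4"
    and sg: "\<epsilon>\<^sup>2 = 1" "s\<^sup>2 = 1"
    using top by (auto simp: slice_weights_def A)
  have "w \<noteq> 0" using pq by auto
  have num: "p * (e2*e3 * (e1*e2) + e1*e4 * (s*e3*e4)) - q * (e2*e3 * (s*e3*e4) + e1*e4 * (e1*e2))
    = w * s * \<epsilon> * (A1 * A2 * (A3 - A4) + A3 * A4 * (A1 - A2))"
  proof -
    have "p * (e2*e3 * (e1*e2) + e1*e4 * (s*e3*e4)) - q * (e2*e3 * (s*e3*e4) + e1*e4 * (e1*e2))
      = w * (e1\<^sup>2 * e3\<^sup>2 * (e2\<^sup>2 + s * e4\<^sup>2) - e2\<^sup>2 * e4\<^sup>2 * (s * e3\<^sup>2 + e1\<^sup>2))"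
      unfolding pq by (simp add: power2_eq_square algebra_simps)
    also have "\<dots> = w * s * \<epsilon> * (A1 * A2 * (A3 - A4) + A3 * A4 * (A1 - A2))"
      unfolding e using sg by algebra
    finally show ?thesis .
  qed
  have "\<epsilon> * A1 \<ge> 0" "\<epsilon> * A2 \<ge> 0" "s * \<epsilon> * A3 \<ge> 0" "s * \<epsilon> * A4 \<ge> 0"
    using e by (metis zero_le_power2)+
  then have "(\<epsilon> * A1) * (\<epsilon> * A2) \<ge> 0" "(s * \<epsilon> * A3) * (s * \<epsilon> * A4) \<ge> 0"
    by (meson mult_nonneg_nonneg)+
  moreover have "(\<epsilon> * A1) * (\<epsilon> * A2) = A1 * A2" "(s * \<epsilon> * A3) * (s * \<epsilon> * A4) = A3 * A4"
    using sg by algebra+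
  ultimately have nn: "A1 * A2 \<ge> 0" "A3 * A4 \<ge> 0" by simp_all
  have gap: "A1 - A2 > 0" "A3 - A4 > 0" using ord by (simp_all add: A)
  have "A1 * A2 \<noteq> 0 \<or> A3 * A4 \<noteq> 0" using ord by (auto simp: A)
  then have "A1 * A2 * (A3 - A4) + A3 * A4 * (A1 - A2) > 0"
  proof
    assume "A1 * A2 \<noteq> 0"
    then have "A1 * A2 > 0" using nn by linarith
    then have "A1 * A2 * (A3 - A4) > 0" using mult_pos_pos gap by blast
    moreover have "A3 * A4 * (A1 - A2) \<ge> 0" by (rule mult_nonneg_nonneg) (use nn gap in auto)
    ultimately show ?thesis by linarith
  next
    assume "A3 * A4 \<noteq> 0"
    then have "A3 * A4 > 0" using nn by linarith
    then have "A3 * A4 * (A1 - A2) > 0" using mult_pos_pos gap by blast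
    moreover have "A1 * A2 * (A3 - A4) \<ge> 0" by (rule mult_nonneg_nonneg) (use nn gap in auto)
    ultimately show ?thesis by linarith
  qed
  then have "w * s * \<epsilon> * (A1 * A2 * (A3 - A4) + A3 * A4 * (A1 - A2)) \<noteq> 0"
    using \<open>w \<noteq> 0\<close> sg by auto
  then show ?thesis
    using pq(3) num by (simp add: omega_def slice_point_def)
qed

text \<open>The linearization of \<open>I\<close> is infinitesimally symplectic, so its square is \<open>\<omega>\<close>-symmetric. The square is a
positive multiple of the identity on the plane of the outer slice and a negative one on the plane of the inner slice, and
eigenspaces for different eigenvalues are orthogonal.\<close>

lemma omega_slice_orthogonal:
  assumes top: "slice_weights l \<mu> \<epsilon> 1 e1 e2 e3 e4" "p = w * (e1 * e3)" "q = w * (e2 * e4)"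
    and top': "slice_weights l \<nu> \<epsilon>' (-1) f1 f2 f3 f4" "p = v * (f1 * f3)" "q = v * (f2 * f4)"
    and pq: "p\<^sup>2 \<noteq> q\<^sup>2" and pos: "gap_coeff l 1 > 0" "gap_coeff l 3 > 0"
  shows "omega p q (slice_point 1 e1 e2 e3 e4 x 0 y) (slice_point (-1) f1 f2 f3 f4 x' 0 y') = 0"
proof -
  let ?L = "linearized_vf (I_coeff l) p q"
  let ?u = "slice_point 1 e1 e2 e3 e4 x 0 y" and ?v = "slice_point (-1) f1 f2 f3 f4 x' 0 y'"
  define k where "k = 4 * gap_coeff l 1 * gap_coeff l 3"
  have sg: "\<epsilon> * \<epsilon> = 1" "\<epsilon>' * \<epsilon>' = 1"
    using top(1) top'(1) by (simp_all add: slice_weights_def power2_eq_square)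
  have "?L (?L ?u) = (\<epsilon> * \<epsilon> * k * w\<^sup>2) *\<^sub>R ?u"
    unfolding linearized_vf_slice_point[OF top(1) euler_top_factor_I top(2,3)] slice_point_linear
    by (simp add: k_def power2_eq_square algebra_simps)
  moreover have "?L (?L ?v) = (- (\<epsilon>' * \<epsilon>' * k * v\<^sup>2)) *\<^sub>R ?v"
    unfolding linearized_vf_slice_point[OF top'(1) euler_top_factor_I top'(2,3)] slice_point_linear
    by (simp add: k_def power2_eq_square algebra_simps)
  moreover have "omega p q (?L (?L ?u)) ?v = omega p q ?u (?L (?L ?v))"
  proof -
    have u: "?u \<in> tangent_orb (M2 p q)" "?L ?u \<in> tangent_orb (M2 p q)"
      and v: "?v \<in> tangent_orb (M2 p q)" "?L ?v \<in> tangent_orb (M2 p q)"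
      unfolding linearized_vf_slice_point[OF top(1) euler_top_factor_I top(2,3)]
        linearized_vf_slice_point[OF top'(1) euler_top_factor_I top'(2,3)]
      by (rule slice_point_tangent[OF pq])+
    show ?thesis
      using omega_linearized_vf[OF u(2) v(1) pq] omega_linearized_vf[OF u(1) v(2) pq] by simp
  qed
  ultimately have "k * w\<^sup>2 * omega p q ?u ?v = - (k * v\<^sup>2) * omega p q ?u ?v"
    by (simp only: omega_linear sg mult_1)
  then have "k * (w\<^sup>2 + v\<^sup>2) * omega p q ?u ?v = 0" by (simp add: algebra_simps)
  moreover have "k > 0" using pos by (simp add: k_def)
  moreover have "w\<^sup>2 + v\<^sup>2 \<noteq> 0" using pq top by (auto simp: sum_power2_eq_zero_iff)
  ultimately show ?thesis by auto
qed


section \<open>A symplectic frame in center-saddle form\<close>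

lemma symplectic_frameI:
  fixes b1 b2 b3 b4 :: mat4
  assumes pq: "p\<^sup>2 \<noteq> q\<^sup>2" and T: "{b1, b2, b3, b4} \<subseteq> tangent_orb (M2 p q)"
    and om: "omega p q b1 b3 = 1" "omega p q b2 b4 = 1" "omega p q b1 b2 = 0" "omega p q b1 b4 = 0"
      "omega p q b3 b2 = 0" "omega p q b3 b4 = 0"
  shows "symplectic_frame (tangent_orb (M2 p q)) (orb_form (M2 p q))
     (\<lambda>u. u$1 *\<^sub>R b1 + u$2 *\<^sub>R b2 + u$3 *\<^sub>R b3 + u$4 *\<^sub>R b4)"
proof -
  let ?T = "tangent_orb (M2 p q)"
  let ?phi = "\<lambda>u::real^4. u$1 *\<^sub>R b1 + u$2 *\<^sub>R b2 + u$3 *\<^sub>R b3 + u$4 *\<^sub>R b4"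
  have subT: "subspace ?T" by (rule subspace_tangent_orb)
  have lin: "linear ?phi"
    by (rule linearI) (simp_all add: algebra_simps)
  have phiT: "?phi u \<in> ?T" for u
    using T by (auto intro!: subspace_add[OF subT] subspace_scale[OF subT])
  have self: "omega p q b b = 0" for b using omega_skew[of p q b b] by simp
  have om': "omega p q b3 b1 = - 1" "omega p q b4 b2 = - 1" "omega p q b2 b1 = 0" "omega p q b4 b1 = 0"
      "omega p q b2 b3 = 0" "omega p q b4 b3 = 0"
    using om omega_skew[of p q b3 b1] omega_skew[of p q b4 b2] omega_skew[of p q b2 b1]
      omega_skew[of p q b4 b1] omega_skew[of p q b2 b3] omega_skew[of p q b4 b3] by auto
  have symp: "orb_form (M2 p q) (?phi u) (?phi v) = std_form u v" for u v
    unfolding orb_form_M2[OF pq phiT phiT] omega_linear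
    by (simp add: om om' self std_form_def algebra_simps)
  have inj: "inj ?phi"
  proof (rule injI)
    fix u v assume eq: "?phi u = ?phi v"
    have "std_form u z = std_form v z" for z
      unfolding symp[symmetric] eq ..
    from this[of "axis 1 1"] this[of "axis 2 1"] this[of "axis 3 1"] this[of "axis 4 1"]
    show "u = v" by (simp add: std_form_def axis_def vec_eq_iff forall_4)
  qed
  let ?chi = "\<lambda>M::mat4. (vector [M$3$2, M$2$1, M$1$4, M$3$4] :: real^4)"
  let ?psi = "\<lambda>u::real^4. so4_mat (u$1) 0 (u$2) (u$3) 0 (u$4)"
  have psi_chi: "?psi (?chi M) = M" if "M \<in> ?T" for M
    using that unfolding tangent_orb_M2[OF pq] by (auto simp: vector_4_nth)
  have "linear ?chi"
    by (rule linearI) (simp_all add: vec_eq_iff forall_4 vector_4_nth)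
  then have "linear (?chi \<circ> ?phi)" using lin linear_compose by blast
  moreover have "inj (?chi \<circ> ?phi)"
  proof (rule injI)
    fix u v assume "(?chi \<circ> ?phi) u = (?chi \<circ> ?phi) v"
    then have "?psi (?chi (?phi u)) = ?psi (?chi (?phi v))" by (simp only: o_def)
    then have "?phi u = ?phi v" unfolding psi_chi[OF phiT] .
    then show "u = v" by (rule injD[OF inj])
  qed
  ultimately have surj: "surj (?chi \<circ> ?phi)"
    by (rule linear_injective_imp_surjective) simp
  have "?T \<subseteq> range ?phi"
  proof
    fix M assume M: "M \<in> ?T"
    obtain u where "?chi M = ?chi (?phi u)" using surjD[OF surj, of "?chi M"] unfolding o_def by blast
    then have "?psi (?chi M) = ?psi (?chi (?phi u))" by (simp only:)
    then have "M = ?phi u" unfolding psi_chi[OF phiT] psi_chi[OF M] .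
    then show "M \<in> range ?phi" by blast
  qed
  then have "bij_betw ?phi UNIV ?T"
    using inj phiT unfolding bij_betw_def by blast
  then show ?thesis
    unfolding symplectic_frame_def using subT lin symp by blast
qed

text \<open>On the outer plane the linearizations act by a matrix with zero diagonal and off-diagonal entries proportional to
\<open>d\<^sub>1\<close> and \<open>d\<^sub>3\<close>, so \<open>(\<surd>d\<^sub>1, \<plusminus> \<surd>d\<^sub>3)\<close> are eigenvectors for all Hamiltonians. On the inner plane the entries are
proportional to \<open>d\<^sub>1\<close> and \<open>- d\<^sub>3\<close>, and rescaling the axes by \<open>\<surd>d\<^sub>1\<close> and \<open>\<surd>d\<^sub>3\<close> turns the action into a rotation. The
remaining freedom of scale normalizes the symplectic form.\<close>

lemma center_saddle_frame:
  assumes ord: "(l$1)\<^sup>2 > (l$2)\<^sup>2" "(l$2)\<^sup>2 > (l$3)\<^sup>2" "(l$3)\<^sup>2 > (l$4)\<^sup>2" and pq: "p\<^sup>2 \<noteq> q\<^sup>2"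
    and out: "slice_weights l \<mu> \<epsilon> 1 e1 e2 e3 e4" "p = w * (e1 * e3)" "q = w * (e2 * e4)"
    and inn: "slice_weights l \<nu> \<epsilon>' (-1) f1 f2 f3 f4" "p = v * (f1 * f3)" "q = v * (f2 * f4)"
  obtains \<phi> \<alpha> \<beta> where "symplectic_frame (tangent_orb (M2 p q)) (orb_form (M2 p q)) \<phi>"
    and "\<alpha> \<noteq> 0" "\<beta> \<noteq> 0"
    and "\<And>c g h u. euler_top_factor c l \<mu> g \<Longrightarrow> euler_top_factor c l \<nu> h \<Longrightarrow>
       linearized_vf c p q (\<phi> u) = \<phi> (center_saddle_mat (\<alpha> * g) (\<beta> * h) *v u)"
proof -
  define d1 d3 where d: "d1 = gap_coeff l 1" "d3 = gap_coeff l 3"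
  have dpos: "d1 > 0" "d3 > 0" using ord by (simp_all add: d gap_coeff_def)
  define r1 r3 where r: "r1 = sqrt d1" "r3 = sqrt d3"
  have rpos: "r1 > 0" "r3 > 0" and rsq: "d1 = r1 * r1" "d3 = r3 * r3" using dpos by (simp_all add: r)
  let ?F = "slice_point 1 e1 e2 e3 e4" and ?G = "slice_point (-1) f1 f2 f3 f4"
  define \<Omega> \<Omega>' where Om: "\<Omega> = omega p q (?F 1 0 0) (?F 0 0 1)" "\<Omega>' = omega p q (?G 1 0 0) (?G 0 0 1)"
  have Om0: "\<Omega> \<noteq> 0" "\<Omega>' \<noteq> 0"
    unfolding Om using omega_slice_pair_nonzero[OF out pq ord] omega_slice_pair_nonzero[OF inn pq ord] by auto
  have OmF: "omega p q (?F x 0 y) (?F x' 0 y') = (x * y' - y * x') * \<Omega>" for x y x' y'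
    by (simp add: Om omega_def slice_point_def diff_divide_distrib[symmetric] algebra_simps)
  have OmG: "omega p q (?G x 0 y) (?G x' 0 y') = (x * y' - y * x') * \<Omega>'" for x y x' y'
    by (simp add: Om omega_def slice_point_def diff_divide_distrib[symmetric] algebra_simps)
  have FG: "omega p q (?F x 0 y) (?G x' 0 y') = 0" for x y x' y'
    using omega_slice_orthogonal[OF out inn pq] dpos d by simp
  \<comment> \<open>normalizes the pairing of the two real eigenvectors\<close>
  define \<kappa> where "\<kappa> = - 1 / (2 * r1 * r3 * \<Omega>)"
  define k where "k = 1 / sqrt (r1 * r3 * \<bar>\<Omega>'\<bar>)"
  \<comment> \<open>orientation of the rotation plane\<close>
  define \<sigma> where "\<sigma> = sgn \<Omega>'"
  have s0: "\<sigma> * \<sigma> = 1" using Om0 by (simp add: \<sigma>_def sgn_if)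
  then have s1: "\<sigma> * (\<sigma> * x) = x" for x by (simp flip: mult.assoc)
  have ksq: "\<sigma> * (k * k) * (r1 * r3) * \<Omega>' = 1"
    using rpos Om0 by (simp add: k_def \<sigma>_def sgn_if field_simps)
  have \<kappa>: "\<kappa> * (- 2 * (r1 * r3)) * \<Omega> = 1"
    using rpos Om0 by (simp add: \<kappa>_def field_simps)
  define b1 where "b1 = ?F r1 0 r3"
  define b3 where "b3 = ?F (\<kappa> * r1) 0 (- \<kappa> * r3)"
  define b2 where "b2 = ?G (k * r1) 0 0"
  define b4 where "b4 = ?G 0 0 (\<sigma> * k * r3)"
  define \<phi> where "\<phi> = (\<lambda>u::real^4. u$1 *\<^sub>R b1 + u$2 *\<^sub>R b2 + u$3 *\<^sub>R b3 + u$4 *\<^sub>R b4)"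
  have "symplectic_frame (tangent_orb (M2 p q)) (orb_form (M2 p q)) \<phi>"
    unfolding \<phi>_def
  proof (rule symplectic_frameI[OF pq])
    show "{b1, b2, b3, b4} \<subseteq> tangent_orb (M2 p q)"
      unfolding b1_def b2_def b3_def b4_def using slice_point_tangent[OF pq] by simp
    show "omega p q b1 b3 = 1" unfolding b1_def b3_def OmF using \<kappa> by (simp add: algebra_simps)
    show "omega p q b2 b4 = 1" unfolding b2_def b4_def OmG using ksq by (simp add: algebra_simps)
    show "omega p q b1 b2 = 0" "omega p q b1 b4 = 0" "omega p q b3 b2 = 0" "omega p q b3 b4 = 0"
      unfolding b1_def b2_def b3_def b4_def by (rule FG)+
  qed
  moreover have w0: "w \<noteq> 0" "v \<noteq> 0" using pq out inn by auto
  have sg: "\<epsilon> \<noteq> 0" "\<epsilon>' \<noteq> 0" using out(1) inn(1) by (auto simp: slice_weights_def)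
  have "\<epsilon> * w * r1 * r3 \<noteq> 0" "\<sigma> * \<epsilon>' * v * r1 * r3 \<noteq> 0"
    using w0 sg s0 rpos by auto
  moreover have "linearized_vf c p q (\<phi> u) = \<phi> (center_saddle_mat ((\<epsilon> * w * r1 * r3) * g) ((\<sigma> * \<epsilon>' * v * r1 * r3) * h) *v u)"
    if ef: "euler_top_factor c l \<mu> g" "euler_top_factor c l \<nu> h" for c g h u
  proof -
    interpret L: bounded_linear "linearized_vf c p q" by (rule bounded_linear_linearized_vf)
    note LF = linearized_vf_slice_point[OF out(1) ef(1) out(2,3)] and LG = linearized_vf_slice_point[OF inn(1) ef(2) inn(2,3)]
    have "linearized_vf c p q b1 = (- ((\<epsilon> * w * r1 * r3) * g)) *\<^sub>R b1"
      "linearized_vf c p q b3 = ((\<epsilon> * w * r1 * r3) * g) *\<^sub>R b3"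
      unfolding b1_def b3_def LF slice_point_linear d[symmetric] rsq by (simp_all add: ac_simps)
    moreover have "linearized_vf c p q b2 = ((\<sigma> * \<epsilon>' * v * r1 * r3) * h) *\<^sub>R b4"
      "linearized_vf c p q b4 = (- ((\<sigma> * \<epsilon>' * v * r1 * r3) * h)) *\<^sub>R b2"
      unfolding b2_def b4_def LG slice_point_linear d[symmetric] rsq
      by (simp_all add: ac_simps s1)
    ultimately show ?thesis
      unfolding \<phi>_def L.add L.scaleR center_saddle_mat_mult vector_4_nth
      by (simp add: algebra_simps)
  qed
  ultimately show ?thesis using that by blast
qed


section \<open>The two slices through an equilibrium\<close>

text \<open>The nonnegative weights, as explicit functions of \<open>\<mu>\<close>, so that they can be varied continuously.\<close>

definition slice_weight :: "real^4 \<Rightarrow> real \<Rightarrow> real \<Rightarrow> real \<Rightarrow> 4 \<Rightarrow> real" where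
  "slice_weight l \<mu> \<epsilon> s i = sqrt ((if i = 1 \<or> i = 2 then \<epsilon> else s * \<epsilon>) * ((l$i)\<^sup>2 - \<mu>))"

lemma M2_in_slice:
  assumes sg: "\<epsilon>\<^sup>2 = 1" "s\<^sup>2 = 1"
    and nn: "\<epsilon> * ((l$1)\<^sup>2 - \<mu>) \<ge> 0" "\<epsilon> * ((l$2)\<^sup>2 - \<mu>) \<ge> 0"
      "s * \<epsilon> * ((l$3)\<^sup>2 - \<mu>) \<ge> 0" "s * \<epsilon> * ((l$4)\<^sup>2 - \<mu>) \<ge> 0"
    and root: "q\<^sup>2 * (((l$1)\<^sup>2 - \<mu>) * ((l$3)\<^sup>2 - \<mu>)) = p\<^sup>2 * (((l$2)\<^sup>2 - \<mu>) * ((l$4)\<^sup>2 - \<mu>))"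
    and nz: "((l$1)\<^sup>2 - \<mu>) * ((l$3)\<^sup>2 - \<mu>) \<noteq> 0 \<or> ((l$2)\<^sup>2 - \<mu>) * ((l$4)\<^sup>2 - \<mu>) \<noteq> 0"
  obtains t w where "t\<^sup>2 = 1"
    "p = w * (slice_weight l \<mu> \<epsilon> s 1 * slice_weight l \<mu> \<epsilon> s 3)"
    "q = w * (slice_weight l \<mu> \<epsilon> s 2 * (t * slice_weight l \<mu> \<epsilon> s 4))"
    "slice_weights l \<mu> \<epsilon> s (slice_weight l \<mu> \<epsilon> s 1) (slice_weight l \<mu> \<epsilon> s 2) (slice_weight l \<mu> \<epsilon> s 3) (t * slice_weight l \<mu> \<epsilon> s 4)"
proof -
  let ?e = "slice_weight l \<mu> \<epsilon> s"
  have e: "(?e 1)\<^sup>2 = \<epsilon> * ((l$1)\<^sup>2 - \<mu>)" "(?e 2)\<^sup>2 = \<epsilon> * ((l$2)\<^sup>2 - \<mu>)"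
    "(?e 3)\<^sup>2 = s * \<epsilon> * ((l$3)\<^sup>2 - \<mu>)" "(?e 4)\<^sup>2 = s * \<epsilon> * ((l$4)\<^sup>2 - \<mu>)"
    unfolding slice_weight_def using nn by simp_all
  define X Y where "X = ?e 1 * ?e 3" and "Y = ?e 2 * ?e 4"
  have XY: "X\<^sup>2 = s * (((l$1)\<^sup>2 - \<mu>) * ((l$3)\<^sup>2 - \<mu>))" "Y\<^sup>2 = s * (((l$2)\<^sup>2 - \<mu>) * ((l$4)\<^sup>2 - \<mu>))"
    unfolding X_def Y_def power_mult_distrib e using sg by algebra+
  have rel: "q\<^sup>2 * X\<^sup>2 = p\<^sup>2 * Y\<^sup>2"
    unfolding XY using root by algebra
  have "s \<noteq> 0" using sg by auto
  then have "X \<noteq> 0 \<or> Y \<noteq> 0" using nz XY by fastforce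
  then obtain t w where tw: "t\<^sup>2 = 1" "p = w * X" "q = w * (t * Y)"
  proof (cases "X = 0")
    case True
    then have "p = 0" "Y \<noteq> 0" using rel \<open>X \<noteq> 0 \<or> Y \<noteq> 0\<close> by auto
    then show ?thesis using True that[of 1 "q / Y"] by simp
  next
    case False
    then have "q\<^sup>2 = (p / X * Y)\<^sup>2" using rel by (simp add: power_mult_distrib power_divide field_simps)
    then have "q = p / X * Y \<or> q = - (p / X * Y)" by (simp only: power2_eq_iff)
    then show ?thesis using False that[of 1 "p / X"] that[of "- 1" "p / X"] by auto
  qed
  show ?thesis
  proof (rule that[OF tw(1)])
    show "p = w * (?e 1 * ?e 3)" "q = w * (?e 2 * (t * ?e 4))"
      using tw by (simp_all add: X_def Y_def ac_simps)
    show "slice_weights l \<mu> \<epsilon> s (?e 1) (?e 2) (?e 3) (t * ?e 4)"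
      unfolding slice_weights_def power_mult_distrib e using sg tw(1) by simp
  qed
qed

text \<open>The quadratic function \<open>g\<close> that measures the failure of the equation changes sign between \<open>a\<^sub>3\<close> and
\<open>a\<^sub>2\<close>, which gives \<open>\<nu>\<close>. Its leading coefficient is \<open>q\<^sup>2 - p\<^sup>2\<close>, so the other root \<open>\<mu>\<close> comes from the
sum of the roots, and the signs of \<open>g a4\<close> and \<open>g a1\<close> locate it.\<close>

lemma interlacing_roots:
  fixes a1 a2 a3 a4 p q :: real
  assumes ord: "a1 > a2" "a2 > a3" "a3 > a4" and pq: "p\<^sup>2 \<noteq> q\<^sup>2"
  obtains \<mu> \<nu> where
    "q\<^sup>2 * ((a1 - \<mu>) * (a3 - \<mu>)) = p\<^sup>2 * ((a2 - \<mu>) * (a4 - \<mu>))"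
    "q\<^sup>2 * ((a1 - \<nu>) * (a3 - \<nu>)) = p\<^sup>2 * ((a2 - \<nu>) * (a4 - \<nu>))"
    "a3 \<le> \<nu>" "\<nu> \<le> a2" "q\<^sup>2 < p\<^sup>2 \<and> \<mu> \<le> a4 \<or> p\<^sup>2 < q\<^sup>2 \<and> a1 \<le> \<mu>"
proof -
  define g where "g x = q\<^sup>2 * ((a1 - x) * (a3 - x)) - p\<^sup>2 * ((a2 - x) * (a4 - x))" for x
  have "g a2 \<le> 0" unfolding g_def using ord by (simp add: mult_nonneg_nonpos)
  moreover have "0 \<le> g a3" unfolding g_def using ord by (simp add: mult_nonneg_nonpos)
  moreover have "continuous_on {a3..a2} g"
    unfolding g_def by (intro continuous_intros)
  ultimately obtain \<nu> where \<nu>: "a3 \<le> \<nu>" "\<nu> \<le> a2" "g \<nu> = 0"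
    using IVT2'[of g a2 0 a3] ord by auto
  define k where "k = q\<^sup>2 - p\<^sup>2"
  have k: "k \<noteq> 0" using pq by (simp add: k_def)
  define \<mu> where "\<mu> = (q\<^sup>2 * (a1 + a3) - p\<^sup>2 * (a2 + a4)) / k - \<nu>"
  have k\<mu>: "k * \<mu> = q\<^sup>2 * (a1 + a3) - p\<^sup>2 * (a2 + a4) - k * \<nu>"
  proof -
    have "k * (N / k - \<nu>) = N - k * \<nu>" for N using k by (simp add: right_diff_distrib)
    then show ?thesis unfolding \<mu>_def .
  qed
  have fac: "g x = k * (x - \<nu>) * (x - \<mu>)" for x
    using k\<mu> \<nu>(3) unfolding g_def k_def by algebra
  have "q\<^sup>2 < p\<^sup>2 \<and> \<mu> \<le> a4 \<or> p\<^sup>2 < q\<^sup>2 \<and> a1 \<le> \<mu>"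
  proof (cases "q\<^sup>2 < p\<^sup>2")
    case True
    have "0 \<le> g a4" unfolding g_def using ord by simp
    moreover have "k * (a4 - \<nu>) > 0" using True ord \<nu> by (intro mult_neg_neg) (auto simp: k_def)
    ultimately have "0 \<le> a4 - \<mu>"
      unfolding fac using zero_le_mult_iff[of "k * (a4 - \<nu>)" "a4 - \<mu>"] by linarith
    then show ?thesis using True by simp
  next
    case False
    then have lt: "p\<^sup>2 < q\<^sup>2" using pq by simp
    have "g a1 \<le> 0" unfolding g_def using ord by (simp add: mult_nonpos_nonpos)
    moreover have "k * (a1 - \<nu>) > 0" using lt ord \<nu> by (intro mult_pos_pos) (auto simp: k_def)
    ultimately have "a1 - \<mu> \<le> 0"
      unfolding fac using mult_le_0_iff[of "k * (a1 - \<nu>)" "a1 - \<mu>"] by linarith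
    then show ?thesis using lt by simp
  qed
  moreover have "g \<mu> = 0" by (simp add: fac)
  ultimately show ?thesis using that[of \<mu> \<nu>] \<nu> by (simp add: g_def)
qed

section \<open>Explicit solutions of the Euler top\<close>

text \<open>Separation of variables: the inverse function of \<open>F x = \<integral> 1 / f\<close> over \<open>x0..x\<close> solves the equation, and the
upper bound on \<open>f\<close> makes \<open>F\<close> surjective, so the solution exists for all times and reaches
every value.\<close>

lemma autonomous_solution:
  fixes f :: "real \<Rightarrow> real"
  assumes cont: "continuous_on UNIV f" and pos: "\<And>x. f x > 0" and bd: "\<And>x. f x \<le> K"
  obtains \<theta> where "\<theta> 0 = x0" "\<And>t. (\<theta> has_real_derivative f (\<theta> t)) (at t)"
    "\<And>x. x \<ge> x0 \<Longrightarrow> \<exists>t\<ge>0. \<theta> t = x" "\<And>x. x \<le> x0 \<Longrightarrow> \<exists>t\<le>0. \<theta> t = x"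
proof -
  define F where "F x = (LBINT y=x0..x. 1 / f y)" for x :: real
  have contf: "continuous_on S (\<lambda>x. 1 / f x)" for S
    by (intro continuous_intros continuous_on_subset[OF cont]) (use pos in \<open>auto simp: less_imp_neq[symmetric]\<close>)
  have dF: "(F has_real_derivative 1 / f x) (at x)" for x
  proof -
    let ?a = "min x x0 - 1" and ?b = "max x x0 + 1"
    have "(F has_vector_derivative 1 / f x) (at x within {?a..?b})"
      unfolding F_def by (rule interval_integral_FTC2) (auto intro: contf)
    moreover have "at x within {?a..?b} = at x"
      by (rule at_within_interior) (auto simp: interior_atLeastAtMost_real)
    ultimately show ?thesis by (simp add: has_real_derivative_iff_has_vector_derivative)
  qed
  have F0: "F x0 = 0" by (simp add: F_def)
  have mono: "x < y \<Longrightarrow> F x < F y" for x y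
    using DERIV_pos_imp_increasing[of x y F] dF pos by (metis divide_pos_pos zero_less_one)
  then have mono': "F x \<le> F y \<longleftrightarrow> x \<le> y" for x y
    by (metis linorder_not_le order_le_less)
  have inj: "F x = F y \<longleftrightarrow> x = y" for x y
    by (metis mono less_irrefl linorder_neqE)
  have K: "K > 0" using pos[of 0] bd[of 0] by linarith
  have grow: "(y - x) / K \<le> F y - F x" if "x \<le> y" for x y
  proof -
    have "((\<lambda>z. F z - z / K) has_real_derivative 1 / f z - 1 / K) (at z)" for z
      using K by (auto intro!: derivative_eq_intros dF)
    moreover have "1 / f z - 1 / K \<ge> 0" for z
      using frac_le[of 1 1 "f z" K] bd[of z] pos[of z] by simp
    ultimately have "F x - x / K \<le> F y - y / K"
      using DERIV_nonneg_imp_nondecreasing[OF that, of "\<lambda>z. F z - z / K"] by metis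
    then show ?thesis by (simp add: diff_divide_distrib)
  qed
  have isC: "isCont F x" for x using dF DERIV_isCont by blast
  have surj: "\<exists>x. F x = t" for t
  proof -
    define u where "u = \<bar>t\<bar> * K"
    have u: "u \<ge> 0" using K by (simp add: u_def)
    have "F (x0 + u) \<ge> \<bar>t\<bar>" "F (x0 - u) \<le> - \<bar>t\<bar>"
      using grow[of x0 "x0 + u"] grow[of "x0 - u" x0] u K F0 by (simp_all add: u_def)
    then have "F (x0 - u) \<le> t" "t \<le> F (x0 + u)" by linarith+
    then show ?thesis using IVT[of F "x0 - u" t "x0 + u"] isC u by auto
  qed
  obtain \<theta> where F\<theta>: "\<And>t. F (\<theta> t) = t" using surj by metis
  have \<theta>F: "\<theta> (F x) = x" for x using F\<theta>[of "F x"] inj by blast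
  have cont\<theta>: "isCont \<theta> t" for t
    using isCont_inverse_function2[of "\<theta> t - 1" "\<theta> t" "\<theta> t + 1" \<theta> F] \<theta>F isC F\<theta> by simp
  have d\<theta>: "(\<theta> has_real_derivative f (\<theta> t)) (at t)" for t
  proof -
    have "1 / f (\<theta> t) \<noteq> 0" using pos[of "\<theta> t"] by simp
    then have "(\<theta> has_real_derivative inverse (1 / f (\<theta> t))) (at t)"
      using DERIV_inverse_function[of F "1 / f (\<theta> t)" \<theta> t "t - 1" "t + 1"] dF F\<theta> cont\<theta> by simp
    then show ?thesis by simp
  qed
  show ?thesis
  proof (rule that[OF _ d\<theta>])
    show "\<theta> 0 = x0" using \<theta>F[of x0] F0 by simp
    show "\<exists>t\<ge>0. \<theta> t = x" if "x \<ge> x0" for x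
      using \<theta>F[of x] mono'[of x0 x] F0 that by metis
    show "\<exists>t\<le>0. \<theta> t = x" if "x \<le> x0" for x
      using \<theta>F[of x] mono'[of x x0] F0 that by metis
  qed
qed

text \<open>The normalized equations, obtained from the slice coordinates by \<open>w\<^sub>i = \<surd>d\<^sub>i v\<^sub>i\<close>.\<close>

definition euler_top_solution :: "real \<Rightarrow> (real \<Rightarrow> real) \<Rightarrow> (real \<Rightarrow> real) \<Rightarrow> (real \<Rightarrow> real) \<Rightarrow> bool" where
  "euler_top_solution \<kappa> v1 v2 v3 \<longleftrightarrow> (\<forall>t.
     (v1 has_real_derivative - \<kappa> * (v2 t * v3 t)) (at t) \<and>
     (v2 has_real_derivative \<kappa> * (v1 t * v3 t)) (at t) \<and>
     (v3 has_real_derivative - \<kappa> * (v1 t * v2 t)) (at t))"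

text \<open>The energies \<open>v\<^sub>1\<^sup>2 + v\<^sub>2\<^sup>2 = A\<close> and \<open>v\<^sub>3\<^sup>2 + v\<^sub>2\<^sup>2 = B\<close> suggest \<open>(v\<^sub>3, v\<^sub>2) = \<surd>B (cos \<psi>, sin \<psi>)\<close>, which reduces
the system to the scalar equation of a rotating pendulum for \<open>\<psi>\<close>.\<close>

lemma euler_top_rotation:
  assumes AB: "A > B" "B > 0" and \<kappa>: "\<kappa> \<noteq> 0" and \<sigma>: "\<sigma> = 1 \<or> \<sigma> = -1"
  obtains v1 v2 v3 where "euler_top_solution \<kappa> v1 v2 v3"
    "\<And>t. (v1 t)\<^sup>2 + (v2 t)\<^sup>2 = A" "\<And>t. (v3 t)\<^sup>2 + (v2 t)\<^sup>2 = B"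
    "v2 0 = \<sigma> * sqrt B" "\<exists>t\<ge>0. v2 t = 0"
proof -
  define f where "f x = sqrt (A - B * (sin x)\<^sup>2)" for x
  have below: "B * (sin x)\<^sup>2 \<le> B" for x
    using mult_left_mono[of "(sin x)\<^sup>2" 1 B] AB by (simp add: abs_square_le_1)
  have lt: "B * (sin x)\<^sup>2 < A" for x using below[of x] AB by linarith
  have pos: "f x > 0" for x using lt[of x] by (simp add: f_def)
  have fsq: "(f x)\<^sup>2 = A - B * (sin x)\<^sup>2" for x
    using lt[of x] by (simp add: f_def)
  have "continuous_on UNIV f" unfolding f_def by (intro continuous_intros)
  moreover have "f x \<le> sqrt A" for x unfolding f_def using AB by simp
  ultimately obtain \<theta> where \<theta>0: "\<theta> 0 = \<sigma> * (pi / 2)"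
    and d\<theta>: "\<And>t. (\<theta> has_real_derivative f (\<theta> t)) (at t)"
    and up: "\<And>x. x \<ge> \<sigma> * (pi / 2) \<Longrightarrow> \<exists>t\<ge>0. \<theta> t = x"
    and down: "\<And>x. x \<le> \<sigma> * (pi / 2) \<Longrightarrow> \<exists>t\<le>0. \<theta> t = x"
    using autonomous_solution[of f "sqrt A" "\<sigma> * (pi / 2)"] pos by metis
  define \<psi> where "\<psi> t = \<theta> (\<kappa> * t)" for t
  have d\<psi>: "(\<psi> has_real_derivative \<kappa> * f (\<psi> t)) (at t)" for t
    unfolding \<psi>_def
    by (rule DERIV_cong[OF DERIV_chain2[OF d\<theta>]], rule DERIV_cmult_Id) (simp add: mult.commute)
  define v1 v2 v3 where "v1 t = f (\<psi> t)" and "v2 t = sqrt B * sin (\<psi> t)" and "v3 t = sqrt B * cos (\<psi> t)" for t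
  have d2: "(v2 has_real_derivative \<kappa> * (v1 t * v3 t)) (at t)" for t
    unfolding v2_def v1_def v3_def by (auto intro!: derivative_eq_intros d\<psi>)
  have d3: "(v3 has_real_derivative - \<kappa> * (v1 t * v2 t)) (at t)" for t
    unfolding v2_def v1_def v3_def by (auto intro!: derivative_eq_intros d\<psi>)
  have v1: "v1 t = sqrt (A - (v2 t)\<^sup>2)" for t
    using AB by (simp add: v1_def v2_def f_def power_mult_distrib)
  have v1pos: "v1 t > 0" for t by (simp add: v1_def pos)
  have d1: "(v1 has_real_derivative - \<kappa> * (v2 t * v3 t)) (at t)" for t
  proof -
    have "A - (v2 t)\<^sup>2 > 0" using v1[of t] v1pos[of t] by simp
    then have "((\<lambda>t. sqrt (A - (v2 t)\<^sup>2)) has_real_derivative - \<kappa> * (v2 t * v3 t)) (at t)"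
      using v1[of t] v1pos[of t]
      by (auto intro!: derivative_eq_intros d2 simp: field_simps)
    then show ?thesis by (simp add: v1[abs_def, symmetric])
  qed
  have "\<exists>t\<ge>0. v2 t = 0"
  proof (cases "\<kappa> > 0")
    case True
    obtain s where "s \<ge> 0" "\<theta> s = pi" using up[of pi] \<sigma> by auto
    then show ?thesis using True by (intro exI[of _ "s / \<kappa>"]) (simp add: v2_def \<psi>_def)
  next
    case False
    obtain s where "s \<le> 0" "\<theta> s = - pi" using down[of "- pi"] \<sigma> by auto
    then show ?thesis using False \<kappa>
      by (intro exI[of _ "s / \<kappa>"]) (simp add: v2_def \<psi>_def divide_nonpos_nonpos)
  qed
  moreover have "v2 0 = \<sigma> * sqrt B" using \<sigma> by (auto simp: v2_def \<psi>_def \<theta>0)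
  moreover have "(v1 t)\<^sup>2 + (v2 t)\<^sup>2 = A" for t
    using AB by (simp add: v1_def v2_def fsq power_mult_distrib)
  moreover have "(v3 t)\<^sup>2 + (v2 t)\<^sup>2 = B" for t
    using AB by (simp add: v3_def v2_def power_mult_distrib distrib_left[symmetric])
  moreover have "euler_top_solution \<kappa> v1 v2 v3"
    using d1 d2 d3 by (simp add: euler_top_solution_def)
  ultimately show ?thesis using that by blast
qed

text \<open>For equal energies the pendulum solution becomes \<open>v\<^sub>2 = \<plusminus> r tanh s\<close>, \<open>v\<^sub>1, v\<^sub>3 = \<plusminus> r / cosh s\<close>. Starting it at a
sufficiently large negative time puts \<open>v2 0\<close> as close to \<open>\<sigma> * r\<close> as desired.\<close>

lemma euler_top_separatrix:
  assumes r: "r > 0" and \<kappa>: "\<kappa> \<noteq> 0" and \<sigma>: "\<sigma> = 1 \<or> \<sigma> = -1" and \<eta>: "\<eta> > 0"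
  obtains v1 v2 v3 where "euler_top_solution \<kappa> v1 v2 v3"
    "\<And>t. (v1 t)\<^sup>2 + (v2 t)\<^sup>2 = r\<^sup>2" "\<And>t. (v3 t)\<^sup>2 + (v2 t)\<^sup>2 = r\<^sup>2"
    "\<bar>v2 0 - \<sigma> * r\<bar> < \<eta>" "\<exists>t\<ge>0. v2 t = 0"
proof -
  have "\<forall>\<^sub>F x::real in at_top. dist (tanh x) 1 < \<eta> / r"
    using tanh_real_at_top by (rule tendstoD) (use r \<eta> in simp)
  then have "\<forall>\<^sub>F x::real in at_top. x > 0 \<and> dist (tanh x) 1 < \<eta> / r"
    using eventually_gt_at_top[of 0] by (rule eventually_elim2) simp
  then obtain x :: real where x: "x > 0" "dist (tanh x) 1 < \<eta> / r"
    by (auto simp: eventually_at_top_linorder)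
  \<comment> \<open>the sign that sends \<open>v2\<close> to \<open>\<sigma> * r\<close> in the past\<close>
  define \<tau> where "\<tau> = - \<sigma> * sgn \<kappa>"
  have \<tau>: "\<tau> * \<tau> = 1" using \<sigma> \<kappa> by (auto simp: \<tau>_def sgn_if)
  define T where "T = x / (\<bar>\<kappa>\<bar> * r)"
  have T: "T > 0" using x r \<kappa> by (simp add: T_def)
  define s where "s t = \<kappa> * r * (t - T)" for t
  have ds: "(s has_real_derivative \<kappa> * r) (at t)" for t
    unfolding s_def by (auto intro!: derivative_eq_intros)
  define v1 v2 v3 where "v1 t = r / cosh (s t)" and "v2 t = \<tau> * r * tanh (s t)" and "v3 t = \<tau> * (r / cosh (s t))" for t
  have ch: "cosh (s t) \<noteq> 0" for t using cosh_real_pos[of "s t"] by simp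
  have sech: "1 - (tanh y)\<^sup>2 = 1 / (cosh y)\<^sup>2" for y :: real
  proof -
    have "1 - (tanh y)\<^sup>2 = ((cosh y)\<^sup>2 - (sinh y)\<^sup>2) / (cosh y)\<^sup>2"
      using cosh_real_pos[of y] by (simp add: tanh_def power_divide diff_divide_distrib)
    then show ?thesis by (simp add: cosh_square_eq)
  qed
  have d1: "(v1 has_real_derivative - \<kappa> * (v2 t * v3 t)) (at t)" for t
    unfolding v1_def v2_def v3_def using ch[of t] \<tau>
    by (auto intro!: derivative_eq_intros ds simp: tanh_def power2_eq_square field_simps)
  have d3: "(v3 has_real_derivative - \<kappa> * (v1 t * v2 t)) (at t)" for t
    unfolding v1_def v2_def v3_def using ch[of t] \<tau>
    by (auto intro!: derivative_eq_intros ds simp: tanh_def power2_eq_square field_simps)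
  have d2: "(v2 has_real_derivative \<kappa> * (v1 t * v3 t)) (at t)" for t
  proof -
    have "v1 t * v3 t = \<tau> * r * r * (1 - (tanh (s t))\<^sup>2)"
      unfolding sech by (simp add: v1_def v3_def power2_eq_square)
    moreover have "(v2 has_real_derivative \<tau> * r * ((1 - (tanh (s t))\<^sup>2) * (\<kappa> * r))) (at t)"
      unfolding v2_def using ch[of t] by (auto intro!: derivative_eq_intros ds)
    ultimately show ?thesis by (simp add: ac_simps)
  qed
  have E: "(v1 t)\<^sup>2 + (v2 t)\<^sup>2 = r\<^sup>2" "(v3 t)\<^sup>2 + (v2 t)\<^sup>2 = r\<^sup>2" for t
  proof -
    have "(v1 t)\<^sup>2 = r\<^sup>2 * (1 - (tanh (s t))\<^sup>2)" "(v2 t)\<^sup>2 = r\<^sup>2 * (tanh (s t))\<^sup>2"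
      "(v3 t)\<^sup>2 = r\<^sup>2 * (1 - (tanh (s t))\<^sup>2)"
      using \<tau> unfolding sech by (simp_all add: v1_def v2_def v3_def power_mult_distrib power_divide power2_eq_square)
    then show "(v1 t)\<^sup>2 + (v2 t)\<^sup>2 = r\<^sup>2" "(v3 t)\<^sup>2 + (v2 t)\<^sup>2 = r\<^sup>2" by (simp_all add: algebra_simps)
  qed
  have "s 0 = - sgn \<kappa> * x"
    using r \<kappa> by (simp add: s_def T_def sgn_if)
  then have "v2 0 = \<sigma> * r * tanh x"
    using \<kappa> by (auto simp: v2_def \<tau>_def sgn_if)
  then have "v2 0 - \<sigma> * r = \<sigma> * r * (tanh x - 1)" by (simp add: algebra_simps)
  then have "\<bar>v2 0 - \<sigma> * r\<bar> = r * dist (tanh x) 1"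
    using \<sigma> r by (auto simp: dist_real_def abs_mult)
  then have "\<bar>v2 0 - \<sigma> * r\<bar> < \<eta>" using x(2) r by (simp add: field_simps)
  moreover have "\<exists>t\<ge>0. v2 t = 0" using T by (intro exI[of _ T]) (simp add: v2_def s_def)
  moreover have "euler_top_solution \<kappa> v1 v2 v3"
    using d1 d2 d3 by (simp add: euler_top_solution_def)
  ultimately show ?thesis using that E by blast
qed

text \<open>The three regimes in one statement: whatever the energies, some solution starts near an end of the range of \<open>v\<^sub>2\<close> and later
reaches \<open>v\<^sub>2 = 0\<close>.\<close>

lemma euler_top_transit:
  assumes AB: "A > 0" "B > 0" and \<kappa>: "\<kappa> \<noteq> 0" and \<sigma>: "\<sigma> = 1 \<or> \<sigma> = -1" and \<eta>: "\<eta> > 0"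
  shows "\<exists>v1 v2 v3. euler_top_solution \<kappa> v1 v2 v3 \<and>
    (\<forall>t. (v1 t)\<^sup>2 + (v2 t)\<^sup>2 = A) \<and> (\<forall>t. (v3 t)\<^sup>2 + (v2 t)\<^sup>2 = B) \<and>
    \<bar>v2 0 - \<sigma> * sqrt (min A B)\<bar> < \<eta> \<and> (\<exists>t\<ge>0. v2 t = 0)"
proof -
  consider "A > B" | "B > A" | "A = B" by linarith
  then show ?thesis
  proof cases
    case 1
    obtain v1 v2 v3 where "euler_top_solution \<kappa> v1 v2 v3"
      "\<And>t. (v1 t)\<^sup>2 + (v2 t)\<^sup>2 = A" "\<And>t. (v3 t)\<^sup>2 + (v2 t)\<^sup>2 = B"
      "v2 0 = \<sigma> * sqrt B" "\<exists>t\<ge>0. v2 t = 0"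
      using euler_top_rotation[OF 1 AB(2) \<kappa> \<sigma>] by blast
    then show ?thesis using 1 \<eta> by (intro exI[of _ v1] exI[of _ v2] exI[of _ v3]) simp
  next
    case 2
    obtain v3 v2 v1 where "euler_top_solution \<kappa> v3 v2 v1"
      "\<And>t. (v3 t)\<^sup>2 + (v2 t)\<^sup>2 = B" "\<And>t. (v1 t)\<^sup>2 + (v2 t)\<^sup>2 = A"
      "v2 0 = \<sigma> * sqrt A" "\<exists>t\<ge>0. v2 t = 0"
      using euler_top_rotation[OF 2 AB(1) \<kappa> \<sigma>] by blast
    moreover from this have "euler_top_solution \<kappa> v1 v2 v3"
      by (simp add: euler_top_solution_def mult.commute)
    ultimately show ?thesis using 2 \<eta> by (intro exI[of _ v1] exI[of _ v2] exI[of _ v3]) simp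
  next
    case 3
    have "sqrt A > 0" "(sqrt A)\<^sup>2 = A" using AB by simp_all
    then show ?thesis
      using euler_top_separatrix[of "sqrt A" \<kappa> \<sigma> \<eta>] \<kappa> \<sigma> \<eta> 3 by (metis min.idem)
  qed
qed


section \<open>Instability\<close>

text \<open>On an outer slice both Casimirs are combinations of the two energies of the top. For \<open>C1\<close> this uses the identity
\<open>bal\<close>, which says that the weights of \<open>v\<^sub>2\<^sup>2\<close> match.\<close>

lemma slice_point_in_Orb_iff:
  assumes top: "slice_weights l \<mu> \<epsilon> 1 e1 e2 e3 e4"
    and d: "gap_coeff l 1 \<ge> 0" "gap_coeff l 2 \<ge> 0" "gap_coeff l 3 \<ge> 0"
    and v: "v1\<^sup>2 + v2\<^sup>2 = A" "v3\<^sup>2 + v2\<^sup>2 = B"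
  shows "slice_point 1 e1 e2 e3 e4 (sqrt (gap_coeff l 1) * v1) (sqrt (gap_coeff l 2) * v2) (sqrt (gap_coeff l 3) * v3)
      \<in> Orb c1 c2 \<longleftrightarrow>
    (e2\<^sup>2 * e3\<^sup>2 + e1\<^sup>2 * e4\<^sup>2) * (gap_coeff l 1 * A) + (e1\<^sup>2 * e2\<^sup>2 + e3\<^sup>2 * e4\<^sup>2) * (gap_coeff l 3 * B) = 2 * c1
    \<and> e1 * e2 * e3 * e4 * (gap_coeff l 1 * A + gap_coeff l 3 * B) = c2"
proof -
  define d1 d2 d3 where dd: "d1 = gap_coeff l 1" "d2 = gap_coeff l 2" "d3 = gap_coeff l 3"
  have sum: "d2 = d1 + d3" unfolding dd by (rule gap_coeff_sum)
  have e: "e1\<^sup>2 = \<epsilon> * ((l$1)\<^sup>2 - \<mu>)" "e2\<^sup>2 = \<epsilon> * ((l$2)\<^sup>2 - \<mu>)"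
     "e3\<^sup>2 = \<epsilon> * ((l$3)\<^sup>2 - \<mu>)" "e4\<^sup>2 = \<epsilon> * ((l$4)\<^sup>2 - \<mu>)" and \<epsilon>: "\<epsilon>\<^sup>2 = 1"
    using top by (auto simp: slice_weights_def)
  have bal: "(e1\<^sup>2 * e3\<^sup>2 + e2\<^sup>2 * e4\<^sup>2) * d2
     = (e2\<^sup>2 * e3\<^sup>2 + e1\<^sup>2 * e4\<^sup>2) * d1 + (e1\<^sup>2 * e2\<^sup>2 + e3\<^sup>2 * e4\<^sup>2) * d3"
    unfolding e dd gap_coeff_def by simp algebra
  have sq: "(sqrt d1 * x)\<^sup>2 = d1 * x\<^sup>2" "(sqrt d2 * x)\<^sup>2 = d2 * x\<^sup>2" "(sqrt d3 * x)\<^sup>2 = d3 * x\<^sup>2" for x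
    using d by (simp_all add: dd power_mult_distrib)
  define w1 w2 w3 where w: "w1 = sqrt d1 * v1" "w2 = sqrt d2 * v2" "w3 = sqrt d3 * v3"
  have "(e2*e3*w1)\<^sup>2 + (e1*e3*w2)\<^sup>2 + (e1*e2*w3)\<^sup>2 + (e1*e4*w1)\<^sup>2 + (e2*e4*w2)\<^sup>2 + (e3*e4*w3)\<^sup>2
     = (e2\<^sup>2 * e3\<^sup>2 + e1\<^sup>2 * e4\<^sup>2) * w1\<^sup>2 + (e1\<^sup>2 * e3\<^sup>2 + e2\<^sup>2 * e4\<^sup>2) * w2\<^sup>2 + (e1\<^sup>2 * e2\<^sup>2 + e3\<^sup>2 * e4\<^sup>2) * w3\<^sup>2"
    by (simp add: power_mult_distrib algebra_simps)
  also have "\<dots> = (e2\<^sup>2 * e3\<^sup>2 + e1\<^sup>2 * e4\<^sup>2) * (d1 * A) + (e1\<^sup>2 * e2\<^sup>2 + e3\<^sup>2 * e4\<^sup>2) * (d3 * B)"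
    unfolding w sq v[symmetric] using bal by algebra
  finally have c1: "(e2*e3*w1)\<^sup>2 + (e1*e3*w2)\<^sup>2 + (e1*e2*w3)\<^sup>2 + (e1*e4*w1)\<^sup>2 + (e2*e4*w2)\<^sup>2 + (e3*e4*w3)\<^sup>2
    = (e2\<^sup>2 * e3\<^sup>2 + e1\<^sup>2 * e4\<^sup>2) * (d1 * A) + (e1\<^sup>2 * e2\<^sup>2 + e3\<^sup>2 * e4\<^sup>2) * (d3 * B)" .
  have "e2*e3*w1 * (e1*e4*w1) + e1*e3*w2 * (e2*e4*w2) + e1*e2*w3 * (e3*e4*w3)
    = e1 * e2 * e3 * e4 * (w1\<^sup>2 + w2\<^sup>2 + w3\<^sup>2)"
    by (simp add: power2_eq_square algebra_simps)
  also have "\<dots> = e1 * e2 * e3 * e4 * (d1 * A + d3 * B)"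
    unfolding w sq v[symmetric] using sum by algebra
  finally have c2: "e2*e3*w1 * (e1*e4*w1) + e1*e3*w2 * (e2*e4*w2) + e1*e2*w3 * (e3*e4*w3)
    = e1 * e2 * e3 * e4 * (d1 * A + d3 * B)" .
  show ?thesis
    unfolding dd[symmetric] w[symmetric] slice_point_def so4_mat_in_Orb_iff mult_1 c1 c2 ..
qed

lemma slice_point_solution:
  assumes pos: "\<And>i j. i \<noteq> j \<Longrightarrow> l$i + l$j > 0"
    and top: "slice_weights l \<mu> \<epsilon> 1 e1 e2 e3 e4"
    and d: "gap_coeff l 1 \<ge> 0" "gap_coeff l 2 \<ge> 0" "gap_coeff l 3 \<ge> 0"
    and sol: "euler_top_solution
       (\<epsilon> * H_factor l \<mu> * (sqrt (gap_coeff l 1) * sqrt (gap_coeff l 2) * sqrt (gap_coeff l 3))) v1 v2 v3"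
    and orb: "\<And>t. slice_point 1 e1 e2 e3 e4 (sqrt (gap_coeff l 1) * v1 t) (sqrt (gap_coeff l 2) * v2 t)
      (sqrt (gap_coeff l 3) * v3 t) \<in> Orb c1 c2"
  shows "solution_on (rigid_body l) (Orb c1 c2) (\<lambda>t. slice_point 1 e1 e2 e3 e4
      (sqrt (gap_coeff l 1) * v1 t) (sqrt (gap_coeff l 2) * v2 t) (sqrt (gap_coeff l 3) * v3 t))"
proof -
  define r1 r2 r3 where r: "r1 = sqrt (gap_coeff l 1)" "r2 = sqrt (gap_coeff l 2)" "r3 = sqrt (gap_coeff l 3)"
  have rsq: "gap_coeff l 1 = r1 * r1" "gap_coeff l 2 = r2 * r2" "gap_coeff l 3 = r3 * r3"
    using d by (simp_all add: r)
  define g where "g = \<epsilon> * H_factor l \<mu>"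
  let ?\<gamma> = "\<lambda>t. slice_point 1 e1 e2 e3 e4 (r1 * v1 t) (r2 * v2 t) (r3 * v3 t)"
  have "(?\<gamma> has_vector_derivative rigid_body l (?\<gamma> t)) (at t)" for t
  proof -
    have v: "(v1 has_real_derivative - (g * (r1 * r2 * r3)) * (v2 t * v3 t)) (at t)"
      "(v2 has_real_derivative (g * (r1 * r2 * r3)) * (v1 t * v3 t)) (at t)"
      "(v3 has_real_derivative - (g * (r1 * r2 * r3)) * (v1 t * v2 t)) (at t)"
      using sol by (simp_all add: euler_top_solution_def r g_def)
    have m: "((\<lambda>t. c * (k * v t)) has_derivative (\<lambda>h. h * (c * (k * v')))) (at t)"
      if "(v has_real_derivative v') (at t)" for v v' c k
      using that unfolding has_field_derivative_def
      by (auto intro!: derivative_eq_intros simp: fun_eq_iff)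
    have "(?\<gamma> has_derivative (\<lambda>h. h *\<^sub>R slice_point 1 e1 e2 e3 e4
        (r1 * (- (g * (r1 * r2 * r3)) * (v2 t * v3 t))) (r2 * (g * (r1 * r2 * r3) * (v1 t * v3 t)))
        (r3 * (- (g * (r1 * r2 * r3)) * (v1 t * v2 t))))) (at t)"
      unfolding slice_point_def so4_mat_scaleR by (intro has_derivative_so4_mat m v)
    moreover have "?\<gamma> t \<in> so4" by (simp add: slice_point_def so4_mat_in_so4)
    then have "rigid_body l (?\<gamma> t) = slice_point 1 e1 e2 e3 e4
        (r1 * (- (g * (r1 * r2 * r3)) * (v2 t * v3 t))) (r2 * (g * (r1 * r2 * r3) * (v1 t * v3 t)))
        (r3 * (- (g * (r1 * r2 * r3)) * (v1 t * v2 t)))"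
      using rigid_body_eq_quad_vf[OF pos, of "?\<gamma> t"]
        quad_vf_slice_point[OF top euler_top_factor_H[OF pos], of "r1 * v1 t" "r2 * v2 t" "r3 * v3 t"]
      by (simp add: rsq g_def ac_simps)
    ultimately show ?thesis by (simp add: has_vector_derivative_def)
  qed
  then show ?thesis
    using orb unfolding solution_on_def r by (auto intro: has_vector_derivative_at_within)
qed

lemma not_lyapunov_stable_mono:
  assumes "\<not> lyapunov_stable X S p" "S \<subseteq> S'"
  shows "\<not> lyapunov_stable X S' p"
  using assms unfolding lyapunov_stable_def solution_on_def by (meson subsetD)

lemma dist_mat4_ge: "\<bar>M$i$j - N$i$j\<bar> \<le> dist M (N :: mat4)"
  using dist_vec_nth_le[of "M$i" j "N$i"] dist_vec_nth_le[of M i N] by (simp add: dist_real_def)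

text \<open>A criterion that treats a fixed slice and a sequence of slices alike. In the limit both energies equal
\<open>r\<^sup>2\<close>, so starting with \<open>v\<^sub>2\<close> near \<open>\<plusminus> r\<close> forces \<open>v\<^sub>1\<close> and \<open>v\<^sub>3\<close> to be small, and the initial points converge to \<open>M2 p q\<close>.
When \<open>v\<^sub>2\<close> vanishes, so do the coordinates \<open>x\<^sub>2\<close> and \<open>y\<^sub>2\<close>, and the solution is at distance at
least \<open>max \<bar>p\<bar> \<bar>q\<bar>\<close>.\<close>

lemma unstable_if_approached_by_euler_tops:
  fixes e1 e2 e3 e4 A B \<mu> :: "nat \<Rightarrow> real"
  assumes pos: "\<And>i j. i \<noteq> j \<Longrightarrow> l$i + l$j > 0"
    and d: "gap_coeff l 1 > 0" "gap_coeff l 2 > 0" "gap_coeff l 3 > 0"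
    and lim: "e1 \<longlonglongrightarrow> E1" "e2 \<longlonglongrightarrow> E2" "e3 \<longlonglongrightarrow> E3" "e4 \<longlonglongrightarrow> E4" "A \<longlonglongrightarrow> r\<^sup>2" "B \<longlonglongrightarrow> r\<^sup>2"
    and r: "r > 0" and \<sigma>: "\<sigma> = 1 \<or> \<sigma> = -1" and \<epsilon>: "\<epsilon> \<noteq> 0"
    and p: "p = \<sigma> * r * sqrt (gap_coeff l 2) * (E1 * E3)"
    and q: "q = \<sigma> * r * sqrt (gap_coeff l 2) * (E2 * E4)" and pq: "p \<noteq> 0 \<or> q \<noteq> 0"
    and ev: "\<forall>\<^sub>F n in sequentially. slice_weights l (\<mu> n) \<epsilon> 1 (e1 n) (e2 n) (e3 n) (e4 n)
       \<and> H_factor l (\<mu> n) \<noteq> 0 \<and> A n > 0 \<and> B n > 0 \<and>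
       ((e2 n)\<^sup>2 * (e3 n)\<^sup>2 + (e1 n)\<^sup>2 * (e4 n)\<^sup>2) * (gap_coeff l 1 * A n)
       + ((e1 n)\<^sup>2 * (e2 n)\<^sup>2 + (e3 n)\<^sup>2 * (e4 n)\<^sup>2) * (gap_coeff l 3 * B n) = 2 * c1 \<and>
       e1 n * e2 n * e3 n * e4 n * (gap_coeff l 1 * A n + gap_coeff l 3 * B n) = c2"
      (is "eventually ?good _")
  shows "\<not> lyapunov_stable (rigid_body l) (Orb c1 c2) (M2 p q)"
proof
  assume stable: "lyapunov_stable (rigid_body l) (Orb c1 c2) (M2 p q)"
  define \<kappa> where "\<kappa> n = \<epsilon> * H_factor l (\<mu> n) * (sqrt (gap_coeff l 1) * sqrt (gap_coeff l 2) * sqrt (gap_coeff l 3))" for n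
  have "\<exists>v1 v2 v3. ?good n \<longrightarrow> euler_top_solution (\<kappa> n) v1 v2 v3 \<and>
    (\<forall>t. (v1 t)\<^sup>2 + (v2 t)\<^sup>2 = A n) \<and> (\<forall>t. (v3 t)\<^sup>2 + (v2 t)\<^sup>2 = B n) \<and>
    \<bar>v2 0 - \<sigma> * sqrt (min (A n) (B n))\<bar> < 1 / (real n + 1) \<and> (\<exists>t\<ge>0. v2 t = 0)" for n
  proof (cases "?good n")
    case True
    then have "\<kappa> n \<noteq> 0" "A n > 0" "B n > 0" using \<epsilon> d by (auto simp: \<kappa>_def)
    then show ?thesis
      using euler_top_transit[of "A n" "B n" "\<kappa> n" \<sigma> "1 / (real n + 1)"] \<sigma> by auto
  qed auto
  then obtain v1 v2 v3 where v: "\<And>n. ?good n \<Longrightarrow> euler_top_solution (\<kappa> n) (v1 n) (v2 n) (v3 n) \<and>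
    (\<forall>t. (v1 n t)\<^sup>2 + (v2 n t)\<^sup>2 = A n) \<and> (\<forall>t. (v3 n t)\<^sup>2 + (v2 n t)\<^sup>2 = B n) \<and>
    \<bar>v2 n 0 - \<sigma> * sqrt (min (A n) (B n))\<bar> < 1 / (real n + 1) \<and> (\<exists>t\<ge>0. v2 n t = 0)"
    by metis
  define \<gamma> where "\<gamma> n t = slice_point 1 (e1 n) (e2 n) (e3 n) (e4 n) (sqrt (gap_coeff l 1) * v1 n t)
     (sqrt (gap_coeff l 2) * v2 n t) (sqrt (gap_coeff l 3) * v3 n t)" for n t
  have sol: "solution_on (rigid_body l) (Orb c1 c2) (\<gamma> n)" if "?good n" for n
    unfolding \<gamma>_def
  proof (rule slice_point_solution[OF pos])
    show "slice_weights l (\<mu> n) \<epsilon> 1 (e1 n) (e2 n) (e3 n) (e4 n)" using that by blast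
    show "euler_top_solution (\<epsilon> * H_factor l (\<mu> n) * (sqrt (gap_coeff l 1) * sqrt (gap_coeff l 2)
        * sqrt (gap_coeff l 3))) (v1 n) (v2 n) (v3 n)"
      using v[OF that] by (simp add: \<kappa>_def)
    fix t
    have "(v1 n t)\<^sup>2 + (v2 n t)\<^sup>2 = A n" "(v3 n t)\<^sup>2 + (v2 n t)\<^sup>2 = B n" using v[OF that] by blast+
    then show "slice_point 1 (e1 n) (e2 n) (e3 n) (e4 n) (sqrt (gap_coeff l 1) * v1 n t)
       (sqrt (gap_coeff l 2) * v2 n t) (sqrt (gap_coeff l 3) * v3 n t) \<in> Orb c1 c2"
      using slice_point_in_Orb_iff[of l "\<mu> n" \<epsilon>] that d by auto
  qed (use d in auto)
  have lim2: "(\<lambda>n. v2 n 0) \<longlonglongrightarrow> \<sigma> * r"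
  proof -
    have m: "(\<lambda>n. \<sigma> * sqrt (min (A n) (B n))) \<longlonglongrightarrow> \<sigma> * sqrt (min (r\<^sup>2) (r\<^sup>2))"
      by (intro tendsto_intros lim)
    have "(\<lambda>n. v2 n 0 - \<sigma> * sqrt (min (A n) (B n))) \<longlonglongrightarrow> 0"
    proof (rule Lim_null_comparison)
      show "\<forall>\<^sub>F n in sequentially. norm (v2 n 0 - \<sigma> * sqrt (min (A n) (B n))) \<le> 1 / (real n + 1)"
        using ev by (rule eventually_mono) (use v in \<open>force simp: less_imp_le\<close>)
      show "(\<lambda>n. 1 / (real n + 1)) \<longlonglongrightarrow> 0"
        using LIMSEQ_inverse_real_of_nat by (simp add: inverse_eq_divide add.commute)
    qed
    from tendsto_add[OF this m] show ?thesis using r by simp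
  qed
  have lim13: "(\<lambda>n. v1 n 0) \<longlonglongrightarrow> 0" "(\<lambda>n. v3 n 0) \<longlonglongrightarrow> 0"
  proof -
    have s: "(\<sigma> * r)\<^sup>2 = r\<^sup>2" using \<sigma> by auto
    have "(\<lambda>n. A n - (v2 n 0)\<^sup>2) \<longlonglongrightarrow> r\<^sup>2 - (\<sigma> * r)\<^sup>2" "(\<lambda>n. B n - (v2 n 0)\<^sup>2) \<longlonglongrightarrow> r\<^sup>2 - (\<sigma> * r)\<^sup>2"
      by (intro tendsto_intros lim lim2)+
    moreover have "\<forall>\<^sub>F n in sequentially. A n - (v2 n 0)\<^sup>2 = (v1 n 0)\<^sup>2"
      using ev by (rule eventually_mono) (use v in \<open>metis add_diff_cancel_right'\<close>)
    moreover have "\<forall>\<^sub>F n in sequentially. B n - (v2 n 0)\<^sup>2 = (v3 n 0)\<^sup>2"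
      using ev by (rule eventually_mono) (use v in \<open>metis add_diff_cancel_right'\<close>)
    ultimately have "(\<lambda>n. (v1 n 0)\<^sup>2) \<longlonglongrightarrow> 0" "(\<lambda>n. (v3 n 0)\<^sup>2) \<longlonglongrightarrow> 0"
      unfolding s by (auto dest: Lim_transform_eventually)
    from this[THEN tendsto_real_sqrt]
    show "(\<lambda>n. v1 n 0) \<longlonglongrightarrow> 0" "(\<lambda>n. v3 n 0) \<longlonglongrightarrow> 0"
      by (simp_all add: tendsto_rabs_zero_iff)
  qed
  have start: "(\<lambda>n. \<gamma> n 0) \<longlonglongrightarrow> M2 p q"
  proof -
    have "(\<lambda>n. \<gamma> n 0) \<longlonglongrightarrow> slice_point 1 E1 E2 E3 E4 (sqrt (gap_coeff l 1) * 0)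
      (sqrt (gap_coeff l 2) * (\<sigma> * r)) (sqrt (gap_coeff l 3) * 0)"
      unfolding \<gamma>_def slice_point_def
      by (intro tendsto_so4_mat tendsto_mult tendsto_const lim lim2 lim13)
    then show ?thesis by (simp add: slice_point_def M2_def p q ac_simps)
  qed
  define \<eta> where "\<eta> = max \<bar>p\<bar> \<bar>q\<bar>"
  have "\<eta> > 0" using pq by (auto simp: \<eta>_def)
  then obtain \<delta> where \<delta>: "\<delta> > 0" "\<And>\<gamma> t. solution_on (rigid_body l) (Orb c1 c2) \<gamma> \<Longrightarrow>
      dist (\<gamma> 0) (M2 p q) < \<delta> \<Longrightarrow> t \<ge> 0 \<Longrightarrow> dist (\<gamma> t) (M2 p q) < \<eta>"
    using stable unfolding lyapunov_stable_def by meson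
  have "\<forall>\<^sub>F n in sequentially. ?good n \<and> dist (\<gamma> n 0) (M2 p q) < \<delta>"
    using ev tendstoD[OF start \<delta>(1)] by (rule eventually_conj)
  then obtain n where n: "?good n" "dist (\<gamma> n 0) (M2 p q) < \<delta>"
    by (auto simp: eventually_sequentially)
  obtain t where t: "t \<ge> 0" "v2 n t = 0" using v[OF n(1)] by blast
  have "\<bar>p\<bar> \<le> dist (\<gamma> n t) (M2 p q)" "\<bar>q\<bar> \<le> dist (\<gamma> n t) (M2 p q)"
    using dist_mat4_ge[of "\<gamma> n t" 1 3 "M2 p q"] dist_mat4_ge[of "\<gamma> n t" 2 4 "M2 p q"] t(2)
    by (simp_all add: \<gamma>_def slice_point_def M2_def)
  then have "\<eta> \<le> dist (\<gamma> n t) (M2 p q)" by (simp add: \<eta>_def)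
  with \<delta>(2)[OF sol[OF n(1)] n(2) t(1)] show False by simp
qed

text \<open>The factor is affine in \<open>\<mu>\<close> with slope a positive multiple of the trace of \<open>J\<close>.\<close>

lemma H_factor_inj:
  assumes pos: "\<And>i j. i \<noteq> j \<Longrightarrow> l$i + l$j > 0"
  shows "H_factor l \<mu> = H_factor l \<nu> \<longleftrightarrow> \<mu> = \<nu>"
proof -
  have "l$1 + l$2 + l$3 + l$4 > 0" using pos[of 1 2] pos[of 3 4] by simp
  moreover have "(l$1 + l$2) * (l$1 + l$3) * (l$1 + l$4) * (l$2 + l$3) * (l$2 + l$4) * (l$3 + l$4) > 0"
    by (intro mult_pos_pos pos) simp_all
  moreover have "(a + \<mu> * S) / P = (a + \<nu> * S) / P \<longleftrightarrow> \<mu> = \<nu>" if "S > 0" "P > 0" for a S P :: real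
    using that by simp
  ultimately show ?thesis unfolding H_factor_def by blast
qed

text \<open>A single slice suffices: the energies \<open>A = B = r\<^sup>2\<close> are those of \<open>M2 p q\<close> itself, and the solutions are shifts in time of
the separatrix that leaves \<open>M2 p q\<close>.\<close>

lemma unstable_of_nonzero_rate:
  assumes pos: "\<And>i j. i \<noteq> j \<Longrightarrow> l$i + l$j > 0"
    and d: "gap_coeff l 1 > 0" "gap_coeff l 2 > 0" "gap_coeff l 3 > 0"
    and top: "slice_weights l \<mu> \<epsilon> 1 e1 e2 e3 e4" and p: "p = w * (e1 * e3)" and q: "q = w * (e2 * e4)"
    and pq: "p \<noteq> 0 \<or> q \<noteq> 0" and M: "M2 p q \<in> Orb c1 c2" and H: "H_factor l \<mu> \<noteq> 0"
  shows "\<not> lyapunov_stable (rigid_body l) (Orb c1 c2) (M2 p q)"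
proof -
  define r where "r = \<bar>w\<bar> / sqrt (gap_coeff l 2)"
  have w: "w \<noteq> 0" using pq p q by auto
  have r: "r > 0" using w d by (simp add: r_def)
  have sw: "w = sgn w * r * sqrt (gap_coeff l 2)" using d w by (simp add: r_def sgn_if)
  have sw': "sqrt (gap_coeff l 2) * (sgn w * r) = w"
    using d w by (simp add: r_def sgn_if)
  have s: "sgn w = 1 \<or> sgn w = -1" using w by (auto simp: sgn_if)
  have pt: "slice_point 1 e1 e2 e3 e4 (sqrt (gap_coeff l 1) * 0) (sqrt (gap_coeff l 2) * (sgn w * r))
      (sqrt (gap_coeff l 3) * 0) = M2 p q"
    unfolding slice_point_def M2_def so4_mat_eq_iff p q sw' by simp
  have v: "0\<^sup>2 + (sgn w * r)\<^sup>2 = r\<^sup>2" using s by auto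
  have orb: "(e2\<^sup>2 * e3\<^sup>2 + e1\<^sup>2 * e4\<^sup>2) * (gap_coeff l 1 * r\<^sup>2) + (e1\<^sup>2 * e2\<^sup>2 + e3\<^sup>2 * e4\<^sup>2) * (gap_coeff l 3 * r\<^sup>2) = 2 * c1
    \<and> e1 * e2 * e3 * e4 * (gap_coeff l 1 * r\<^sup>2 + gap_coeff l 3 * r\<^sup>2) = c2"
    using slice_point_in_Orb_iff[OF top _ _ _ v v, of c1 c2] d M unfolding pt by auto
  show ?thesis
  proof (rule unstable_if_approached_by_euler_tops[OF pos d tendsto_const tendsto_const tendsto_const
        tendsto_const tendsto_const tendsto_const r s, where \<epsilon> = \<epsilon> and \<mu> = "\<lambda>_. \<mu>"])
    show "\<epsilon> \<noteq> 0" using top by (auto simp: slice_weights_def)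
    show "p = sgn w * r * sqrt (gap_coeff l 2) * (e1 * e3)" "q = sgn w * r * sqrt (gap_coeff l 2) * (e2 * e4)"
      using p q sw by metis+
    show "p \<noteq> 0 \<or> q \<noteq> 0" by (rule pq)
  qed (use top H r orb in auto)
qed

text \<open>If the factor vanishes at \<open>\<mu>\<close>, it is nonzero at \<open>\<mu> - 1 / (n + 1)\<close> by injectivity. To stay on the given orbit, the
energies \<open>A\<close> and \<open>B\<close> are obtained from the two Casimir equations, a linear system whose determinant is controlled
by \<open>b3 - b1 = d2\<close>. At \<open>\<mu>\<close> itself the solution is \<open>A = B = r\<^sup>2\<close>, so for large \<open>n\<close> both are positive.\<close>

lemma unstable_of_zero_rate:
  assumes pos: "\<And>i j. i \<noteq> j \<Longrightarrow> l$i + l$j > 0"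
    and d: "gap_coeff l 1 > 0" "gap_coeff l 2 > 0" "gap_coeff l 3 > 0"
    and below: "\<And>i. \<mu> < (l$i)\<^sup>2" and t: "t\<^sup>2 = 1"
    and p: "p = w * (slice_weight l \<mu> 1 1 1 * slice_weight l \<mu> 1 1 3)"
    and q: "q = w * (slice_weight l \<mu> 1 1 2 * (t * slice_weight l \<mu> 1 1 4))"
    and pq: "p \<noteq> 0 \<or> q \<noteq> 0" and M: "M2 p q \<in> Orb c1 c2" and H: "H_factor l \<mu> = 0"
  shows "\<not> lyapunov_stable (rigid_body l) (Orb c1 c2) (M2 p q)"
proof -
  define m where "m n = \<mu> - 1 / (real n + 1)" for n
  have m: "m n < \<mu>" for n by (simp add: m_def)
  have mlim: "m \<longlonglongrightarrow> \<mu>"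
  proof -
    have "(\<lambda>n. 1 / (real n + 1)) \<longlonglongrightarrow> 0"
      using LIMSEQ_inverse_real_of_nat by (simp add: inverse_eq_divide add.commute)
    then have "m \<longlonglongrightarrow> \<mu> - 0" unfolding m_def by (intro tendsto_diff tendsto_const)
    then show ?thesis by simp
  qed
  define e where "e \<nu> i = (if i = 4 then t * slice_weight l \<nu> 1 1 i else slice_weight l \<nu> 1 1 i)" for \<nu> i
  have esq: "(e \<nu> i)\<^sup>2 = (l$i)\<^sup>2 - \<nu>" if "\<nu> \<le> \<mu>" for \<nu> i
    using below[of i] that t by (auto simp: e_def slice_weight_def power_mult_distrib)
  have elim: "(\<lambda>n. e (m n) i) \<longlonglongrightarrow> e \<mu> i" for i
    unfolding e_def slice_weight_def by (cases "i = 4") (auto intro!: tendsto_intros mlim)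
  have top: "slice_weights l \<nu> 1 1 (e \<nu> 1) (e \<nu> 2) (e \<nu> 3) (e \<nu> 4)" if "\<nu> \<le> \<mu>" for \<nu>
    using esq[OF that] by (simp add: slice_weights_def)
  define E where "E \<nu> = e \<nu> 1 * e \<nu> 2 * e \<nu> 3 * e \<nu> 4" for \<nu>
  define b1 where "b1 \<nu> = (e \<nu> 2)\<^sup>2 * (e \<nu> 3)\<^sup>2 + (e \<nu> 1)\<^sup>2 * (e \<nu> 4)\<^sup>2" for \<nu>
  define b3 where "b3 \<nu> = (e \<nu> 1)\<^sup>2 * (e \<nu> 2)\<^sup>2 + (e \<nu> 3)\<^sup>2 * (e \<nu> 4)\<^sup>2" for \<nu>
  define d1 d2 d3 where dd: "d1 = gap_coeff l 1" "d2 = gap_coeff l 2" "d3 = gap_coeff l 3"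
  have dsum: "d2 = d1 + d3" unfolding dd by (rule gap_coeff_sum)
  have dpos: "d1 > 0" "d2 > 0" "d3 > 0" using d by (simp_all add: dd)
  have E0: "E \<nu> \<noteq> 0" if "\<nu> \<le> \<mu>" for \<nu>
  proof -
    have "e \<nu> i \<noteq> 0" for i using esq[OF that, of i] below[of i] that by auto
    then show ?thesis by (simp add: E_def)
  qed
  have b: "b3 \<nu> - b1 \<nu> = d2" if "\<nu> \<le> \<mu>" for \<nu>
    unfolding b1_def b3_def esq[OF that] dd gap_coeff_def by simp algebra
  define A where "A \<nu> = (b3 \<nu> * (c2 / E \<nu>) - 2 * c1) / (d1 * d2)" for \<nu>
  define B where "B \<nu> = (2 * c1 - b1 \<nu> * (c2 / E \<nu>)) / (d3 * d2)" for \<nu>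
  have AB: "b1 \<nu> * (d1 * A \<nu>) + b3 \<nu> * (d3 * B \<nu>) = 2 * c1 \<and> E \<nu> * (d1 * A \<nu> + d3 * B \<nu>) = c2"
    if "\<nu> \<le> \<mu>" for \<nu>
  proof -
    define k where "k = c2 / E \<nu>"
    have k: "E \<nu> * k = c2" using E0[OF that] by (simp add: k_def)
    have "d1 * A \<nu> = (b3 \<nu> * k - 2 * c1) / d2" "d3 * B \<nu> = (2 * c1 - b1 \<nu> * k) / d2"
      using dpos by (simp_all add: A_def B_def k_def)
    then have AB': "d2 * (d1 * A \<nu>) = b3 \<nu> * k - 2 * c1" "d2 * (d3 * B \<nu>) = 2 * c1 - b1 \<nu> * k"
      using dpos by simp_all
    have "d2 * (b1 \<nu> * (d1 * A \<nu>) + b3 \<nu> * (d3 * B \<nu>)) = d2 * (2 * c1)"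
      "d2 * (E \<nu> * (d1 * A \<nu> + d3 * B \<nu>)) = d2 * c2"
      using AB' b[OF that] k by algebra+
    then show ?thesis using dpos by simp
  qed
  have p': "p = w * (e \<mu> 1 * e \<mu> 3)" and q': "q = w * (e \<mu> 2 * e \<mu> 4)"
    by (simp_all add: e_def p q)
  define r where "r = \<bar>w\<bar> / sqrt d2"
  have w: "w \<noteq> 0" using pq p q by auto
  have r: "r > 0" using w dpos by (simp add: r_def)
  have sw: "w = sgn w * r * sqrt d2" using dpos w by (simp add: r_def sgn_if)
  have s: "sgn w = 1 \<or> sgn w = -1" using w by (auto simp: sgn_if)
  have wsq: "w\<^sup>2 = d2 * r\<^sup>2" using dpos by (simp add: r_def power_divide)
  have M': "p\<^sup>2 + q\<^sup>2 = 2 * c1" "p * q = c2" using M by (auto simp: M2_in_Orb_iff)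
  have c2: "c2 = E \<mu> * (d2 * r\<^sup>2)"
    unfolding M'(2)[symmetric] p' q' wsq[symmetric] E_def by (simp add: power2_eq_square)
  have c1: "2 * c1 = (b1 \<mu> * d1 + b3 \<mu> * d3) * r\<^sup>2"
  proof -
    have "d2 * (w\<^sup>2 * ((e \<mu> 1)\<^sup>2 * (e \<mu> 3)\<^sup>2 + (e \<mu> 2)\<^sup>2 * (e \<mu> 4)\<^sup>2)) = w\<^sup>2 * (b1 \<mu> * d1 + b3 \<mu> * d3)"
      unfolding b1_def b3_def esq[OF order_refl] dd gap_coeff_def by simp algebra
    moreover have "2 * c1 = w\<^sup>2 * ((e \<mu> 1)\<^sup>2 * (e \<mu> 3)\<^sup>2 + (e \<mu> 2)\<^sup>2 * (e \<mu> 4)\<^sup>2)"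
      unfolding M'(1)[symmetric] p' q' by (simp add: power_mult_distrib algebra_simps)
    ultimately have "d2 * (2 * c1) = d2 * ((b1 \<mu> * d1 + b3 \<mu> * d3) * r\<^sup>2)" by (simp add: wsq ac_simps)
    then show ?thesis using dpos by simp
  qed
  have A\<mu>: "A \<mu> = r\<^sup>2" "B \<mu> = r\<^sup>2"
  proof -
    have "c2 / E \<mu> = d2 * r\<^sup>2" using c2 E0[of \<mu>] by simp
    then have "A \<mu> * (d1 * d2) = b3 \<mu> * (d2 * r\<^sup>2) - 2 * c1" "B \<mu> * (d3 * d2) = 2 * c1 - b1 \<mu> * (d2 * r\<^sup>2)"
      using dpos by (simp_all add: A_def B_def)
    then have "A \<mu> * (d1 * d2) = r\<^sup>2 * (d1 * d2)" "B \<mu> * (d3 * d2) = r\<^sup>2 * (d3 * d2)"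
      using c1 b[OF order_refl] dsum by algebra+
    then show "A \<mu> = r\<^sup>2" "B \<mu> = r\<^sup>2" using dpos by simp_all
  qed
  have Elim: "(\<lambda>n. E (m n)) \<longlonglongrightarrow> E \<mu>" unfolding E_def by (intro tendsto_intros elim)
  have "(\<lambda>n. A (m n)) \<longlonglongrightarrow> A \<mu>" "(\<lambda>n. B (m n)) \<longlonglongrightarrow> B \<mu>"
    unfolding A_def B_def b1_def b3_def by (intro tendsto_intros elim Elim; use E0 dpos in simp)+
  then have ABlim: "(\<lambda>n. A (m n)) \<longlonglongrightarrow> r\<^sup>2" "(\<lambda>n. B (m n)) \<longlonglongrightarrow> r\<^sup>2" by (simp_all add: A\<mu>)
  have Hm: "H_factor l (m n) \<noteq> 0" for n
    using H_factor_inj[OF pos, of "m n" \<mu>] H m[of n] by simp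
  show ?thesis
  proof (rule unstable_if_approached_by_euler_tops[OF pos d elim[of 1] elim[of 2] elim[of 3] elim[of 4] ABlim r s,
        where \<epsilon> = 1 and \<mu> = m])
    show "p = sgn w * r * sqrt (gap_coeff l 2) * (e \<mu> 1 * e \<mu> 3)"
      "q = sgn w * r * sqrt (gap_coeff l 2) * (e \<mu> 2 * e \<mu> 4)"
      using p' q' sw unfolding dd by metis+
    have "\<forall>\<^sub>F n in sequentially. A (m n) > 0 \<and> B (m n) > 0"
      using order_tendstoD(1)[OF ABlim(1), of 0] order_tendstoD(1)[OF ABlim(2), of 0] r
      by (simp add: eventually_conj)
    then show "\<forall>\<^sub>F n in sequentially. slice_weights l (m n) 1 1 (e (m n) 1) (e (m n) 2) (e (m n) 3) (e (m n) 4)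
       \<and> H_factor l (m n) \<noteq> 0 \<and> A (m n) > 0 \<and> B (m n) > 0 \<and>
       ((e (m n) 2)\<^sup>2 * (e (m n) 3)\<^sup>2 + (e (m n) 1)\<^sup>2 * (e (m n) 4)\<^sup>2) * (gap_coeff l 1 * A (m n))
       + ((e (m n) 1)\<^sup>2 * (e (m n) 2)\<^sup>2 + (e (m n) 3)\<^sup>2 * (e (m n) 4)\<^sup>2) * (gap_coeff l 3 * B (m n)) = 2 * c1 \<and>
       e (m n) 1 * e (m n) 2 * e (m n) 3 * e (m n) 4 * (gap_coeff l 1 * A (m n) + gap_coeff l 3 * B (m n)) = c2"
    proof (rule eventually_mono)
      fix n assume "A (m n) > 0 \<and> B (m n) > 0"
      moreover have "m n \<le> \<mu>" using m[of n] by simp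
      ultimately show "slice_weights l (m n) 1 1 (e (m n) 1) (e (m n) 2) (e (m n) 3) (e (m n) 4)
       \<and> H_factor l (m n) \<noteq> 0 \<and> A (m n) > 0 \<and> B (m n) > 0 \<and>
       ((e (m n) 2)\<^sup>2 * (e (m n) 3)\<^sup>2 + (e (m n) 1)\<^sup>2 * (e (m n) 4)\<^sup>2) * (gap_coeff l 1 * A (m n))
       + ((e (m n) 1)\<^sup>2 * (e (m n) 2)\<^sup>2 + (e (m n) 3)\<^sup>2 * (e (m n) 4)\<^sup>2) * (gap_coeff l 3 * B (m n)) = 2 * c1 \<and>
       e (m n) 1 * e (m n) 2 * e (m n) 3 * e (m n) 4 * (gap_coeff l 1 * A (m n) + gap_coeff l 3 * B (m n)) = c2"
        using AB[of "m n"] top[of "m n"] Hm[of n] unfolding E_def b1_def b3_def dd by blast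
    qed
  qed (use pq in auto)
qed

text \<open>The parameters of the two linearizations in the frame are \<open>(\<alpha> H_factor \<mu>, \<beta> H_factor \<nu>)\<close> and \<open>(- 2 \<alpha>, - 2 \<beta>)\<close>;
they are independent because the factor of \<open>H\<close> differs on the two slices while that of \<open>I\<close> does not.\<close>

lemma nondegenerate_center_saddle:
  assumes pos: "\<And>i j. i \<noteq> j \<Longrightarrow> l$i + l$j > 0"
    and ord: "(l$1)\<^sup>2 > (l$2)\<^sup>2" "(l$2)\<^sup>2 > (l$3)\<^sup>2" "(l$3)\<^sup>2 > (l$4)\<^sup>2" and pq: "p\<^sup>2 \<noteq> q\<^sup>2"
    and M: "M2 p q \<in> Orb c1 c2"
    and out: "slice_weights l \<mu> \<epsilon> 1 e1 e2 e3 e4" "p = w * (e1 * e3)" "q = w * (e2 * e4)"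
    and inn: "slice_weights l \<nu> \<epsilon>' (-1) f1 f2 f3 f4" "p = v * (f1 * f3)" "q = v * (f2 * f4)"
    and ne: "\<mu> \<noteq> \<nu>"
  shows "nondegenerate l c1 c2 (M2 p q)" "center_saddle l c1 c2 (M2 p q)"
proof -
  let ?M = "M2 p q" and ?T = "tangent_orb (M2 p q)"
  have so4: "N \<in> so4" if "N \<in> Orb c1 c2" for N using that by (simp add: Orb_def)
  obtain \<phi> \<alpha> \<beta> where fr: "symplectic_frame ?T (orb_form ?M) \<phi>" and ab: "\<alpha> \<noteq> 0" "\<beta> \<noteq> 0"
    and L: "\<And>c g h u. euler_top_factor c l \<mu> g \<Longrightarrow> euler_top_factor c l \<nu> h \<Longrightarrow>
       linearized_vf c p q (\<phi> u) = \<phi> (center_saddle_mat (\<alpha> * g) (\<beta> * h) *v u)"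
    using center_saddle_frame[OF ord pq out inn] by blast
  interpret symplectic_frame ?T "orb_form ?M" \<phi> by (rule fr)
  have linH: "linearization c1 c2 (ham_vf (H l)) ?M = Blinfun (linearized_vf (H_coeff l) p q)"
    by (rule linearization_eq[OF M pq]) (simp add: H_eq_energy ham_vf_energy so4)
  have linI: "linearization c1 c2 (ham_vf (I l)) ?M = Blinfun (linearized_vf (I_coeff l) p q)"
    by (rule linearization_eq[OF M pq]) (simp add: I_eq_energy ham_vf_energy so4)
  have app: "blinfun_apply (Blinfun (linearized_vf c p q)) = linearized_vf c p q" for c
    by (simp add: bounded_linear_Blinfun_apply bounded_linear_linearized_vf)
  have "H_factor l \<mu> - H_factor l \<nu> \<noteq> 0" using H_factor_inj[OF pos] ne by simp
  moreover have "(\<alpha> * H_factor l \<mu>) * (\<beta> * (- 2)) - (\<alpha> * (- 2)) * (\<beta> * H_factor l \<nu>)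
      = - 2 * \<alpha> * \<beta> * (H_factor l \<mu> - H_factor l \<nu>)"
    by (simp add: algebra_simps)
  ultimately have indep: "(\<alpha> * H_factor l \<mu>) * (\<beta> * (- 2)) - (\<alpha> * (- 2)) * (\<beta> * H_factor l \<nu>) \<noteq> 0"
    using ab by simp
  note LH = L[OF euler_top_factor_H[OF pos] euler_top_factor_H[OF pos]]
  note LI = L[OF euler_top_factor_I euler_top_factor_I]
  note cartan = cartan_center_saddle_algebra[OF linearized_vf_endo[OF pq] _ linearized_vf_endo[OF pq] _ indep, unfolded app, OF LH LI]
  have alg: "linearized_algebra l c1 c2 ?M = center_saddle_algebra"
    unfolding linearized_algebra_def linH linI by (rule cartan(1))
  show "nondegenerate l c1 c2 ?M"
    unfolding nondegenerate_def alg
    using M cartan(2) energy_critical[OF M pq] rigid_body_eq_quad_vf[OF pos so4[OF M]]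
    by (simp add: H_eq_energy I_eq_energy quad_vf_M2)
  show "center_saddle l c1 c2 ?M"
    unfolding center_saddle_def alg center_saddle_algebra_def using lin bij symp by blast
qed

text \<open>The numerator \<open>N\<close> of \<open>H_factor l\<close> is increasing, and at \<open>(l$4)\<^sup>2\<close> it equals a product of sums
\<open>l$4 + l$i\<close>, hence is positive there. A zero of the factor at the outer root therefore lies strictly below all
\<open>(l$i)\<^sup>2\<close>, where all weights stay positive under a small change of \<open>\<mu>\<close>.\<close>

theorem theorem5p5:
  fixes l :: "real^4" and c1 c2 :: real
  assumes "l$1 > l$2" and "l$2 > l$3" and "l$3 > l$4"
    and "\<And>i j. i \<noteq> j \<Longrightarrow> l$i + l$j > 0"
    and "c1 > \<bar>c2\<bar>"
  shows "\<forall>M \<in> t2 \<inter> Orb c1 c2.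
           nondegenerate l c1 c2 M \<and> center_saddle l c1 c2 M \<and>
           \<not> lyapunov_stable (rigid_body l) (Orb c1 c2) M \<and>
           \<not> lyapunov_stable (rigid_body l) so4 M"
proof
  note pos = assms(4)
  fix M assume "M \<in> t2 \<inter> Orb c1 c2"
  then obtain p q where M: "M = M2 p q" "M2 p q \<in> Orb c1 c2" by (auto simp: t2_def)
  then have pq12: "p\<^sup>2 + q\<^sup>2 = 2 * c1" "p * q = c2" by (auto simp: M2_in_Orb_iff)
  have "p + q \<noteq> 0" "p - q \<noteq> 0"
  proof -
    have "(p + q)\<^sup>2 = 2 * (c1 + c2)" "(p - q)\<^sup>2 = 2 * (c1 - c2)"
      using pq12 by (simp_all add: power2_sum power2_diff)
    then show "p + q \<noteq> 0" "p - q \<noteq> 0" using assms(5) by auto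
  qed
  then have pq: "p\<^sup>2 \<noteq> q\<^sup>2" by (auto simp: power2_eq_iff)
  then have pq0: "p \<noteq> 0 \<or> q \<noteq> 0" by auto
  have l34: "l$3 + l$4 > 0" "l$4 + l$1 > 0" "l$4 + l$2 > 0" "l$4 + l$3 > 0" "l$1 + l$4 > 0" 
    "l$1 + l$2 > 0" "l$1 + l$3 > 0" "l$2 + l$3 > 0"
    using pos by simp_all
  have "l$3 > 0" using l34 assms(3) by simp
  have sq: "(l$i)\<^sup>2 > (l$j)\<^sup>2" if "l$i > l$j" "l$i + l$j > 0" for i j
    using mult_pos_pos[of "l$i - l$j" "l$i + l$j"] that by (simp add: power2_eq_square algebra_simps)
  have ord: "(l$1)\<^sup>2 > (l$2)\<^sup>2" "(l$2)\<^sup>2 > (l$3)\<^sup>2" "(l$3)\<^sup>2 > (l$4)\<^sup>2"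
    using sq assms(1-3) l34 by simp_all
  have d: "gap_coeff l 1 > 0" "gap_coeff l 2 > 0" "gap_coeff l 3 > 0"
    using ord by (simp_all add: gap_coeff_def)
  obtain \<mu> \<nu> where root: "q\<^sup>2 * (((l$1)\<^sup>2 - \<mu>) * ((l$3)\<^sup>2 - \<mu>)) = p\<^sup>2 * (((l$2)\<^sup>2 - \<mu>) * ((l$4)\<^sup>2 - \<mu>))"
    "q\<^sup>2 * (((l$1)\<^sup>2 - \<nu>) * ((l$3)\<^sup>2 - \<nu>)) = p\<^sup>2 * (((l$2)\<^sup>2 - \<nu>) * ((l$4)\<^sup>2 - \<nu>))"
    and \<nu>: "(l$3)\<^sup>2 \<le> \<nu>" "\<nu> \<le> (l$2)\<^sup>2"
    and \<mu>: "q\<^sup>2 < p\<^sup>2 \<and> \<mu> \<le> (l$4)\<^sup>2 \<or> p\<^sup>2 < q\<^sup>2 \<and> (l$1)\<^sup>2 \<le> \<mu>"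
    using interlacing_roots[OF ord pq] by blast
  define \<epsilon> :: real where "\<epsilon> = (if \<mu> \<le> (l$4)\<^sup>2 then 1 else - 1)"
  obtain t v where inn: "p = v * (slice_weight l \<nu> 1 (-1) 1 * slice_weight l \<nu> 1 (-1) 3)"
    "q = v * (slice_weight l \<nu> 1 (-1) 2 * (t * slice_weight l \<nu> 1 (-1) 4))"
    "slice_weights l \<nu> 1 (-1) (slice_weight l \<nu> 1 (-1) 1) (slice_weight l \<nu> 1 (-1) 2) (slice_weight l \<nu> 1 (-1) 3)
       (t * slice_weight l \<nu> 1 (-1) 4)"
    by (rule M2_in_slice[of 1 "-1" l \<nu> q p]) (use root(2) ord \<nu> in \<open>auto simp: order.strict_iff_order\<close>)
  have nz\<mu>: "((l$1)\<^sup>2 - \<mu>) * ((l$3)\<^sup>2 - \<mu>) \<noteq> 0 \<or> ((l$2)\<^sup>2 - \<mu>) * ((l$4)\<^sup>2 - \<mu>) \<noteq> 0"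
    using \<mu> ord by auto
  obtain t w where tsq: "t\<^sup>2 = 1" and out: "p = w * (slice_weight l \<mu> \<epsilon> 1 1 * slice_weight l \<mu> \<epsilon> 1 3)"
    "q = w * (slice_weight l \<mu> \<epsilon> 1 2 * (t * slice_weight l \<mu> \<epsilon> 1 4))"
    "slice_weights l \<mu> \<epsilon> 1 (slice_weight l \<mu> \<epsilon> 1 1) (slice_weight l \<mu> \<epsilon> 1 2) (slice_weight l \<mu> \<epsilon> 1 3)
       (t * slice_weight l \<mu> \<epsilon> 1 4)"
    by (rule M2_in_slice[of \<epsilon> 1 l \<mu> q p]) (use root(1) nz\<mu> ord \<mu> in \<open>auto simp: \<epsilon>_def\<close>)
  have ne: "\<mu> \<noteq> \<nu>" using \<mu> \<nu> ord by auto
  note ndc = nondegenerate_center_saddle[OF pos ord pq M(2) out(3,1,2) inn(3,1,2) ne]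
  have unst: "\<not> lyapunov_stable (rigid_body l) (Orb c1 c2) (M2 p q)"
  proof (cases "H_factor l \<mu> = 0")
    case False
    then show ?thesis
      using unstable_of_nonzero_rate[OF pos d out(3,1,2) pq0 M(2)] by blast
  next
    case True
    define N where "N \<mu> = l$1*l$2*l$3 + l$1*l$2*l$4 + l$1*l$3*l$4 + l$2*l$3*l$4 + \<mu> * (l$1 + l$2 + l$3 + l$4)" for \<mu>
    have S: "l$1 + l$2 + l$3 + l$4 > 0" using l34 by simp
    have mono: "N x \<le> N y" if "x \<le> y" for x y
      unfolding N_def using mult_right_mono[OF that, of "l$1 + l$2 + l$3 + l$4"] S by simp
    have "N \<mu> = 0" using True pos by (auto simp: H_factor_def N_def less_imp_neq[symmetric])
    have "N ((l$4)\<^sup>2) = (l$4 + l$1) * (l$4 + l$2) * (l$4 + l$3)"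
      unfolding N_def by (simp add: power2_eq_square algebra_simps)
    then have N4: "N ((l$4)\<^sup>2) > 0" using l34 by simp
    then have lt: "\<mu> < (l$4)\<^sup>2" using mono[of "(l$4)\<^sup>2" \<mu>] \<open>N \<mu> = 0\<close> by (cases "\<mu> < (l$4)\<^sup>2") auto
    have "\<mu> < (l$i)\<^sup>2" for i
      using lt ord exhaust_4[of i] by auto
    moreover have "\<epsilon> = 1" using lt by (simp add: \<epsilon>_def)
    ultimately show ?thesis
      using unstable_of_zero_rate[OF pos d _ tsq _ _ pq0 M(2) True] out by blast
  qed
  moreover have "Orb c1 c2 \<subseteq> so4" by (auto simp: Orb_def)
  ultimately show "nondegenerate l c1 c2 M \<and> center_saddle l c1 c2 M \<and>
           \<not> lyapunov_stable (rigid_body l) (Orb c1 c2) M \<and>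
           \<not> lyapunov_stable (rigid_body l) so4 M"
    using ndc not_lyapunov_stable_mono unfolding M(1) by blast
qed

end
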